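(* Let $p \ge 2$ and let $\{\hat q^*_n\}_{n\ge 0}$ be a first order minimax optimal sequence of univariate estimators for $r^p_n$ over the alphabet $\mathcal{Y}$, i.e. $\max_{q\in\Delta_{\mathcal Y}} \mathbb{E}_{V^n\sim q}\big[\|q-\hat q^*_n(V^n)\|_p^p\big] = r^p_n(\mathcal Y) + o(r^p_n(\mathcal Y))$ as $n\to\infty$. Then the joint composition $\hat q^{*,m,n}_{XY}$ based on $\{\hat q^*_n\}$ is first order minimax optimal for $R^p_{m,n}$ in the regime $m=o(n)$; that is, along any sequence of pairs $(m,n)$ with $m\to\infty$ and $m/n\to 0$, $$\max_{p_{XY}\in\Delta_{\mathcal X\times\mathcal Y}} \mathbb{E}_{U^n,L^m}\left[\big\|p_{XY}-\hat q^{*,m,n}_{XY}(U^n,L^m)\big\|_p^p\right] = R^p_{m,n}+o\left(R^p_{m,n}\right).$$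
   Context: $\mathcal X,\mathcal Y$ are fixed finite sets, and $\Delta_{\mathcal A}$ denotes the set of probability mass functions on a finite set $\mathcal A$. For functions $f,g$ on a finite set $\mathcal A$, $\|f-g\|_p^p=\sum_{a\in\mathcal A}|f(a)-g(a)|^p$. The univariate minimax risk over a finite alphabet $\mathcal A$ is $$r^p_n(\mathcal A)=\min_{\hat q:\mathcal A^n\to\Delta_{\mathcal A}}\ \max_{q\in\Delta_{\mathcal A}}\ \mathbb E_{V^n}\big[\|q-\hat q(V^n)\|_p^p\big],$$ where $V^n$ consists of $n$ i.i.d. samples from $q$ (for $n=0$ the estimator is a constant). For $p_{XY}\in\Delta_{\mathcal X\times\mathcal Y}$ with marginal $p_X$, let $L^m=\{(X_i',Y_i')\}_{i=1}^m$ be i.i.d. from $p_{XY}$ (complete samples), and let $U^n=\{X_i\}_{i=1}^n$ be i.i.d. from $p_X$ (incomplete samples), independent of $L^m$. The semi-supervised minimax risk is $$R^p_{m,n}=\min_{\hat q_{XY}}\ \max_{p_{XY}}\ \mathbb E_{U^n,L^m}\big[\|p_{XY}-\hat q_{XY}(U^n,L^m)\|_p^p\big],$$ where $\hat q_{XY}$ ranges over maps $\mathcal X^n\times(\mathcal X\times\mathcal Y)^m\to\Delta_{\mathcal X\times\mathcal Y}$. Conditional composition: for a sequence of univariate estimators $\hat q^*_n:\mathcal Y^n\to\Delta_{\mathcal Y}$, $n\ge0$, the conditional estimator $\hat q^{*,m}_{Y\mid X}$ is defined on $l^m=\{(x_i,y_i)\}_{i=1}^m$ by $\hat q^{*,m}_{Y\mid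 X=x}(l^m)=\hat q^*_{n_x}(l_{Y\mid X=x})$ for each $x\in\mathcal X$, where $l_{Y\mid X=x}$ is the collection of the $Y$-values of those samples with $x_i=x$ and $n_x$ is the number of such samples. Joint composition: $\hat q^{*,m,n}_{XY}(u^n,l^m)(x,y)=\hat p_X(x;u^n\cup l^m_X)\,\hat q^{*,m}_{Y\mid X=x}(l^m)(y)$, where $l^m_X$ is the list of $X$-values of $l^m$ and $\hat p_X(\cdot;u^n\cup l_X^m)$ is the empirical distribution (maximum likelihood estimator) of the combined $n+m$ samples of $X$. *)

theory Defs
  imports "HOL-Probability.Probability" "HOL-Library.Landau_Symbols"
begin

text \<open>
  Finite alphabets are types of class \<open>finite\<close>, and probability mass functions on them are
  elements of the type \<open>pmf\<close>. A sample in \<open>A\<^sup>n\<close> is a list of length \<open>n\<close>: the distribution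
  \<^term>\<open>replicate_pmf n q\<close> of \<open>n\<close> i.i.d. draws from \<open>q\<close> is supported on those lists, so the
  values of an estimator on lists of other lengths never matter.
\<close>

definition lp_loss :: "real \<Rightarrow> 'a::finite pmf \<Rightarrow> 'a pmf \<Rightarrow> real" where
  "lp_loss p f g = (\<Sum>a\<in>UNIV. \<bar>pmf f a - pmf g a\<bar> powr p)"

definition max_risk :: "real \<Rightarrow> nat \<Rightarrow> ('a::finite list \<Rightarrow> 'a pmf) \<Rightarrow> real" where
  "max_risk p n qh =
     (SUP q. measure_pmf.expectation (replicate_pmf n q) (\<lambda>v. lp_loss p q (qh v)))"

definition minimax_risk :: "'a::finite itself \<Rightarrow> real \<Rightarrow> nat \<Rightarrow> real" where
  "minimax_risk _ p n = (INF qh :: 'a list \<Rightarrow> 'a pmf. max_risk p n qh)"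

definition semi_sample :: "nat \<Rightarrow> nat \<Rightarrow> ('x \<times> 'y) pmf \<Rightarrow> ('x list \<times> ('x \<times> 'y) list) pmf" where
  "semi_sample m n P = pair_pmf (replicate_pmf n (map_pmf fst P)) (replicate_pmf m P)"

definition semi_max_risk ::
  "real \<Rightarrow> nat \<Rightarrow> nat \<Rightarrow> ('x::finite list \<Rightarrow> ('x \<times> 'y::finite) list \<Rightarrow> ('x \<times> 'y) pmf) \<Rightarrow> real" where
  "semi_max_risk p m n Qh =
     (SUP P. measure_pmf.expectation (semi_sample m n P) (\<lambda>(u, l). lp_loss p P (Qh u l)))"

definition semi_minimax_risk ::
  "'x::finite itself \<Rightarrow> 'y::finite itself \<Rightarrow> real \<Rightarrow> nat \<Rightarrow> nat \<Rightarrow> real" where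
  "semi_minimax_risk _ _ p m n =
     (INF Qh :: 'x list \<Rightarrow> ('x \<times> 'y) list \<Rightarrow> ('x \<times> 'y) pmf. semi_max_risk p m n Qh)"

definition cond_sample :: "'x \<Rightarrow> ('x \<times> 'y) list \<Rightarrow> 'y list" where
  "cond_sample x l = map snd (filter (\<lambda>z. fst z = x) l)"

definition cond_comp :: "(nat \<Rightarrow> 'y list \<Rightarrow> 'y pmf) \<Rightarrow> ('x \<times> 'y) list \<Rightarrow> 'x \<Rightarrow> 'y pmf" where
  "cond_comp qs l x = qs (length (cond_sample x l)) (cond_sample x l)"

text \<open>Unspecified on the empty list, where there is no empirical distribution.\<close>

definition empirical :: "'x list \<Rightarrow> 'x pmf" where
  "empirical xs = pmf_of_multiset (mset xs)"

text \<open>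
  The product of the empirical marginal and the conditional estimator, as a distribution on
  pairs; its mass function is given by \<open>pmf_joint_comp\<close> below.
\<close>

definition joint_comp ::
  "(nat \<Rightarrow> 'y list \<Rightarrow> 'y pmf) \<Rightarrow> 'x list \<Rightarrow> ('x \<times> 'y) list \<Rightarrow> ('x \<times> 'y) pmf" where
  "joint_comp qs u l =
     bind_pmf (empirical (u @ map fst l)) (\<lambda>x. map_pmf (Pair x) (cond_comp qs l x))"

lemma pmf_empirical:
  "xs \<noteq> [] \<Longrightarrow> pmf (empirical xs) x = real (count (mset xs) x) / real (length xs)"
  by (simp add: empirical_def)

lemma pmf_joint_comp:
  "pmf (joint_comp qs u l) (x, y) =
     pmf (empirical (u @ map fst l)) x * pmf (cond_comp qs l x) y"
proof -
  have "pmf (map_pmf (Pair x') (cond_comp qs l x')) (x, y) =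
      pmf (cond_comp qs l x) y * indicator {x} x'" for x'
  proof (cases "x' = x")
    case True
    then show ?thesis by (simp add: pmf_map_inj' inj_def)
  next
    case False
    then have "(x, y) \<notin> set_pmf (map_pmf (Pair x') (cond_comp qs l x'))" by auto
    then have "pmf (map_pmf (Pair x') (cond_comp qs l x')) (x, y) = 0"
      unfolding set_pmf_iff by blast
    with False show ?thesis by simp
  qed
  then show ?thesis by (simp add: joint_comp_def pmf_bind measure_pmf_single mult.commute)
qed

text \<open>
  All losses lie in a fixed bounded interval, so the suprema and infima above range over nonempty
  bounded sets of reals and are genuine.
\<close>

lemma lp_loss_nonneg: "0 \<le> lp_loss p f g"
  by (simp add: lp_loss_def sum_nonneg)

lemma lp_loss_le:
  fixes f g :: "'a::finite pmf"
  assumes "0 \<le> p"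
  shows "lp_loss p f g \<le> real CARD('a)"
proof -
  have "\<bar>pmf f a - pmf g a\<bar> powr p \<le> 1" for a
  proof -
    have "\<bar>pmf f a - pmf g a\<bar> \<le> 1"
      using pmf_nonneg[of f a] pmf_nonneg[of g a] pmf_le_1[of f a] pmf_le_1[of g a] by linarith
    then show ?thesis using powr_mono2[of p "\<bar>pmf f a - pmf g a\<bar>" 1] assms by simp
  qed
  then have "lp_loss p f g \<le> (\<Sum>a\<in>(UNIV::'a set). 1)"
    unfolding lp_loss_def by (intro sum_mono)
  then show ?thesis by simp
qed

lemma expectation_bounds:
  fixes h :: "'b \<Rightarrow> real"
  assumes "\<And>v. 0 \<le> h v" "\<And>v. h v \<le> c"
  shows "0 \<le> measure_pmf.expectation M h" "measure_pmf.expectation M h \<le> c"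
proof -
  have "integrable (measure_pmf M) h"
    using assms by (intro measure_pmf.integrable_const_bound[where B = c]) auto
  then show "measure_pmf.expectation M h \<le> c"
    using assms by (intro measure_pmf.integral_le_const) auto
  show "0 \<le> measure_pmf.expectation M h" using assms by simp
qed

lemma max_risk_bdd:
  fixes qh :: "'a::finite list \<Rightarrow> 'a pmf"
  assumes "0 \<le> p"
  shows "bdd_above (range (\<lambda>q. measure_pmf.expectation (replicate_pmf n q)
           (\<lambda>v. lp_loss p q (qh v))))"
    and "0 \<le> max_risk p n qh"
proof -
  show bdd: "bdd_above (range (\<lambda>q. measure_pmf.expectation (replicate_pmf n q)
           (\<lambda>v. lp_loss p q (qh v))))"
    using assms by (intro bdd_aboveI[where M = "real CARD('a)"])
      (auto intro!: expectation_bounds lp_loss_nonneg lp_loss_le)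
  show "0 \<le> max_risk p n qh"
    unfolding max_risk_def
    by (rule cSUP_upper2[OF bdd UNIV_I]) (auto intro!: lp_loss_nonneg integral_nonneg_AE)
qed

lemma semi_max_risk_bdd:
  fixes Qh :: "'x::finite list \<Rightarrow> ('x \<times> 'y::finite) list \<Rightarrow> ('x \<times> 'y) pmf"
  assumes "0 \<le> p"
  shows "bdd_above (range (\<lambda>P. measure_pmf.expectation (semi_sample m n P)
           (\<lambda>(u, l). lp_loss p P (Qh u l))))"
    and "0 \<le> semi_max_risk p m n Qh"
proof -
  show bdd: "bdd_above (range (\<lambda>P. measure_pmf.expectation (semi_sample m n P)
           (\<lambda>(u, l). lp_loss p P (Qh u l))))"
    using assms by (intro bdd_aboveI[where M = "real CARD('x \<times> 'y)"])
      (auto intro!: expectation_bounds lp_loss_nonneg lp_loss_le simp del: card_prod)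
  show "0 \<le> semi_max_risk p m n Qh"
    unfolding semi_max_risk_def
    by (rule cSUP_upper2[OF bdd UNIV_I]) (auto intro!: lp_loss_nonneg integral_nonneg_AE)
qed

end

theory Submission
  imports Defs
begin

text \<open>
  Write \<open>c\<close> for the absolute \<open>p\<close>-th moment of a standard normal variable and
  \<open>K(A) = c * (SUP q. \<Sum>a. (q a * (1 - q a)) powr (p / 2))\<close> for a finite alphabet \<open>A\<close>. Everything
  rests on the fact that \<open>K(A) * n powr (- p / 2)\<close> is the first order value of the univariate
  minimax risk over \<open>A\<close>, in the following two strong forms.

  \<^item> Upper bound (\<open>empirical_risk_le\<close>). Coordinate by coordinate the empirical distribution has a
    binomial error. A central limit theorem that is uniform in the success probability, together
    with exponential moments, shows that its risk is at most \<open>(K(A) + \<epsilon>) * n powr (- p / 2)\<close>.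

  \<^item> Lower bound (\<open>estimation_risk_ge\<close>). No estimator does better to first order, not even one with
    arbitrary real values. The proof is Bayesian: the log weights of \<open>q\<close> are independent and
    uniform on short intervals, so \<open>q\<close> is their softmax. With all log weights but the \<open>i\<close>-th
    fixed, the log odds of \<open>q i\<close> is uniform on an interval, and the count of the letter \<open>i\<close> is a
    binomial observation in its natural parameter. A Laplace bound for the posterior of this one
    real parameter gives the Gaussian moment \<open>c\<close>.

  If \<open>'y\<close> has at least two letters, then \<open>K('y) > 0\<close> and the semi-supervised risk is of order
  \<open>m powr (- p / 2)\<close>. When the \<open>x\<close>-marginal is a point mass, the unlabelled sample carries no
  information, so the minimax risk is at least \<open>(K('y) - \<epsilon>) * m powr (- p / 2)\<close>
  (\<open>semi_minimax_risk_ge_labelled\<close>). Conversely, the error of the joint composition splits into the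
  error of the marginal, which is of order \<open>(n + m) powr (- p / 2)\<close> and hence negligible when
  \<open>m\<close> is \<open>o(n)\<close>, and the errors of the conditionals. A letter \<open>x\<close> of probability \<open>a\<close> sees about
  \<open>m * a\<close> labelled samples, so it contributes
  \<open>a powr p * K('y) * (m * a) powr (- p / 2) = a powr (p / 2) * K('y) * m powr (- p / 2)\<close>, and
  \<open>\<Sum>x. a x powr (p / 2) \<le> 1\<close> because \<open>p \<ge> 2\<close>. This gives the matching upper bound
  (\<open>joint_comp_max_risk_le\<close>).

  If \<open>'y\<close> is a singleton, then \<open>K('y) = 0\<close> and this argument breaks down. The joint composition is then
  the empirical distribution of \<open>n + m\<close> draws of \<open>x\<close>, and the two facts above, applied to \<open>'x\<close>, give
  the claim with the rate \<open>(n + m) powr (- p / 2)\<close>. When both alphabets are singletons, all risks are zero.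
\<close>

section \<open>Moments of the standardised binomial distribution\<close>

lemma binomial_expectation_power:
  fixes z :: "'b::{banach, second_countable_topology, real_normed_field}"
  assumes "\<theta> \<in> {0..1}"
  shows "measure_pmf.expectation (binomial_pmf n \<theta>) (\<lambda>k. z ^ k)
           = (of_real (1 - \<theta>) + of_real \<theta> * z) ^ n"
proof -
  have "measure_pmf.expectation (binomial_pmf n \<theta>) (\<lambda>k. z ^ k)
          = (\<Sum>k\<le>n. of_nat (n choose k) * (of_real \<theta> * z) ^ k * of_real (1 - \<theta>) ^ (n - k))"
    unfolding expectation_binomial_pmf'[OF assms]
    by (intro sum.cong) (simp_all add: scaleR_conv_of_real power_mult_distrib mult_ac)
  also have "\<dots> = (of_real \<theta> * z + of_real (1 - \<theta>)) ^ n"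
    by (rule binomial_ring[symmetric])
  finally show ?thesis by (simp add: add.commute)
qed

definition binomial_dev :: "nat \<Rightarrow> real \<Rightarrow> nat \<Rightarrow> real" where
  "binomial_dev n \<theta> k = (real k - real n * \<theta>) / sqrt (real n)"

lemma exp_le_quadratic:
  fixes x :: real
  assumes "\<bar>x\<bar> \<le> 1"
  shows "exp x \<le> 1 + x + 2 * x\<^sup>2"
proof -
  obtain t where t: "\<bar>t\<bar> \<le> \<bar>x\<bar>" "exp x = (\<Sum>m<2. x ^ m / fact m) + exp t / fact 2 * x ^ 2"
    using Maclaurin_exp_le[of x 2] by auto
  have "exp t \<le> exp 1" using t(1) assms by simp
  then have "exp t \<le> 4" using exp_le by linarith
  then have "exp t / 2 * x\<^sup>2 \<le> 2 * x\<^sup>2" by (intro mult_right_mono) auto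
  with t(2) show ?thesis by (simp add: numeral_2_eq_2)
qed

text \<open>
  The factor \<open>(1 - \<theta>) * exp (- h * \<theta>) + \<theta> * exp (h * (1 - \<theta>))\<close> of a single centred draw has no
  linear term in \<open>h\<close>, so with \<open>h = s / sqrt n\<close> its \<open>n\<close>-th power stays bounded, uniformly in \<open>\<theta>\<close>.
\<close>

lemma binomial_dev_mgf:
  assumes th: "\<theta> \<in> {0..1}" and "0 < n" and s: "\<bar>s\<bar> \<le> 1"
  shows "measure_pmf.expectation (binomial_pmf n \<theta>) (\<lambda>k. exp (s * binomial_dev n \<theta> k)) \<le> exp 2"
proof -
  define h where "h = s / sqrt (real n)"
  have sq: "sqrt (real n) \<ge> 1" using \<open>0 < n\<close> by simp
  have h1: "\<bar>h\<bar> \<le> 1"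
  proof -
    have "\<bar>h\<bar> = \<bar>s\<bar> / sqrt (real n)" by (simp add: h_def)
    also have "\<dots> \<le> \<bar>s\<bar> / 1" using sq by (intro divide_left_mono) auto
    finally show ?thesis using s by simp
  qed
  have nh: "real n * h\<^sup>2 = s\<^sup>2" using \<open>0 < n\<close> by (simp add: h_def power_divide)
  have "exp (s * binomial_dev n \<theta> k) = exp (- h * \<theta>) ^ n * exp h ^ k" for k
  proof -
    have "s * binomial_dev n \<theta> k = real n * (- h * \<theta>) + real k * h"
      by (simp add: binomial_dev_def h_def diff_divide_distrib algebra_simps)
    then show ?thesis by (simp only: exp_add exp_of_nat_mult)
  qed
  then have "measure_pmf.expectation (binomial_pmf n \<theta>) (\<lambda>k. exp (s * binomial_dev n \<theta> k))
      = exp (- h * \<theta>) ^ n * (1 - \<theta> + \<theta> * exp h) ^ n"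
    using binomial_expectation_power[OF th, of n "exp h"] by simp
  also have "\<dots> = ((1 - \<theta>) * exp (- h * \<theta>) + \<theta> * exp (h * (1 - \<theta>))) ^ n"
  proof -
    have "exp (h * (1 - \<theta>)) = exp (- h * \<theta>) * exp h"
      by (simp flip: exp_add add: algebra_simps)
    then show ?thesis by (simp add: power_mult_distrib[symmetric] algebra_simps)
  qed
  also have "\<dots> \<le> exp (2 * h\<^sup>2) ^ n"
  proof (rule power_mono)
    have b1: "\<bar>- h * \<theta>\<bar> \<le> \<bar>h\<bar>" "\<bar>h * (1 - \<theta>)\<bar> \<le> \<bar>h\<bar>"
      using th by (auto simp: abs_mult intro!: mult_right_le_one_le)
    have b2: "(- h * \<theta>)\<^sup>2 \<le> h\<^sup>2" "(h * (1 - \<theta>))\<^sup>2 \<le> h\<^sup>2"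
      using b1 abs_le_square_iff by blast+
    have "exp (- h * \<theta>) \<le> 1 - h * \<theta> + 2 * h\<^sup>2"
      using exp_le_quadratic[of "- h * \<theta>"] b1 b2 h1 by simp
    moreover have "exp (h * (1 - \<theta>)) \<le> 1 + h * (1 - \<theta>) + 2 * h\<^sup>2"
      using exp_le_quadratic[of "h * (1 - \<theta>)"] b1 b2 h1 by simp
    ultimately have "(1 - \<theta>) * exp (- h * \<theta>) + \<theta> * exp (h * (1 - \<theta>))
        \<le> (1 - \<theta>) * (1 - h * \<theta> + 2 * h\<^sup>2) + \<theta> * (1 + h * (1 - \<theta>) + 2 * h\<^sup>2)"
      using th by (intro add_mono mult_left_mono) auto
    also have "\<dots> = 1 + 2 * h\<^sup>2" by (simp add: algebra_simps)
    also have "\<dots> \<le> exp (2 * h\<^sup>2)" by (rule exp_ge_add_one_self)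
    finally show "(1 - \<theta>) * exp (- h * \<theta>) + \<theta> * exp (h * (1 - \<theta>)) \<le> exp (2 * h\<^sup>2)" .
  qed (use th in auto)
  also have "\<dots> = exp (2 * s\<^sup>2)" using nh by (simp flip: exp_of_nat_mult add: mult_ac)
  also have "\<dots> \<le> exp 2" using s abs_square_le_1 by auto
  finally show ?thesis .
qed

lemma abs_powr_le_exp:
  fixes x s :: real
  assumes "0 < s"
  shows "\<bar>x\<bar> powr s \<le> s powr s * (exp x + exp (- x))"
proof -
  have "\<bar>x\<bar> / s \<le> exp (\<bar>x\<bar> / s)" using exp_ge_add_one_self[of "\<bar>x\<bar> / s"] by linarith
  then have "(\<bar>x\<bar> / s) powr s \<le> exp (\<bar>x\<bar> / s) powr s"
    using assms by (intro powr_mono2) auto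
  also have "\<dots> = exp \<bar>x\<bar>" using assms by (simp add: exp_powr_real)
  also have "\<dots> \<le> exp x + exp (- x)" by (auto simp: abs_if)
  finally have "s powr s * (\<bar>x\<bar> / s) powr s \<le> s powr s * (exp x + exp (- x))"
    by (intro mult_left_mono) auto
  then show ?thesis using assms by (simp add: powr_divide)
qed

lemma binomial_dev_moment_le:
  assumes th: "\<theta> \<in> {0..1}" and "0 < n" and "0 < s"
  shows "measure_pmf.expectation (binomial_pmf n \<theta>) (\<lambda>k. \<bar>binomial_dev n \<theta> k\<bar> powr s)
           \<le> s powr s * (2 * exp 2)"
proof -
  let ?E = "measure_pmf.expectation (binomial_pmf n \<theta>)"
  have "?E (\<lambda>k. \<bar>binomial_dev n \<theta> k\<bar> powr s)
      \<le> ?E (\<lambda>k. s powr s * (exp (1 * binomial_dev n \<theta> k) + exp (-1 * binomial_dev n \<theta> k)))"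
    using abs_powr_le_exp[OF \<open>0 < s\<close>] th by (intro integral_mono) auto
  also have "\<dots> = s powr s * (?E (\<lambda>k. exp (1 * binomial_dev n \<theta> k))
                             + ?E (\<lambda>k. exp (-1 * binomial_dev n \<theta> k)))"
    using th by (simp add: integral_add del: mult_minus1)
  also have "\<dots> \<le> s powr s * (exp 2 + exp 2)"
    using binomial_dev_mgf[OF th \<open>0 < n\<close>, of 1] binomial_dev_mgf[OF th \<open>0 < n\<close>, of "-1"]
    by (intro mult_left_mono add_mono) auto
  finally show ?thesis by simp
qed

lemma iexp_quadratic_approx:
  "cmod (iexp x - (1 + \<i> * of_real x - of_real (x\<^sup>2 / 2))) \<le> \<bar>x\<bar> ^ 3"
proof -
  have "cmod (iexp x - (\<Sum>k\<le>2. (\<i> * x)^k / fact k)) \<le> \<bar>x\<bar>^(Suc 2) / fact (Suc 2)"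
    by (rule iexp_approx1)
  also have "(\<Sum>k\<le>2. (\<i> * complex_of_real x)^k / fact k) = 1 + \<i> * of_real x - of_real (x\<^sup>2 / 2)"
    by (simp add: numeral_2_eq_2 power2_eq_square[symmetric] power_mult_distrib del: power_Suc)
  also have "\<bar>x\<bar>^(Suc 2) / fact (Suc 2) \<le> \<bar>x\<bar> ^ 3"
    using zero_le_power[of "\<bar>x\<bar>" 3] by (simp add: fact_numeral)
  finally show ?thesis .
qed

lemma centered_bernoulli_char_approx:
  assumes th: "\<theta> \<in> {0..1}"
  shows "cmod ((of_real (1 - \<theta>) * iexp (- s * \<theta>) + of_real \<theta> * iexp (s * (1 - \<theta>)))
              - of_real (exp (- (s\<^sup>2 * (\<theta> * (1 - \<theta>)) / 2)))) \<le> \<bar>s\<bar> ^ 3 + s ^ 4"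
proof -
  define A where "A = iexp (- s * \<theta>) - (1 + \<i> * of_real (- s * \<theta>) - of_real ((- s * \<theta>)\<^sup>2 / 2))"
  define B where "B = iexp (s * (1 - \<theta>)) - (1 + \<i> * of_real (s * (1 - \<theta>)) - of_real ((s * (1 - \<theta>))\<^sup>2 / 2))"
  define v where "v = s\<^sup>2 * (\<theta> * (1 - \<theta>)) / 2"
  have v0: "0 \<le> v" using th by (simp add: v_def)
  have v1: "v \<le> s\<^sup>2"
  proof -
    have "\<theta> * (1 - \<theta>) \<le> 1 * 1" using th by (intro mult_mono) auto
    then have "s\<^sup>2 * (\<theta> * (1 - \<theta>)) \<le> s\<^sup>2 * 1" by (intro mult_left_mono) auto
    then show ?thesis using zero_le_power2[of s] unfolding v_def by linarith
  qed
  have eq: "(of_real (1 - \<theta>) * iexp (- s * \<theta>) + of_real \<theta> * iexp (s * (1 - \<theta>))) - of_real (exp (- v))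
      = of_real (1 - \<theta>) * A + of_real \<theta> * B + of_real (1 - v - exp (- v))"
    unfolding A_def B_def v_def
    by (simp add: algebra_simps power2_eq_square) (simp add: field_simps)
  have A3: "cmod A \<le> \<bar>s\<bar> ^ 3"
  proof -
    have "cmod A \<le> \<bar>- s * \<theta>\<bar> ^ 3" unfolding A_def by (rule iexp_quadratic_approx)
    also have "\<dots> \<le> \<bar>s\<bar> ^ 3"
      using th by (intro power_mono) (auto simp: abs_mult intro!: mult_right_le_one_le)
    finally show ?thesis .
  qed
  have B3: "cmod B \<le> \<bar>s\<bar> ^ 3"
  proof -
    have "cmod B \<le> \<bar>s * (1 - \<theta>)\<bar> ^ 3" unfolding B_def by (rule iexp_quadratic_approx)
    also have "\<dots> \<le> \<bar>s\<bar> ^ 3"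
      using th by (intro power_mono) (auto simp: abs_mult intro!: mult_right_le_one_le)
    finally show ?thesis .
  qed
  have E: "\<bar>1 - v - exp (- v)\<bar> \<le> s ^ 4"
  proof -
    have l: "1 - v \<le> exp (- v)" using exp_ge_add_one_self[of "- v"] by simp
    have "exp (- v) \<le> 1 - v + v\<^sup>2"
    proof -
      have "exp (- v) * exp v = 1" by (simp flip: exp_add)
      have "1 \<le> (1 - v + v\<^sup>2) * (1 + v)"
        using v0 by (simp add: algebra_simps power2_eq_square)
      also have "\<dots> \<le> (1 - v + v\<^sup>2) * exp v"
      proof (intro mult_left_mono)
        have "0 \<le> (v - 1/2)\<^sup>2" by simp
        then show "0 \<le> 1 - v + v\<^sup>2" by (simp add: power2_eq_square algebra_simps)
      qed (use exp_ge_add_one_self[of v] in simp)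
      finally have "exp (- v) * 1 \<le> exp (- v) * ((1 - v + v\<^sup>2) * exp v)" by (intro mult_left_mono) auto
      also have "\<dots> = (1 - v + v\<^sup>2) * (exp (- v) * exp v)" by (simp only: mult_ac)
      finally show ?thesis using \<open>exp (- v) * exp v = 1\<close> by simp
    qed
    moreover have "v\<^sup>2 \<le> s ^ 4" using power_mono[OF v1 v0, of 2] by (simp flip: power_mult)
    ultimately show ?thesis using l by simp
  qed
  have "cmod (of_real (1 - \<theta>) * A + of_real \<theta> * B + of_real (1 - v - exp (- v)))
      \<le> cmod (of_real (1 - \<theta>) * A) + cmod (of_real \<theta> * B) + cmod (of_real (1 - v - exp (- v)))"
    by (meson norm_triangle_ineq order_trans add_right_mono)
  also have "\<dots> = (1 - \<theta>) * cmod A + \<theta> * cmod B + \<bar>1 - v - exp (- v)\<bar>"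
    using th by (simp only: norm_mult norm_of_real) simp
  also have "\<dots> \<le> (1 - \<theta>) * \<bar>s\<bar> ^ 3 + \<theta> * \<bar>s\<bar> ^ 3 + s ^ 4"
    using th A3 B3 E by (intro add_mono mult_left_mono) auto
  also have "\<dots> = \<bar>s\<bar> ^ 3 + s ^ 4" by (simp add: algebra_simps)
  finally show ?thesis unfolding v_def[symmetric] eq .
qed

lemma binomial_dev_char:
  fixes t :: real
  assumes th: "\<theta> \<in> {0..1}" and "0 < n"
  defines "s \<equiv> t / sqrt (real n)"
  shows "char (distr (binomial_pmf n \<theta>) borel (binomial_dev n \<theta>)) t
           = (of_real (1 - \<theta>) * iexp (- s * \<theta>) + of_real \<theta> * iexp (s * (1 - \<theta>))) ^ n"
proof -
  have "char (distr (binomial_pmf n \<theta>) borel (binomial_dev n \<theta>)) t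
      = measure_pmf.expectation (binomial_pmf n \<theta>) (\<lambda>k. iexp (t * binomial_dev n \<theta> k))"
    unfolding char_def by (subst integral_distr) auto
  also have "(\<lambda>k. iexp (t * binomial_dev n \<theta> k)) = (\<lambda>k. iexp (- s * \<theta>) ^ n * iexp s ^ k)"
  proof
    fix k
    have e: "t * binomial_dev n \<theta> k = real n * (- s * \<theta>) + real k * s"
      using \<open>0 < n\<close> by (simp add: binomial_dev_def s_def field_simps)
    show "iexp (t * binomial_dev n \<theta> k) = iexp (- s * \<theta>) ^ n * iexp s ^ k"
      unfolding e by (simp add: exp_add[symmetric] exp_of_nat_mult[symmetric] algebra_simps)
  qed
  also have "measure_pmf.expectation (binomial_pmf n \<theta>) (\<lambda>k. iexp (- s * \<theta>) ^ n * iexp s ^ k)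
      = iexp (- s * \<theta>) ^ n * (of_real (1 - \<theta>) + of_real \<theta> * iexp s) ^ n"
    using binomial_expectation_power[OF th, of n "iexp s"] by simp
  also have "\<dots> = (of_real (1 - \<theta>) * iexp (- s * \<theta>) + of_real \<theta> * iexp (s * (1 - \<theta>))) ^ n"
  proof -
    have "iexp (s * (1 - \<theta>)) = iexp (- s * \<theta>) * iexp s"
      by (simp flip: exp_add add: algebra_simps)
    then show ?thesis by (simp add: power_mult_distrib[symmetric] algebra_simps)
  qed
  finally show ?thesis .
qed

text \<open>
  The central limit theorem for a triangular array: \<open>\<theta>\<close> may vary with \<open>j\<close>, and its limit may be
  \<open>0\<close> or \<open>1\<close>, in which case the limit law is degenerate. The characteristic function is an \<open>n\<close>-th
  power, and replacing its base by the Gaussian one costs at most \<open>n\<close> times the error of the base.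
\<close>

lemma binomial_dev_char_tendsto:
  assumes N: "filterlim N at_top sequentially"
    and th: "\<And>j. \<theta> j \<in> {0..1}" and lim: "\<theta> \<longlonglongrightarrow> \<theta>'"
  shows "(\<lambda>j. char (distr (binomial_pmf (N j) (\<theta> j)) borel (binomial_dev (N j) (\<theta> j))) t)
           \<longlonglongrightarrow> of_real (exp (- (t\<^sup>2 * (\<theta>' * (1 - \<theta>')) / 2)))"
proof -
  let ?f = "\<lambda>j. char (distr (binomial_pmf (N j) (\<theta> j)) borel (binomial_dev (N j) (\<theta> j))) t"
  let ?g = "\<lambda>j. complex_of_real (exp (- (t\<^sup>2 * (\<theta> j * (1 - \<theta> j)) / 2)))"
  have glim: "?g \<longlonglongrightarrow> of_real (exp (- (t\<^sup>2 * (\<theta>' * (1 - \<theta>')) / 2)))"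
    by (intro tendsto_intros lim) simp_all
  have pos: "eventually (\<lambda>j. 0 < N j) sequentially"
    using N by (rule eventually_compose_filterlim[OF eventually_gt_at_top])
  have bound: "eventually (\<lambda>j. norm (?f j - ?g j) \<le> \<bar>t\<bar> ^ 3 / sqrt (N j) + t ^ 4 / N j) sequentially"
    using pos
  proof eventually_elim
    case (elim j)
    define n s where "n = N j" and "s = t / sqrt (real n)"
    have n: "0 < n" using elim by (simp add: n_def)
    define z where "z = of_real (1 - \<theta> j) * iexp (- s * \<theta> j) + of_real (\<theta> j) * iexp (s * (1 - \<theta> j))"
    define w where "w = exp (- (s\<^sup>2 * (\<theta> j * (1 - \<theta> j)) / 2))"
    have f: "?f j = z ^ n" using binomial_dev_char[OF th n, of j t] by (simp add: n_def s_def z_def)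
    have "real n * s\<^sup>2 = t\<^sup>2" using n by (simp add: s_def power_divide)
    then have g: "?g j = of_real w ^ n"
      by (simp add: w_def exp_of_nat_mult[symmetric] flip: of_real_power)
    have z1: "cmod z \<le> 1"
    proof -
      have "cmod z \<le> cmod (of_real (1 - \<theta> j) * iexp (- s * \<theta> j)) + cmod (of_real (\<theta> j) * iexp (s * (1 - \<theta> j)))"
        unfolding z_def by (rule norm_triangle_ineq)
      also have "\<dots> = (1 - \<theta> j) + \<theta> j" using th[of j] by (simp only: norm_mult norm_of_real norm_exp_i_times) simp
      finally show ?thesis by simp
    qed
    have w1: "cmod (of_real w) \<le> 1" using th[of j] by (simp add: w_def)
    have "norm (?f j - ?g j) \<le> n * cmod (z - of_real w)"
      unfolding f g by (rule norm_power_diff[OF z1 w1])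
    also have "\<dots> \<le> n * (\<bar>s\<bar> ^ 3 + s ^ 4)"
      using centered_bernoulli_char_approx[of "\<theta> j" s] th[of j] by (intro mult_left_mono) (auto simp: z_def w_def)
    also have "\<dots> = \<bar>t\<bar> ^ 3 / sqrt n + t ^ 4 / n"
    proof -
      have "real n * \<bar>s\<bar> ^ 3 = \<bar>t\<bar> ^ 3 * (real n / (sqrt (real n) ^ 3))"
        by (simp add: s_def power_divide)
      also have "real n / sqrt (real n) ^ 3 = 1 / sqrt (real n)"
        using n by (simp add: power3_eq_cube)
      finally have a: "real n * \<bar>s\<bar> ^ 3 = \<bar>t\<bar> ^ 3 / sqrt n" by simp
      have "sqrt (real n) ^ 4 = real n ^ 2"
        using power_mult[of "sqrt (real n)" 2 2] by simp
      then have "real n * s ^ 4 = t ^ 4 / n"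
        using n by (simp add: s_def power_divide power2_eq_square)
      with a show ?thesis by (simp add: distrib_left)
    qed
    finally show ?case by (simp add: n_def)
  qed
  have sN: "filterlim (\<lambda>j. real (N j)) at_top sequentially"
    using filterlim_compose[OF filterlim_real_sequentially N] .
  have "(\<lambda>j. \<bar>t\<bar> ^ 3 / sqrt (N j) + t ^ 4 / N j) \<longlonglongrightarrow> 0 + 0"
    by (intro tendsto_add tendsto_divide_0[OF tendsto_const] filterlim_at_top_imp_at_infinity sN
        filterlim_compose[OF sqrt_at_top sN])
  then have "(\<lambda>j. ?f j - ?g j) \<longlonglongrightarrow> 0"
    using bound by (intro Lim_null_comparison[OF bound]) simp
  from tendsto_add[OF this glim] show ?thesis by simp
qed


definition gauss_abs_moment :: "real \<Rightarrow> real" where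
  "gauss_abs_moment p = (LINT x|std_normal_distribution. \<bar>x\<bar> powr p)"

lemma continuous_abs_powr:
  fixes p :: real
  assumes "0 < p"
  shows "continuous_on UNIV (\<lambda>x::real. \<bar>x\<bar> powr p)"
  using assms by (intro continuous_on_powr' continuous_intros) auto

lemma integrable_gauss_abs_moment:
  assumes "0 \<le> p"
  shows "integrable std_normal_distribution (\<lambda>x. \<bar>x\<bar> powr p)"
proof -
  define k where "k = nat \<lceil>p\<rceil>"
  have k: "p \<le> real (2 * k)" unfolding k_def using assms by linarith
  have "integrable std_normal_distribution (\<lambda>x. 1 + x ^ (2 * k))"
  proof (intro Bochner_Integration.integrable_add std_normal_distribution_even_moments(2))
    show "integrable std_normal_distribution (\<lambda>x. 1 :: real)"
      by (intro finite_measure.integrable_const prob_space.finite_measure prob_space_normal_density) simp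
  qed
  then show ?thesis
  proof (rule Bochner_Integration.integrable_bound)
    have "\<bar>x\<bar> powr p \<le> 1 + x ^ (2 * k)" for x :: real
    proof (cases "\<bar>x\<bar> \<le> 1")
      case True
      then have "\<bar>x\<bar> powr p \<le> 1" using powr_mono2[of p "\<bar>x\<bar>" 1] assms by simp
      then show ?thesis by (simp add: add_increasing2)
    next
      case False
      then have "\<bar>x\<bar> powr p \<le> \<bar>x\<bar> powr real (2 * k)" using k by (intro powr_mono) auto
      also have "\<dots> = x ^ (2 * k)" using False by (subst powr_realpow) (auto simp: power_even_abs)
      finally show ?thesis by simp
    qed
    then show "AE x in std_normal_distribution. norm (\<bar>x\<bar> powr p) \<le> norm (1 + x ^ (2 * k))"
      by (intro AE_I2) (simp add: add_nonneg_nonneg)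
  qed simp
qed

lemma real_distribution_binomial_dev:
  "real_distribution (distr (binomial_pmf n \<theta>) borel (binomial_dev n \<theta>))"
  by (intro real_distribution.intro prob_space.prob_space_distr
      real_distribution_axioms.intro measure_pmf.prob_space_axioms) auto

text \<open>
  Weak convergence only controls bounded continuous functions. The part of \<open>\<bar>x\<bar> powr p\<close> above a
  level \<open>B\<close> is at most \<open>\<bar>x\<bar> powr (2 * p) / B\<close>, whose expectation is small uniformly in \<open>j\<close> by the
  exponential moments.
\<close>

lemma binomial_dev_moment_limsup:
  assumes N: "filterlim N at_top sequentially"
    and th: "\<And>j. \<theta> j \<in> {0..1}" and lim: "\<theta> \<longlonglongrightarrow> \<theta>'" and p: "0 < p" and \<epsilon>: "0 < \<epsilon>"
  shows "eventually (\<lambda>j. measure_pmf.expectation (binomial_pmf (N j) (\<theta> j))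
             (\<lambda>k. \<bar>binomial_dev (N j) (\<theta> j) k\<bar> powr p)
           \<le> (\<theta>' * (1 - \<theta>')) powr (p / 2) * gauss_abs_moment p + \<epsilon>) sequentially"
proof -
  define v where "v = \<theta>' * (1 - \<theta>')"
  have "\<theta>' \<in> {0..1}"
    using closed_sequentially[OF closed_real_atLeastAtMost _ lim] th by auto
  then have v0: "0 \<le> v" by (simp add: v_def)
  define M where "M = (\<lambda>j. distr (binomial_pmf (N j) (\<theta> j)) borel (binomial_dev (N j) (\<theta> j)))"
  define M' where "M' = distr std_normal_distribution borel (\<lambda>x. sqrt v * x)"
  interpret Z: prob_space std_normal_distribution using prob_space_normal_density[of 1 0] by simp
  have RM: "real_distribution (M j)" for j unfolding M_def by (rule real_distribution_binomial_dev)
  have RM': "real_distribution M'" unfolding M'_def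
    by (intro real_distribution.intro Z.prob_space_distr real_distribution_axioms.intro) auto
  have char': "char M' t = of_real (exp (- (t\<^sup>2 * v / 2)))" for t
  proof -
    have "char M' t = char std_normal_distribution (t * sqrt v)"
      unfolding M'_def char_def by (subst integral_distr) (auto simp: mult_ac)
    then show ?thesis using v0 by (simp add: char_std_normal_distribution power_mult_distrib)
  qed
  have wc: "weak_conv_m M M'"
  proof (rule levy_continuity[OF RM RM'])
    show "(\<lambda>j. char (M j) t) \<longlonglongrightarrow> char M' t" for t
      unfolding char' M_def v_def by (rule binomial_dev_char_tendsto[OF N th lim])
  qed
  \<comment> \<open>\<open>K\<close> bounds all moments of order \<open>2 * p\<close>, and \<open>B\<close> makes the part above the level at most \<open>\<epsilon> / 2\<close>.\<close>
  define K where "K = (2 * p) powr (2 * p) * (2 * exp 2)"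
  have K0: "0 < K" using p by (simp add: K_def)
  define B where "B = 2 * K / \<epsilon>"
  have B0: "0 < B" using K0 \<epsilon> by (simp add: B_def)
  define g where "g = (\<lambda>x::real. min (\<bar>x\<bar> powr p) B)"
  have gint: "integrable std_normal_distribution (\<lambda>x. g (sqrt v * x))"
    using B0 by (intro Z.integrable_const_bound[where B = B]) (auto simp: g_def)
  have "(\<lambda>j. integral\<^sup>L (M j) g) \<longlonglongrightarrow> integral\<^sup>L M' g"
  proof (rule weak_conv_imp_integral_bdd_continuous_conv[OF RM RM' wc])
    have "continuous_on UNIV g" unfolding g_def
      by (intro continuous_intros continuous_abs_powr p)
    then show "isCont g x" for x by (simp add: continuous_on_eq_continuous_at)
    show "norm (g x) \<le> B" for x using B0 by (simp add: g_def)
  qed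
  moreover have "integral\<^sup>L M' g \<le> v powr (p / 2) * gauss_abs_moment p"
  proof -
    have "integral\<^sup>L M' g = (LINT x|std_normal_distribution. g (sqrt v * x))"
      unfolding M'_def by (subst integral_distr) (auto simp: g_def)
    also have "\<dots> \<le> (LINT x|std_normal_distribution. v powr (p / 2) * \<bar>x\<bar> powr p)"
    proof (intro integral_mono integrable_mult_right integrable_gauss_abs_moment gint)
      fix x
      have "g (sqrt v * x) \<le> \<bar>sqrt v * x\<bar> powr p" by (simp add: g_def)
      also have "\<dots> = v powr (p / 2) * \<bar>x\<bar> powr p"
        using v0 by (simp add: abs_mult powr_mult powr_half_sqrt[symmetric] powr_powr)
      finally show "g (sqrt v * x) \<le> v powr (p / 2) * \<bar>x\<bar> powr p" .
    qed (use p in auto)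
    finally show ?thesis by (simp add: gauss_abs_moment_def)
  qed
  ultimately have "eventually (\<lambda>j. integral\<^sup>L (M j) g < v powr (p / 2) * gauss_abs_moment p + \<epsilon> / 2) sequentially"
    using \<epsilon> by (intro order_tendstoD) auto
  moreover have "eventually (\<lambda>j. 0 < N j) sequentially"
    using N by (rule eventually_compose_filterlim[OF eventually_gt_at_top])
  ultimately show ?thesis
  proof eventually_elim
    case (elim j)
    let ?d = "binomial_dev (N j) (\<theta> j)"
    let ?E = "measure_pmf.expectation (binomial_pmf (N j) (\<theta> j))"
    have tr: "\<bar>x\<bar> powr p \<le> g x + \<bar>x\<bar> powr (2 * p) / B" for x :: real
    proof (cases "\<bar>x\<bar> powr p \<le> B")
      case False
      have "\<bar>x\<bar> powr p * B \<le> \<bar>x\<bar> powr p * \<bar>x\<bar> powr p" using False by (intro mult_left_mono) auto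
      then have "\<bar>x\<bar> powr p * B \<le> \<bar>x\<bar> powr (2 * p)" by (simp flip: powr_add)
      then have "\<bar>x\<bar> powr p \<le> \<bar>x\<bar> powr (2 * p) / B" using B0 by (simp add: field_simps)
      then show ?thesis using B0 by (simp add: g_def min_def)
    qed (use B0 in \<open>simp add: g_def\<close>)
    have "?E (\<lambda>k. \<bar>?d k\<bar> powr p) \<le> ?E (\<lambda>k. g (?d k) + \<bar>?d k\<bar> powr (2 * p) / B)"
      using th by (intro integral_mono tr) auto
    also have "\<dots> = ?E (\<lambda>k. g (?d k)) + ?E (\<lambda>k. \<bar>?d k\<bar> powr (2 * p)) / B"
      using th by (subst Bochner_Integration.integral_add) auto
    also have "?E (\<lambda>k. g (?d k)) = integral\<^sup>L (M j) g"
      unfolding M_def by (subst integral_distr) (auto simp: g_def)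
    also have "?E (\<lambda>k. \<bar>?d k\<bar> powr (2 * p)) / B \<le> K / B"
      using binomial_dev_moment_le[OF th elim(2), of "2 * p" j] p B0
      by (intro divide_right_mono) (auto simp: K_def)
    also have "K / B = \<epsilon> / 2" using K0 \<epsilon> by (simp add: B_def)
    finally show ?case using elim(1) by (simp add: v_def)
  qed
qed

text \<open>
  Uniformity in \<open>\<theta>\<close> comes from compactness of the unit interval: a sequence of violations would
  have a convergent subsequence and contradict the triangular limit.
\<close>

lemma binomial_dev_moment_uniform:
  assumes p: "0 < p" and \<epsilon>: "0 < \<epsilon>"
  shows "eventually (\<lambda>n. \<forall>\<theta>\<in>{0..1}. measure_pmf.expectation (binomial_pmf n \<theta>)
             (\<lambda>k. \<bar>binomial_dev n \<theta> k\<bar> powr p)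
           \<le> (\<theta> * (1 - \<theta>)) powr (p / 2) * gauss_abs_moment p + \<epsilon>) sequentially"
proof (rule ccontr)
  let ?E = "\<lambda>n \<theta>. measure_pmf.expectation (binomial_pmf n \<theta>) (\<lambda>k. \<bar>binomial_dev n \<theta> k\<bar> powr p)"
  let ?L = "\<lambda>\<theta>. (\<theta> * (1 - \<theta>)) powr (p / 2) * gauss_abs_moment p"
  assume "\<not> ?thesis"
  then have "\<exists>n\<ge>j. \<exists>\<theta>\<in>{0..1}. ?L \<theta> + \<epsilon> < ?E n \<theta>" for j
    unfolding eventually_sequentially by (metis not_le)
  then obtain N \<theta> where NT: "\<And>j. N j \<ge> j" "\<And>j. \<theta> j \<in> {0..1}" "\<And>j. ?L (\<theta> j) + \<epsilon> < ?E (N j) (\<theta> j)"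
    by metis
  have "seq_compact {0..1::real}" by (simp add: compact_imp_seq_compact)
  then obtain \<theta>' r where r: "\<theta>' \<in> {0..1}" "strict_mono r" "(\<theta> \<circ> r) \<longlonglongrightarrow> \<theta>'"
    using NT(2) by (metis seq_compactE)
  have lim: "(\<lambda>j. \<theta> (r j)) \<longlonglongrightarrow> \<theta>'" using r(3) by (simp add: o_def)
  have Nr: "filterlim (\<lambda>j. N (r j)) at_top sequentially"
  proof (rule filterlim_at_top_mono[OF filterlim_ident])
    show "eventually (\<lambda>j. j \<le> N (r j)) sequentially"
      using NT(1) seq_suble[OF r(2)] by (intro always_eventually) (meson order_trans)
  qed
  have "eventually (\<lambda>j. ?E (N (r j)) (\<theta> (r j)) \<le> ?L \<theta>' + \<epsilon> / 2) sequentially"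
    using NT(2) \<epsilon> by (intro binomial_dev_moment_limsup[OF Nr _ lim p]) auto
  moreover have "(\<lambda>j. ?L (\<theta> (r j))) \<longlonglongrightarrow> ?L \<theta>'"
  proof (rule tendsto_mult_right)
    show "(\<lambda>j. (\<theta> (r j) * (1 - \<theta> (r j))) powr (p / 2)) \<longlonglongrightarrow> (\<theta>' * (1 - \<theta>')) powr (p / 2)"
      using p NT(2) by (intro tendsto_powr' tendsto_intros lim) auto
  qed
  then have "eventually (\<lambda>j. ?L \<theta>' - \<epsilon> / 2 < ?L (\<theta> (r j))) sequentially"
    using \<epsilon> by (intro order_tendstoD) auto
  ultimately have "eventually (\<lambda>j. False) sequentially"
  proof eventually_elim
    case (elim j)
    with NT(3)[of "r j"] show ?case by linarith
  qed
  then show False by simp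
qed

section \<open>The risk of the empirical distribution\<close>

lemma map_pmf_eq_bernoulli:
  "map_pmf P q = bernoulli_pmf (measure_pmf.prob q {x. P x})"
proof (rule pmf_eqI)
  fix b :: bool
  have "pmf (map_pmf P q) True = measure_pmf.prob q {x. P x}"
    by (simp add: pmf_map vimage_def)
  moreover have "pmf (map_pmf P q) False = 1 - measure_pmf.prob q {x. P x}"
    using measure_pmf.prob_compl[of "{x. P x}" q]
    by (simp add: pmf_map vimage_def Collect_neg_eq Compl_eq_Diff_UNIV)
  ultimately show "pmf (map_pmf P q) b = pmf (bernoulli_pmf (measure_pmf.prob q {x. P x})) b"
    by (cases b) auto
qed

lemma map_replicate_pmf: "map_pmf (map f) (replicate_pmf n q) = replicate_pmf n (map_pmf f q)"
proof (induction n)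
  case (Suc n)
  then show ?case by (simp add: map_bind_pmf bind_map_pmf flip: Suc.IH)
qed simp

lemma filter_length_replicate_pmf:
  "map_pmf (\<lambda>v. length (filter P v)) (replicate_pmf n q)
     = binomial_pmf n (measure_pmf.prob q {x. P x})"
proof -
  have "binomial_pmf n (measure_pmf.prob q {x. P x})
      = map_pmf (length \<circ> filter id) (replicate_pmf n (map_pmf P q))"
    by (subst binomial_pmf_altdef) (auto simp: map_pmf_eq_bernoulli)
  also have "\<dots> = map_pmf (\<lambda>v. length (filter P v)) (replicate_pmf n q)"
    by (simp flip: map_replicate_pmf add: pmf.map_comp o_def filter_map)
  finally show ?thesis ..
qed

lemma count_replicate_pmf:
  "map_pmf (\<lambda>v. count (mset v) a) (replicate_pmf n q) = binomial_pmf n (pmf q a)"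
proof -
  have "(\<lambda>v. count (mset v) a) = (\<lambda>v. length (filter (\<lambda>x. x = a) v))"
  proof
    show "count (mset v) a = length (filter (\<lambda>x. x = a) v)" for v by (induction v) auto
  qed
  then show ?thesis by (simp add: filter_length_replicate_pmf pmf.rep_eq)
qed

lemma finite_set_replicate_pmf [simp]:
  "finite (set_pmf (replicate_pmf n (q :: 'a::finite pmf)))"
proof (rule finite_subset)
  show "set_pmf (replicate_pmf n q) \<subseteq> {xs. set xs \<subseteq> UNIV \<and> length xs = n}"
    by (auto simp: set_replicate_pmf)
  show "finite {xs :: 'a list. set xs \<subseteq> UNIV \<and> length xs = n}" by (rule finite_lists_length_eq) simp
qed

text \<open>
  The limit of \<open>n powr (p / 2)\<close> times the univariate minimax risk, for \<open>p \<ge> 1\<close>. The supremum selects the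
  least favourable distribution.
\<close>

definition sharp_risk_const :: "'a::finite itself \<Rightarrow> real \<Rightarrow> real" where
  "sharp_risk_const _ p = gauss_abs_moment p *
     (SUP q :: 'a pmf. \<Sum>a\<in>UNIV. (pmf q a * (1 - pmf q a)) powr (p / 2))"

lemma gauss_abs_moment_nonneg: "0 \<le> gauss_abs_moment p"
  unfolding gauss_abs_moment_def by (intro integral_nonneg_AE) auto

lemma multinomial_variance_powr_bdd:
  assumes "0 \<le> p"
  shows "bdd_above (range (\<lambda>q :: 'a::finite pmf. \<Sum>a\<in>UNIV. (pmf q a * (1 - pmf q a)) powr (p / 2)))"
proof (intro bdd_aboveI[where M = "\<Sum>a\<in>(UNIV::'a set). 1"], clarify, rule sum_mono)
  fix q :: "'a pmf" and a
  have "pmf q a * (1 - pmf q a) \<le> 1 * 1"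
    by (intro mult_mono) (auto simp: pmf_le_1 )
  then show "(pmf q a * (1 - pmf q a)) powr (p / 2) \<le> 1"
    using powr_mono2[of "p/2" "pmf q a * (1 - pmf q a)" 1] assms by (simp add: pmf_le_1)
qed

lemma binomial_dev_div_sqrt:
  assumes "0 < n"
  shows "binomial_dev n \<theta> k / sqrt (real n) = real k / real n - \<theta>"
proof -
  have "binomial_dev n \<theta> k / sqrt (real n) = (real k - real n * \<theta>) / (sqrt (real n) * sqrt (real n))"
    by (simp only: binomial_dev_def divide_divide_eq_left)
  also have "\<dots> = (real k - real n * \<theta>) / real n"
    by (simp only: real_sqrt_mult_self abs_of_nat)
  also have "\<dots> = real k / real n - \<theta>"
    using assms by (simp only: diff_divide_distrib) simp
  finally show ?thesis .
qed
lemma empirical_coordinate_risk: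
  assumes "0 < n"
  shows "measure_pmf.expectation (replicate_pmf n q)
           (\<lambda>v. \<bar>pmf q a - pmf (empirical v) a\<bar> powr p)
         = real n powr (- p / 2) *
           measure_pmf.expectation (binomial_pmf n (pmf q a)) (\<lambda>k. \<bar>binomial_dev n (pmf q a) k\<bar> powr p)"
proof -
  let ?\<theta> = "pmf q a"
  have "measure_pmf.expectation (replicate_pmf n q) (\<lambda>v. \<bar>?\<theta> - pmf (empirical v) a\<bar> powr p)
      = measure_pmf.expectation (replicate_pmf n q)
          (\<lambda>v. real n powr (- p / 2) * \<bar>binomial_dev n ?\<theta> (count (mset v) a)\<bar> powr p)"
  proof (intro integral_cong_AE AE_pmfI)
    have nroot: "sqrt (real n) powr p = real n powr (p / 2)"
      by (simp add: powr_half_sqrt[symmetric] powr_powr)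
    fix v assume "v \<in> set_pmf (replicate_pmf n q)"
    then have len: "length v = n" by (simp add: set_replicate_pmf)
    with \<open>0 < n\<close> have "v \<noteq> []" by auto
    have "pmf (empirical v) a - ?\<theta> = binomial_dev n ?\<theta> (count (mset v) a) / sqrt (real n)"
      using len by (simp only: pmf_empirical[OF \<open>v \<noteq> []\<close>] binomial_dev_div_sqrt[OF \<open>0 < n\<close>])
    then have "\<bar>pmf (empirical v) a - ?\<theta>\<bar> = \<bar>binomial_dev n ?\<theta> (count (mset v) a)\<bar> / sqrt (real n)"
      by simp
    then have "\<bar>?\<theta> - pmf (empirical v) a\<bar> = \<bar>binomial_dev n ?\<theta> (count (mset v) a)\<bar> / sqrt (real n)"
      by (simp only: abs_minus_commute)
    then have "\<bar>?\<theta> - pmf (empirical v) a\<bar> powr p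
        = \<bar>binomial_dev n ?\<theta> (count (mset v) a)\<bar> powr p / sqrt (real n) powr p"
      by (simp add: powr_divide)
    moreover have "real n powr (- p / 2) = inverse (real n powr (p / 2))"
      by (simp only: minus_divide_left[symmetric] powr_minus)
    ultimately show "\<bar>?\<theta> - pmf (empirical v) a\<bar> powr p
        = real n powr (- p / 2) * \<bar>binomial_dev n ?\<theta> (count (mset v) a)\<bar> powr p"
      by (simp only: nroot field_class.field_divide_inverse mult.commute)
  qed auto
  also have "\<dots> = real n powr (- p / 2) * measure_pmf.expectation
      (map_pmf (\<lambda>v. count (mset v) a) (replicate_pmf n q)) (\<lambda>k. \<bar>binomial_dev n ?\<theta> k\<bar> powr p)"
    by (simp add: integral_map_pmf)
  finally show ?thesis by (simp add: count_replicate_pmf)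
qed

lemma empirical_risk_sum:
  fixes q :: "'a::finite pmf"
  assumes "0 < n"
  shows "measure_pmf.expectation (replicate_pmf n q) (\<lambda>v. lp_loss p q (empirical v))
         = real n powr (- p / 2) * (\<Sum>a\<in>UNIV.
             measure_pmf.expectation (binomial_pmf n (pmf q a)) (\<lambda>k. \<bar>binomial_dev n (pmf q a) k\<bar> powr p))"
proof -
  have "measure_pmf.expectation (replicate_pmf n q) (\<lambda>v. lp_loss p q (empirical v))
      = (\<Sum>a\<in>UNIV. measure_pmf.expectation (replicate_pmf n q) (\<lambda>v. \<bar>pmf q a - pmf (empirical v) a\<bar> powr p))"
    unfolding lp_loss_def
    by (rule Bochner_Integration.integral_sum, rule integrable_measure_pmf_finite, rule finite_set_replicate_pmf)
  then show ?thesis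
    unfolding empirical_coordinate_risk[OF assms] sum_distrib_left[symmetric] .
qed

proposition empirical_risk_le:
  assumes p: "0 < p" and \<epsilon>: "0 < \<epsilon>"
  shows "eventually (\<lambda>n. \<forall>q :: 'a::finite pmf.
           measure_pmf.expectation (replicate_pmf n q) (\<lambda>v. lp_loss p q (empirical v))
             \<le> (sharp_risk_const TYPE('a) p + \<epsilon>) * real n powr (- p / 2)) sequentially"
proof -
  define \<epsilon>' where "\<epsilon>' = \<epsilon> / real CARD('a)"
  have "0 < \<epsilon>'" using \<epsilon> by (simp add: \<epsilon>'_def)
  from binomial_dev_moment_uniform[OF p this] eventually_gt_at_top[of 0]
  show ?thesis
  proof eventually_elim
    case (elim n)
    show ?case
    proof
      fix q :: "'a pmf"
      let ?F = "\<lambda>a. measure_pmf.expectation (binomial_pmf n (pmf q a)) (\<lambda>k. \<bar>binomial_dev n (pmf q a) k\<bar> powr p)"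
      have "(\<Sum>a\<in>UNIV. ?F a) \<le> (\<Sum>a\<in>(UNIV :: 'a set). (pmf q a * (1 - pmf q a)) powr (p / 2) * gauss_abs_moment p + \<epsilon>')"
      proof (rule sum_mono)
        fix a
        have "pmf q a \<in> {0..1}" by (simp add: pmf_le_1)
        with elim(1) show "?F a \<le> (pmf q a * (1 - pmf q a)) powr (p / 2) * gauss_abs_moment p + \<epsilon>'"
          by blast
      qed
      also have "\<dots> = gauss_abs_moment p * (\<Sum>a\<in>UNIV. (pmf q a * (1 - pmf q a)) powr (p / 2)) + \<epsilon>"
        by (simp add: sum.distrib sum_distrib_left mult.commute \<epsilon>'_def)
      also have "\<dots> \<le> sharp_risk_const TYPE('a) p + \<epsilon>"
        unfolding sharp_risk_const_def using p
        by (intro add_mono mult_left_mono cSUP_upper multinomial_variance_powr_bdd gauss_abs_moment_nonneg) auto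
      finally have "(\<Sum>a\<in>UNIV. ?F a) * real n powr (- p / 2)
          \<le> (sharp_risk_const TYPE('a) p + \<epsilon>) * real n powr (- p / 2)"
        by (intro mult_right_mono) auto
      then show "measure_pmf.expectation (replicate_pmf n q) (\<lambda>v. lp_loss p q (empirical v))
             \<le> (sharp_risk_const TYPE('a) p + \<epsilon>) * real n powr (- p / 2)"
        by (simp only: empirical_risk_sum[OF elim(2)] mult.commute[of "real n powr (- p / 2)"])
    qed
  qed
qed

lemma gauss_abs_moment_pos: "0 < gauss_abs_moment p" if "0 \<le> p"
proof -
  have "gauss_abs_moment p \<noteq> 0"
  proof
    assume "gauss_abs_moment p = 0"
    then have "AE x in std_normal_distribution. \<bar>x\<bar> powr p = 0"
      unfolding gauss_abs_moment_def
      by (subst (asm) integral_nonneg_eq_0_iff_AE[OF integrable_gauss_abs_moment[OF that]]) auto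
    then have "AE x in lborel. 0 < std_normal_density x \<longrightarrow> x = (0::real)"
      by (simp add: AE_density)
    then have "AE x in lborel. x = (0::real)" by (simp add: normal_density_pos)
    then have "AE x in lborel. (x::real) \<in> {0}" by simp
    moreover have "{0::real} \<in> null_sets lborel" by (intro finite_imp_null_set_lborel) simp
    then have "AE x in lborel. (x::real) \<notin> {0}" by (rule AE_not_in)
    ultimately have "AE x in (lborel :: real measure). False" by eventually_elim simp
    then show False by (simp add: eventually_False ae_filter_eq_bot_iff)
  qed
  then show ?thesis using gauss_abs_moment_nonneg[of p] by linarith
qed

lemma sharp_risk_const_pos:
  assumes "0 \<le> p" "2 \<le> CARD('a::finite)"
  shows "0 < sharp_risk_const TYPE('a) p"
proof -
  define u where "u = pmf_of_set (UNIV :: 'a set)"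
  have u: "pmf u a = 1 / real CARD('a)" for a by (simp add: u_def)
  have "0 < (\<Sum>a\<in>(UNIV::'a set). (pmf u a * (1 - pmf u a)) powr (p / 2))"
    using assms(2) by (intro sum_pos) (auto simp: u)
  also have "\<dots> \<le> (SUP q :: 'a pmf. \<Sum>a\<in>UNIV. (pmf q a * (1 - pmf q a)) powr (p / 2))"
    by (intro cSUP_upper multinomial_variance_powr_bdd assms) auto
  finally show ?thesis
    unfolding sharp_risk_const_def using gauss_abs_moment_pos[OF assms(1)] by simp
qed

section \<open>Posterior risk for a binomial observation with uniform log odds\<close>

definition logistic :: "real \<Rightarrow> real" where
  "logistic x = exp x / (1 + exp x)"

text \<open>
  This is both the derivative of the logistic function and the variance of a Bernoulli variable whose
  log odds is \<open>x\<close>.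
\<close>

definition logistic_var :: "real \<Rightarrow> real" where
  "logistic_var x = logistic x * (1 - logistic x)"

lemma one_plus_exp_pos: "0 < 1 + exp (x::real)" "1 + exp (x::real) \<noteq> 0"
  using exp_gt_zero[of x] by linarith+

lemma logistic_range: "0 < logistic x" "logistic x < 1"
  by (auto simp: logistic_def one_plus_exp_pos divide_less_eq)

lemma one_minus_logistic: "1 - logistic x = 1 / (1 + exp x)"
  using one_plus_exp_pos[of x] by (simp add: logistic_def field_simps)

lemma logistic_var_pos: "0 < logistic_var x"
  using logistic_range[of x] by (simp add: logistic_var_def)

lemma has_field_derivative_logistic:
  "(logistic has_field_derivative logistic_var x) (at x)"
  unfolding logistic_def[abs_def] logistic_var_def
  by (rule derivative_eq_intros refl one_plus_exp_pos(2))+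
    (use one_plus_exp_pos[of x] in \<open>simp add: field_simps power2_eq_square\<close>)

lemma measurable_logistic [measurable]: "logistic \<in> borel_measurable borel"
  unfolding logistic_def[abs_def] by measurable

lemma strict_mono_logistic: "strict_mono logistic"
proof (rule strict_monoI)
  fix x y :: real assume "x < y"
  then show "logistic x < logistic y"
    by (rule DERIV_pos_imp_increasing) (use has_field_derivative_logistic logistic_var_pos in blast)
qed

lemma logistic_logit:
  assumes "0 < t" "t < 1"
  shows "logistic (ln (t / (1 - t))) = t"
  using assms by (simp add: logistic_def field_simps)

lemma logistic_var_eq: "logistic_var x = 1 / (2 + exp x + exp (- x))"
  using one_plus_exp_pos[of x]
  by (simp add: logistic_var_def one_minus_logistic logistic_def exp_minus field_simps)

text \<open>
  On a short interval of log odds the variance is constant up to a factor close to one. Hence the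
  likelihood lies between two Gaussian kernels of nearly equal width.
\<close>

lemma logistic_var_le:
  assumes "\<bar>x - y\<bar> \<le> l"
  shows "logistic_var x \<le> exp l * logistic_var y"
proof -
  have "exp y \<le> exp l * exp x" "exp (- y) \<le> exp l * exp (- x)" "2 \<le> exp l * 2"
    using assms by (auto simp flip: exp_add)
  then have "2 + exp y + exp (- y) \<le> exp l * (2 + exp x + exp (- x))"
    by (simp only: distrib_left add_mono)
  moreover have "0 < 2 + exp x + exp (- x)" "0 < 2 + exp y + exp (- y)"
    using exp_gt_zero[of x] exp_gt_zero[of "- x"] exp_gt_zero[of y] exp_gt_zero[of "- y"] by linarith+
  ultimately show ?thesis by (simp add: logistic_var_eq field_simps)
qed

lemma logistic_diff_ge:
  assumes "a \<le> y" "y \<le> x" "x \<le> b" and V: "\<And>z. z \<in> {a..b} \<Longrightarrow> V \<le> logistic_var z"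
  shows "V * (x - y) \<le> logistic x - logistic y"
proof (cases "x = y")
  case False
  then have "y < x" using assms by simp
  from MVT2[OF this has_field_derivative_logistic] obtain z where
    z: "y < z" "z < x" "logistic x - logistic y = (x - y) * logistic_var z" by blast
  have "V * (x - y) \<le> logistic_var z * (x - y)"
    using z assms by (intro mult_right_mono V) auto
  then show ?thesis using z(3) by (simp add: mult.commute)
qed simp

definition bernoulli_loglik :: "real \<Rightarrow> real \<Rightarrow> real \<Rightarrow> real" where
  "bernoulli_loglik n k x = k * x - n * ln (1 + exp x)"

lemma exp_bernoulli_loglik:
  assumes "k \<le> n"
  shows "exp (bernoulli_loglik (real n) (real k) x) = logistic x ^ k * (1 - logistic x) ^ (n - k)"
proof -
  have "exp (real n * ln (1 + exp x)) = (1 + exp x) ^ n"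
    using one_plus_exp_pos[of x] by (simp add: exp_of_nat_mult)
  then have "exp (bernoulli_loglik (real n) (real k) x) = exp x ^ k / (1 + exp x) ^ n"
    by (simp add: bernoulli_loglik_def exp_diff exp_of_nat_mult)
  also have "(1 + exp x) ^ n = (1 + exp x) ^ k * (1 + exp x) ^ (n - k)"
    using assms by (simp flip: power_add)
  finally show ?thesis
    by (simp add: one_minus_logistic power_divide) (simp add: logistic_def power_divide)
qed

lemma measurable_bernoulli_loglik [measurable]: "bernoulli_loglik n k \<in> borel_measurable borel"
  unfolding bernoulli_loglik_def[abs_def] by measurable

lemma bernoulli_loglik_taylor:
  assumes "x \<in> {a..b}" "y \<in> {a..b}" and crit: "k = n * logistic y"
  shows "\<exists>z\<in>{a..b}. bernoulli_loglik n k x = bernoulli_loglik n k y - n * logistic_var z * (x - y)\<^sup>2 / 2"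
proof (cases "x = y")
  case False
  define diff where "diff = (\<lambda>m::nat. if m = 0 then bernoulli_loglik n k
      else if m = 1 then (\<lambda>x. k - n * logistic x) else (\<lambda>x. - n * logistic_var x))"
  have d0: "(bernoulli_loglik n k has_field_derivative k - n * logistic t) (at t)" for t
    unfolding bernoulli_loglik_def[abs_def]
    by (rule derivative_eq_intros refl one_plus_exp_pos)+ (simp add: logistic_def)
  have d1: "((\<lambda>x. k - n * logistic x) has_field_derivative - n * logistic_var t) (at t)" for t
    by (rule derivative_eq_intros has_field_derivative_logistic refl)+ simp
  have "\<exists>t. (if x < y then x < t \<and> t < y else y < t \<and> t < x) \<and>
      bernoulli_loglik n k x = (\<Sum>m<2. (diff m y / fact m) * (x - y)^m) + (diff 2 t / fact 2) * (x - y)^2"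
    by (rule Taylor[of 2 diff _ a b])
      (use assms False d0 d1 in \<open>auto simp: diff_def less_2_cases_iff\<close>)
  then obtain t where t: "if x < y then x < t \<and> t < y else y < t \<and> t < x"
    "bernoulli_loglik n k x = (\<Sum>m<2. (diff m y / fact m) * (x - y)^m) + (diff 2 t / fact 2) * (x - y)^2"
    by blast
  show ?thesis
  proof (rule bexI)
    show "bernoulli_loglik n k x = bernoulli_loglik n k y - n * logistic_var t * (x - y)\<^sup>2 / 2"
      using t(2) crit by (simp add: diff_def numeral_2_eq_2)
    show "t \<in> {a..b}" using t(1) assms by (auto split: if_splits)
  qed
qed (use assms in auto)

text \<open>
  The best guess \<open>t\<close> against a law that is symmetric around a centre is the centre: the losses at two
  mirror points are bounded below together, uniformly in \<open>t\<close>. This inequality stands in for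
  Anderson's lemma in the posterior bound.
\<close>

lemma abs_powr_pair_ge:
  fixes x y t p :: real
  assumes "1 \<le> p"
  shows "2 * (\<bar>x - y\<bar> / 2) powr p \<le> \<bar>x - t\<bar> powr p + \<bar>y - t\<bar> powr p"
proof (cases "x = t \<or> y = t")
  case True
  have "2 * (\<bar>x - y\<bar> / 2) powr p = (2 / 2 powr p) * \<bar>x - y\<bar> powr p"
    by (simp add: powr_divide)
  also have "\<dots> \<le> 1 * \<bar>x - y\<bar> powr p"
    using powr_mono[of 1 p 2] assms by (intro mult_right_mono) auto
  finally show ?thesis using True assms by (auto simp: abs_minus_commute)
next
  case False
  have "(\<bar>x - y\<bar> / 2) powr p \<le> ((1/2) * \<bar>x - t\<bar> + (1/2) * \<bar>y - t\<bar>) powr p"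
    using assms by (intro powr_mono2) auto
  also have "\<dots> \<le> (1/2) * \<bar>x - t\<bar> powr p + (1/2) * \<bar>y - t\<bar> powr p"
    using convex_onD[OF powr_convex[OF assms], of "1/2" "\<bar>x - t\<bar>" "\<bar>y - t\<bar>"] False by simp
  finally show ?thesis by simp
qed

definition trunc_gauss_moment :: "real \<Rightarrow> real \<Rightarrow> ennreal" where
  "trunc_gauss_moment p R =
     (\<integral>\<^sup>+z. ennreal (\<bar>z\<bar> powr p * std_normal_density z) * indicator {-R..R} z \<partial>lborel)"

lemma trunc_gauss_moment_mono: "R \<le> S \<Longrightarrow> trunc_gauss_moment p R \<le> trunc_gauss_moment p S"
  unfolding trunc_gauss_moment_def by (intro nn_integral_mono) (auto simp: indicator_def)

lemma trunc_gauss_moment_eventually_ge: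
  assumes "0 \<le> p" "c < gauss_abs_moment p"
  shows "eventually (\<lambda>R. ennreal c \<le> trunc_gauss_moment p R) at_top"
proof -
  let ?f = "\<lambda>i z. ennreal (\<bar>z\<bar> powr p * std_normal_density z) * indicator {- real i..real i} z"
  have int: "integrable lborel (\<lambda>z. std_normal_density z * \<bar>z\<bar> powr p)"
    using integrable_gauss_abs_moment[OF assms(1)] by (simp add: integrable_density)
  have "(SUP i. trunc_gauss_moment p (real i)) = (\<integral>\<^sup>+z. (SUP i. ?f i z) \<partial>lborel)"
    unfolding trunc_gauss_moment_def
    by (intro nn_integral_monotone_convergence_SUP[symmetric]) (auto simp: incseq_def le_fun_def indicator_def)
  also have "\<dots> = (\<integral>\<^sup>+z. ennreal (\<bar>z\<bar> powr p * std_normal_density z) \<partial>lborel)"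
  proof (intro nn_integral_cong antisym SUP_least)
    fix z :: real
    show "?f i z \<le> ennreal (\<bar>z\<bar> powr p * std_normal_density z)" for i by (auto simp: indicator_def)
    obtain i where "\<bar>z\<bar> \<le> real i" using real_arch_simple by blast
    then have "z \<in> {- real i..real i}" by auto
    then have "ennreal (\<bar>z\<bar> powr p * std_normal_density z) \<le> ?f i z" by simp
    then show "ennreal (\<bar>z\<bar> powr p * std_normal_density z) \<le> (SUP i. ?f i z)"
      by (rule order_trans) (rule SUP_upper, simp)
  qed
  also have "\<dots> = ennreal (gauss_abs_moment p)"
    unfolding gauss_abs_moment_def using int
    by (subst integral_density) (auto simp: nn_integral_eq_integral mult.commute)
  finally have "ennreal c < (SUP i. trunc_gauss_moment p (real i))"
    using assms gauss_abs_moment_pos[OF assms(1)] by (simp add: ennreal_lessI)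
  then obtain i where i: "ennreal c < trunc_gauss_moment p (real i)" by (auto simp: less_SUP_iff)
  show ?thesis
    using eventually_ge_at_top[of "real i"]
    by eventually_elim (use i trunc_gauss_moment_mono in \<open>blast intro: order_trans less_imp_le\<close>)
qed

lemma nn_integral_gauss_kernel:
  assumes "0 < c"
  shows "(\<integral>\<^sup>+h. ennreal (exp (- (c * h\<^sup>2 / 2))) \<partial>lborel) = ennreal (sqrt (2 * pi) / sqrt c)"
proof -
  have s: "0 < 1 / sqrt c" using assms by simp
  have dens: "exp (- (c * h\<^sup>2 / 2)) = sqrt (2 * pi) / sqrt c * normal_density 0 (1 / sqrt c) h" for h
    using assms by (simp add: normal_density_def power_divide real_sqrt_divide)
  have "(\<integral>\<^sup>+h. ennreal (normal_density 0 (1 / sqrt c) h) \<partial>lborel) = 1"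
    using prob_space.emeasure_space_1[OF prob_space_normal_density[OF s, of 0]]
    by (simp add: emeasure_density)
  then show ?thesis
    unfolding dens using assms by (subst ennreal_mult) (auto simp: nn_integral_cmult)
qed

lemma nn_integral_trunc_moment_kernel:
  assumes "0 < c" 
  shows "(\<integral>\<^sup>+h. ennreal (\<bar>h\<bar> powr p * exp (- (c * h\<^sup>2 / 2))) * indicator {-\<rho>..\<rho>} h \<partial>lborel)
          = ennreal (sqrt (2 * pi) * c powr (- (p + 1) / 2)) * trunc_gauss_moment p (\<rho> * sqrt c)"
proof -
  define s where "s = sqrt c"
  have s: "0 < s" "s\<^sup>2 = c" using assms by (auto simp: s_def)
  let ?f = "\<lambda>h. ennreal (\<bar>h\<bar> powr p * exp (- (c * h\<^sup>2 / 2))) * indicator {-\<rho>..\<rho>} h"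
  have "(\<integral>\<^sup>+h. ?f h \<partial>lborel) = ennreal \<bar>1 / s\<bar> * (\<integral>\<^sup>+z. ?f (0 + (1 / s) * z) \<partial>lborel)"
    using s by (intro nn_integral_real_affine) auto
  also have "(\<integral>\<^sup>+z. ?f (0 + (1 / s) * z) \<partial>lborel) = (\<integral>\<^sup>+z. ennreal (sqrt (2 * pi) * s powr (- p)) *
      (ennreal (\<bar>z\<bar> powr p * std_normal_density z) * indicator {- (\<rho> * s)..\<rho> * s} z) \<partial>lborel)"
  proof (intro nn_integral_cong)
    fix z :: real
    have ind: "indicator {-\<rho>..\<rho>} (0 + (1 / s) * z) = (indicator {- (\<rho> * s)..\<rho> * s} z :: ennreal)"
      using s by (auto simp: indicator_def field_simps)
    have "\<bar>0 + (1 / s) * z\<bar> powr p = s powr (- p) * \<bar>z\<bar> powr p"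
      using s by (simp add: abs_mult powr_divide powr_minus_divide)
    moreover have "c * (0 + (1 / s) * z)\<^sup>2 / 2 = z\<^sup>2 / 2"
      using s by (simp add: power_divide flip: s(2))
    ultimately have "\<bar>0 + (1 / s) * z\<bar> powr p * exp (- (c * (0 + (1 / s) * z)\<^sup>2 / 2))
        = (sqrt (2 * pi) * s powr (- p)) * (\<bar>z\<bar> powr p * std_normal_density z)"
      by (simp add: std_normal_density_def)
    then show "?f (0 + (1 / s) * z) = ennreal (sqrt (2 * pi) * s powr (- p)) *
      (ennreal (\<bar>z\<bar> powr p * std_normal_density z) * indicator {- (\<rho> * s)..\<rho> * s} z)"
      unfolding ind by (simp add: ennreal_mult' mult.assoc)
  qed
  also have "\<dots> = ennreal (sqrt (2 * pi) * s powr (- p)) * trunc_gauss_moment p (\<rho> * s)"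
    unfolding trunc_gauss_moment_def by (rule nn_integral_cmult) simp
  also have "ennreal \<bar>1 / s\<bar> * \<dots> = ennreal (sqrt (2 * pi) * c powr (- (p + 1) / 2)) * trunc_gauss_moment p (\<rho> * s)"
  proof -
    have "c powr (- (p + 1) / 2) = s powr (- (p + 1))"
      using assms by (simp add: s_def powr_half_sqrt[symmetric] powr_powr)
    also have "\<dots> = s powr (- p) * s powr (- 1)" by (simp only: powr_add[symmetric]) simp
    also have "s powr (- 1) = 1 / s" using s by (simp add: powr_minus_divide)
    finally have "c powr (- (p + 1) / 2) = s powr (- p) * (1 / s)" .
    then have "sqrt (2 * pi) * c powr (- (p + 1) / 2) = \<bar>1 / s\<bar> * (sqrt (2 * pi) * s powr (- p))"
      using s(1) by simp
    then show ?thesis by (simp only: ennreal_mult'[OF abs_ge_zero] mult.assoc)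
  qed
  finally show ?thesis by (simp add: s_def)
qed

text \<open>
  The Laplace method, in the form of an inequality. In the numerator the likelihood is bounded below
  by a Gaussian kernel around its mode \<open>x0\<close>, restricted to the distance \<open>\<rho>\<close>, and the points
  \<open>x0 + h\<close> and \<open>x0 - h\<close> are paired to get rid of \<open>t\<close>. In the denominator the likelihood is bounded
  above by a slightly wider Gaussian kernel on the whole line. The exponential of
  \<open>- (3 * p / 2 + 1) * l\<close> collects the loss from the two different widths and from the nonlinearity of
  the logistic function.
\<close>

lemma laplace_risk_ge:
  fixes N :: real
  assumes p: "1 \<le> p" and N: "0 < N" and v: "0 < v" and crit: "k = N * logistic x0"
    and \<rho>: "0 < \<rho>" "a \<le> x0 - \<rho>" "x0 + \<rho> \<le> b"
    and V1: "\<And>x. x \<in> {a..b} \<Longrightarrow> v * exp (- l) \<le> logistic_var x"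
    and V2: "\<And>x. x \<in> {a..b} \<Longrightarrow> logistic_var x \<le> v * exp l"
  shows "ennreal (N powr (- p / 2) * v powr (p / 2) * exp (- ((3 * p / 2 + 1) * l)))
            * trunc_gauss_moment p (\<rho> * sqrt (N * (v * exp l)))
            * (\<integral>\<^sup>+x. ennreal (exp (bernoulli_loglik N k x)) * indicator {a..b} x \<partial>lborel)
         \<le> (\<integral>\<^sup>+x. ennreal (\<bar>logistic x - t\<bar> powr p * exp (bernoulli_loglik N k x))
                    * indicator {a..b} x \<partial>lborel)"
proof -
  let ?g = "bernoulli_loglik N k"
  define A where "A = N * (v * exp (- l))"
  define B where "B = N * (v * exp l)"
  have AB: "0 < A" "0 < B" using N v by (auto simp: A_def B_def)
  have x0: "x0 \<in> {a..b}" using \<rho> by auto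
  have g_le: "?g x \<le> ?g x0 - A * (x - x0)\<^sup>2 / 2" if x: "x \<in> {a..b}" for x
  proof -
    obtain z where z: "z \<in> {a..b}" "?g x = ?g x0 - N * logistic_var z * (x - x0)\<^sup>2 / 2"
      using bernoulli_loglik_taylor[OF x x0 crit] by blast
    have "A * (x - x0)\<^sup>2 \<le> N * logistic_var z * (x - x0)\<^sup>2"
      unfolding A_def using V1[OF z(1)] N by (intro mult_right_mono mult_left_mono) auto
    with z(2) show ?thesis by simp
  qed
  have g_ge: "?g x0 - B * (x - x0)\<^sup>2 / 2 \<le> ?g x" if x: "x \<in> {a..b}" for x
  proof -
    obtain z where z: "z \<in> {a..b}" "?g x = ?g x0 - N * logistic_var z * (x - x0)\<^sup>2 / 2"
      using bernoulli_loglik_taylor[OF x x0 crit] by blast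
    have "N * logistic_var z * (x - x0)\<^sup>2 \<le> B * (x - x0)\<^sup>2"
      unfolding B_def using V2[OF z(1)] N by (intro mult_right_mono mult_left_mono) auto
    with z(2) show ?thesis by simp
  qed
  define D where "D = (\<integral>\<^sup>+x. ennreal (exp (?g x)) * indicator {a..b} x \<partial>lborel)"
  define F where "F = (\<lambda>x. ennreal (\<bar>logistic x - t\<bar> powr p * exp (?g x)) * indicator {a..b} x)"
  have [measurable]: "F \<in> borel_measurable borel" unfolding F_def by measurable
  define c where "c = exp (?g x0)"
  have c: "0 < c" by (simp add: c_def)
  define d where "d = v * exp (- l)"
  have d: "0 < d" using v by (simp add: d_def)
  have D_le: "D \<le> ennreal (c * (sqrt (2 * pi) / sqrt A))"
  proof -
    have "D = ennreal \<bar>1\<bar> * (\<integral>\<^sup>+h. ennreal (exp (?g (x0 + 1 * h))) * indicator {a..b} (x0 + 1 * h) \<partial>lborel)"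
      unfolding D_def by (intro nn_integral_real_affine) auto
    also have "\<dots> \<le> (\<integral>\<^sup>+h. ennreal c * ennreal (exp (- (A * h\<^sup>2 / 2))) \<partial>lborel)"
    proof (simp, intro nn_integral_mono)
      fix h
      show "ennreal (exp (?g (x0 + h))) * indicator {a..b} (x0 + h)
          \<le> ennreal c * ennreal (exp (- (A * h\<^sup>2 / 2)))"
      proof (cases "x0 + h \<in> {a..b}")
        case True
        have "exp (?g (x0 + h)) \<le> exp (?g x0 + - (A * h\<^sup>2 / 2))" using g_le[OF True] by simp
        also have "\<dots> = c * exp (- (A * h\<^sup>2 / 2))" by (simp only: exp_add c_def)
        finally show ?thesis using True c by (simp add: ennreal_mult[symmetric] ennreal_leI)
      qed simp
    qed
    also have "\<dots> = ennreal c * ennreal (sqrt (2 * pi) / sqrt A)"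
      by (simp add: nn_integral_cmult nn_integral_gauss_kernel[OF AB(1)])
    finally show ?thesis by (subst ennreal_mult') (use c in auto)
  qed
  define I where "I = (\<integral>\<^sup>+x. F x \<partial>lborel)"
  define J where "J = ennreal (c * d powr p) * (ennreal (sqrt (2 * pi) * B powr (- (p + 1) / 2))
                        * trunc_gauss_moment p (\<rho> * sqrt B))"
  have "J \<le> I"
  proof -
    have Ip: "I = (\<integral>\<^sup>+h. F (x0 + h) \<partial>lborel)"
      unfolding I_def using nn_integral_real_affine[of F 1 x0] by simp
    have Im: "I = (\<integral>\<^sup>+h. F (x0 - h) \<partial>lborel)"
      unfolding I_def using nn_integral_real_affine[of F "-1" x0] by simp
    let ?K = "\<lambda>h. ennreal (\<bar>h\<bar> powr p * exp (- (B * h\<^sup>2 / 2))) * indicator {-\<rho>..\<rho>} h"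
    have "2 * J = (\<integral>\<^sup>+h. 2 * (ennreal (c * d powr p) * ?K h) \<partial>lborel)"
      unfolding J_def nn_integral_trunc_moment_kernel[OF AB(2), symmetric]
      by (simp add: nn_integral_cmult)
    also have "\<dots> \<le> (\<integral>\<^sup>+h. F (x0 + h) + F (x0 - h) \<partial>lborel)"
    proof (intro nn_integral_mono)
      fix h :: real
      show "2 * (ennreal (c * d powr p) * ?K h) \<le> F (x0 + h) + F (x0 - h)"
      proof (cases "\<bar>h\<bar> \<le> \<rho>")
        case True
        then have mem: "x0 + h \<in> {a..b}" "x0 - h \<in> {a..b}" using \<rho> by auto
        define w where "w = c * exp (- (B * h\<^sup>2 / 2))"
        have w: "0 \<le> w" using c by (simp add: w_def)
        have "exp (?g x0 + - (B * h\<^sup>2 / 2)) \<le> exp (?g (x0 + h))" using g_ge[OF mem(1)] by simp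
        then have w1: "w \<le> exp (?g (x0 + h))" by (simp only: exp_add c_def w_def)
        have "exp (?g x0 + - (B * h\<^sup>2 / 2)) \<le> exp (?g (x0 - h))" using g_ge[OF mem(2)] by simp
        then have w2: "w \<le> exp (?g (x0 - h))" by (simp only: exp_add c_def w_def)
        have diff: "d * (2 * \<bar>h\<bar>) \<le> \<bar>logistic (x0 + h) - logistic (x0 - h)\<bar>"
        proof (cases "0 \<le> h")
          case True
          show ?thesis
            using logistic_diff_ge[of a "x0 - h" "x0 + h" b d] mem True V1 by (auto simp: d_def)
        next
          case False
          show ?thesis
            using logistic_diff_ge[of a "x0 + h" "x0 - h" b d] mem False V1 by (auto simp: d_def)
        qed
        have "2 * (d powr p * \<bar>h\<bar> powr p) = 2 * ((d * (2 * \<bar>h\<bar>)) / 2) powr p"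
          using d by (simp add: powr_mult)
        also have "\<dots> \<le> 2 * (\<bar>logistic (x0 + h) - logistic (x0 - h)\<bar> / 2) powr p"
          using diff d p by (intro mult_left_mono powr_mono2 divide_right_mono) auto
        also have "\<dots> \<le> \<bar>logistic (x0 + h) - t\<bar> powr p + \<bar>logistic (x0 - h) - t\<bar> powr p"
          by (rule abs_powr_pair_ge[OF p])
        finally have "2 * (d powr p * \<bar>h\<bar> powr p) * w
            \<le> (\<bar>logistic (x0 + h) - t\<bar> powr p + \<bar>logistic (x0 - h) - t\<bar> powr p) * w"
          using w by (rule mult_right_mono)
        also have "\<dots> \<le> \<bar>logistic (x0 + h) - t\<bar> powr p * exp (?g (x0 + h))
                     + \<bar>logistic (x0 - h) - t\<bar> powr p * exp (?g (x0 - h))"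
          unfolding distrib_right using w1 w2 by (intro add_mono mult_left_mono) auto
        finally have "ennreal (2 * (c * d powr p * (\<bar>h\<bar> powr p * exp (- (B * h\<^sup>2 / 2)))))
            \<le> ennreal (\<bar>logistic (x0 + h) - t\<bar> powr p * exp (?g (x0 + h))
                     + \<bar>logistic (x0 - h) - t\<bar> powr p * exp (?g (x0 - h)))"
          by (intro ennreal_leI) (simp add: w_def mult_ac)
        then show ?thesis
          using mem True c by (simp add: F_def ennreal_mult' ennreal_plus abs_le_iff)
      qed (auto simp: indicator_def abs_le_iff)
    qed
    also have "\<dots> = 2 * I"
      by (subst nn_integral_add) (auto simp: Ip[symmetric] Im[symmetric] mult_2)
    finally show ?thesis by (simp add: ennreal_mult_le_mult_iff)
  qed
  \<comment> \<open>An identity between monomials in \<open>N\<close>, \<open>v\<close> and \<open>exp l\<close>, checked on their logarithms.\<close>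
  have coeff: "N powr (- p / 2) * v powr (p / 2) * exp (- ((3 * p / 2 + 1) * l)) * (1 / sqrt A)
        = d powr p * B powr (- (p + 1) / 2)"
  proof -
    define \<alpha> \<beta> where "\<alpha> = ln N" and "\<beta> = ln v"
    have ex: "N = exp \<alpha>" "v = exp \<beta>" using N v by (auto simp: \<alpha>_def \<beta>_def)
    have sA: "1 / sqrt A = exp ((\<alpha> + \<beta> - l) * - (1 / 2))"
    proof -
      have Ae: "A = exp (\<alpha> + \<beta> - l)"
        by (simp add: A_def ex exp_add exp_diff exp_minus divide_inverse)
      have "1 / sqrt A = A powr (- (1/2))" using AB by (simp add: powr_minus_divide powr_half_sqrt)
      also have "A powr (- (1/2)) = exp (\<alpha> + \<beta> - l) powr (- (1/2))"
        by (simp only: Ae)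
      also have "\<dots> = exp ((\<alpha> + \<beta> - l) * - (1 / 2))" by (simp only: exp_powr_real)
      finally show ?thesis .
    qed
    have B': "B = exp (\<alpha> + \<beta> + l)" by (simp add: B_def ex exp_add)
    have d': "d = exp (\<beta> - l)" by (simp add: d_def ex exp_diff exp_minus divide_inverse)
    show ?thesis unfolding sA B' d' ex(1) ex(2) exp_powr_real exp_add[symmetric]
      by (rule arg_cong[where f = exp]) (simp add: field_simps)
  qed
  have er: "ennreal u * X * ennreal w = ennreal (u * w) * X" if "0 \<le> u" "0 \<le> w" for u w X
    using that by (simp add: ennreal_mult mult_ac)
  have "ennreal (N powr (- p / 2) * v powr (p / 2) * exp (- ((3 * p / 2 + 1) * l)))
          * trunc_gauss_moment p (\<rho> * sqrt B) * D
      \<le> ennreal (N powr (- p / 2) * v powr (p / 2) * exp (- ((3 * p / 2 + 1) * l)))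
          * trunc_gauss_moment p (\<rho> * sqrt B) * ennreal (c * (sqrt (2 * pi) / sqrt A))"
    by (intro mult_left_mono D_le) auto
  also have "\<dots> = ennreal (N powr (- p / 2) * v powr (p / 2) * exp (- ((3 * p / 2 + 1) * l))
                          * (c * (sqrt (2 * pi) / sqrt A))) * trunc_gauss_moment p (\<rho> * sqrt B)"
    by (intro er) (use c AB in auto)
  also have "N powr (- p / 2) * v powr (p / 2) * exp (- ((3 * p / 2 + 1) * l)) * (c * (sqrt (2 * pi) / sqrt A))
      = c * sqrt (2 * pi) * (N powr (- p / 2) * v powr (p / 2) * exp (- ((3 * p / 2 + 1) * l)) * (1 / sqrt A))"
    by simp
  also have "\<dots> = c * d powr p * (sqrt (2 * pi) * B powr (- (p + 1) / 2))"
    unfolding coeff by simp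
  also have "ennreal \<dots> * trunc_gauss_moment p (\<rho> * sqrt B) = J"
    unfolding J_def by (subst er[symmetric]) (use c in \<open>auto simp: mult_ac\<close>)
  also note \<open>J \<le> I\<close>
  finally show ?thesis unfolding I_def D_def F_def B_def .
qed

lemma pmf_replicate_pmf:
  "pmf (replicate_pmf n q) v = (if length v = n then prod_list (map (pmf q) v) else 0)"
proof (induction n arbitrary: v)
  case 0
  then show ?case by (cases v) auto
next
  case (Suc n)
  have R: "replicate_pmf (Suc n) q = bind_pmf q (\<lambda>x. map_pmf ((#) x) (replicate_pmf n q))"
    by (simp add: map_pmf_def)
  show ?case
  proof (cases v)
    case Nil
    then have "v \<notin> set_pmf (replicate_pmf (Suc n) q)" by (auto simp: set_replicate_pmf)
    then have "pmf (replicate_pmf (Suc n) q) v = 0" unfolding set_pmf_iff by blast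
    with Nil show ?thesis by simp
  next
    case (Cons y ys)
    have "pmf (map_pmf ((#) x) (replicate_pmf n q)) v = pmf (replicate_pmf n q) ys * indicator {y} x" for x
    proof (cases "x = y")
      case True
      then show ?thesis using Cons by (simp add: pmf_map_inj' inj_def)
    next
      case False
      then have "v \<notin> set_pmf (map_pmf ((#) x) (replicate_pmf n q))" using Cons by auto
      then have "pmf (map_pmf ((#) x) (replicate_pmf n q)) v = 0" unfolding set_pmf_iff by blast
      with False show ?thesis by simp
    qed
    then have "pmf (replicate_pmf (Suc n) q) v = pmf (replicate_pmf n q) ys * pmf q y"
      unfolding R by (simp add: pmf_bind measure_pmf_single)
    then show ?thesis using Cons by (simp add: Suc.IH mult.commute)
  qed
qed

lemma expectation_replicate_pmf:
  fixes q :: "'a::finite pmf"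
  shows "measure_pmf.expectation (replicate_pmf n q) f
           = (\<Sum>v\<in>{v. length v = n}. prod_list (map (pmf q) v) * f v)"
proof -
  have "finite {xs :: 'a list. set xs \<subseteq> UNIV \<and> length xs = n}"
    by (rule finite_lists_length_eq) simp
  then have "measure_pmf.expectation (replicate_pmf n q) f
      = (\<Sum>v\<in>{v. length v = n}. f v * pmf (replicate_pmf n q) v)"
    by (intro integral_measure_pmf_real) (auto simp: set_replicate_pmf)
  then show ?thesis by (simp add: pmf_replicate_pmf mult.commute)
qed

text \<open>
  When the odds among the letters other than \<open>i\<close> are fixed, the count of \<open>i\<close> is a sufficient
  statistic: the likelihood is a binomial one times a factor that is free of the parameter.
\<close>

lemma prod_list_map_split:
  fixes f :: "'a \<Rightarrow> real"
  assumes "\<And>b. b \<noteq> i \<Longrightarrow> f b = c * r b"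
  shows "prod_list (map f v) = prod_list (map r (filter (\<lambda>b. b \<noteq> i) v))
           * (f i ^ length (filter (\<lambda>b. b = i) v) * c ^ (length v - length (filter (\<lambda>b. b = i) v)))"
proof (induction v)
  case (Cons b v)
  have "length (filter (\<lambda>b. b = i) v) \<le> length v" by simp
  then show ?case using Cons assms by (auto simp: Suc_diff_le)
qed simp

text \<open>
  The average risk for coordinate \<open>i\<close> along a curve of distributions on which the log odds \<open>x\<close> of
  letter \<open>i\<close> is uniform on an interval of length \<open>l\<close> and the odds among the other letters stay fixed.
  For each data list whose empirical log odds lies at distance at least \<open>\<rho>\<close> from the boundary, the
  Laplace bound applies. By Chebyshev's inequality these lists have probability at least
  \<open>1 - \<delta>\<close> as soon as the true log odds is at distance at least \<open>2 * \<rho>\<close> from the boundary.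

  The four factors \<open>1 - \<delta>\<close> account for the variation of the variance on the interval, the truncation
  of the Gaussian moment, the atypical data, and the boundary layers. The bound is uniform over the
  position of the interval, the odds \<open>r\<close> of the other letters and the estimator \<open>T\<close>; this
  uniformity makes it possible to integrate it over the other coordinates.
\<close>

lemma logistic_bayes_risk_ge:
  fixes i :: "'a::finite"
  assumes p: "1 \<le> p" and \<delta>: "0 < \<delta>" "\<delta> < 1" and l: "0 < l" "(3 * p / 2 + 1) * l \<le> \<delta>"
  shows "eventually (\<lambda>n. \<forall>a (Q :: real \<Rightarrow> 'a pmf) r T.
           \<mu> - l \<le> a \<and> a \<le> \<mu> \<and> (\<forall>x. pmf (Q x) i = logistic x) \<and>
           (\<forall>x b. b \<noteq> i \<longrightarrow> pmf (Q x) b = (1 - logistic x) * r b) \<longrightarrow>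
           ennreal (l * ((1 - \<delta>) ^ 4 * real n powr (- p / 2) * logistic_var \<mu> powr (p / 2) * gauss_abs_moment p))
             \<le> (\<integral>\<^sup>+x. ennreal (measure_pmf.expectation (replicate_pmf n (Q x))
                   (\<lambda>v. \<bar>logistic x - T v\<bar> powr p)) * indicator {a..a + l} x \<partial>lborel)) sequentially"
proof -
  define v where "v = logistic_var \<mu>"
  have v: "0 < v" using logistic_var_pos by (simp add: v_def)
  define \<rho> where "\<rho> = \<delta> * l / 4"
  have \<rho>: "0 < \<rho>" "4 * \<rho> = \<delta> * l" using \<delta> l by (auto simp: \<rho>_def)
  define c where "c = gauss_abs_moment p"
  have c: "0 < c" using gauss_abs_moment_pos[of p] p by (simp add: c_def)
  have sqrtlim: "filterlim (\<lambda>n. \<rho> * sqrt (real n * (v * exp l))) at_top sequentially"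
  proof -
    have "filterlim (\<lambda>n. (\<rho> * sqrt (v * exp l)) * sqrt (real n)) at_top sequentially"
      using \<rho>(1) v by (intro filterlim_tendsto_pos_mult_at_top[OF tendsto_const]
          filterlim_compose[OF sqrt_at_top filterlim_real_sequentially]) auto
    then show ?thesis by (simp add: real_sqrt_mult mult_ac)
  qed
  have "eventually (\<lambda>R. ennreal ((1 - \<delta>) * c) \<le> trunc_gauss_moment p R) at_top"
    using p c \<delta> by (intro trunc_gauss_moment_eventually_ge) (auto simp: c_def)
  from eventually_compose_filterlim[OF this sqrtlim]
  have ev1: "eventually (\<lambda>n. ennreal ((1 - \<delta>) * c) \<le> trunc_gauss_moment p (\<rho> * sqrt (real n * (v * exp l)))) sequentially" .
  define d where "d = v * exp (- l) * \<rho>"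
  have d: "0 < d" using v \<rho> by (simp add: d_def)
  have "((\<lambda>n. 8 * exp 2 / (real n * d\<^sup>2)) \<longlongrightarrow> 0) sequentially"
    using lim_const_over_n[of "8 * exp 2 / d\<^sup>2"] by (simp add: mult.commute)
  then have ev2: "eventually (\<lambda>n. 8 * exp 2 / (real n * d\<^sup>2) < \<delta>) sequentially"
    using \<delta> by (intro order_tendstoD) auto
  show ?thesis
    using ev1 ev2 eventually_gt_at_top[of 0]
  proof eventually_elim
    case (elim n)
    show ?case
    proof (intro allI impI, elim conjE)
      fix a :: real and Q :: "real \<Rightarrow> 'a pmf" and r T
      assume a: "\<mu> - l \<le> a" "a \<le> \<mu>" and Qi: "\<forall>x. pmf (Q x) i = logistic x"
        and Qb: "\<forall>x b. b \<noteq> i \<longrightarrow> pmf (Q x) b = (1 - logistic x) * r b"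
      have r0: "0 \<le> r b" if "b \<noteq> i" for b
        using Qb[rule_format, of b 0] that pmf_nonneg[of "Q 0" b] logistic_range[of 0]
        by (simp add: zero_le_mult_iff)
      define b where "b = a + l"
      have V1: "v * exp (- l) \<le> logistic_var x" and V2: "logistic_var x \<le> v * exp l" if "x \<in> {a..b}" for x
      proof -
        have "\<bar>\<mu> - x\<bar> \<le> l" using that a by (auto simp: b_def)
        then have "v \<le> exp l * logistic_var x" "logistic_var x \<le> exp l * v"
          using logistic_var_le[of \<mu> x l] logistic_var_le[of x \<mu> l] by (auto simp: v_def abs_minus_commute)
        then show "v * exp (- l) \<le> logistic_var x" "logistic_var x \<le> v * exp l"
          by (auto simp: exp_minus field_simps)
      qed
      define K where "K = (\<lambda>v :: 'a list. length (filter (\<lambda>b. b = i) v))"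
      define W where "W = (\<lambda>v :: 'a list. prod_list (map r (filter (\<lambda>b. b \<noteq> i) v)))"
      define g where "g = (\<lambda>v. bernoulli_loglik (real n) (real (K v)))"
      define \<Omega> where "\<Omega> = {v :: 'a list. length v = n}"
      have W0: "0 \<le> W v" for v unfolding W_def by (intro prod_list_nonneg) (auto simp: r0)
      have lik: "prod_list (map (pmf (Q x)) v) = W v * exp (g v x)" if "v \<in> \<Omega>" for v x
      proof -
        have "K v \<le> n" using that by (auto simp: K_def \<Omega>_def)
        then show ?thesis
          using that prod_list_map_split[of i "pmf (Q x)" "1 - logistic x" r v] Qi Qb
          by (simp add: g_def exp_bernoulli_loglik W_def K_def \<Omega>_def)
      qed
      have fin: "finite \<Omega>"
        using finite_lists_length_eq[of "UNIV :: 'a set" n] by (simp add: \<Omega>_def)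
      \<comment> \<open>The lists whose empirical log odds stays at distance \<open>\<rho>\<close> from the ends of the interval.\<close>
      define G where "G = {v \<in> \<Omega>. logistic (a + \<rho>) \<le> real (K v) / real n \<and> real (K v) / real n \<le> logistic (b - \<rho>)}"
      have G: "G \<subseteq> \<Omega>" "finite G" using fin by (auto simp: G_def)
      have good: "ennreal (1 - \<delta>) \<le> ennreal (\<Sum>v\<in>G. W v * exp (g v x))"
        if x: "x \<in> {a + 2 * \<rho>..b - 2 * \<rho>}" for x
      proof -
        let ?\<theta> = "logistic x" and ?Bin = "binomial_pmf n (logistic x)"
        have th: "?\<theta> \<in> {0..1}" using logistic_range[of x] by auto
        have dn: "0 < real n * d\<^sup>2" using d elim by simp
        have lo: "d \<le> ?\<theta> - logistic (a + \<rho>)"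
        proof -
          have "v * exp (- l) * \<rho> \<le> v * exp (- l) * (x - (a + \<rho>))"
            using x v by (intro mult_left_mono) auto
          also have "\<dots> \<le> ?\<theta> - logistic (a + \<rho>)"
            using x \<rho>(1) V1 by (intro logistic_diff_ge[of a _ _ b]) auto
          finally show ?thesis by (simp add: d_def)
        qed
        have hi: "d \<le> logistic (b - \<rho>) - ?\<theta>"
        proof -
          have "v * exp (- l) * \<rho> \<le> v * exp (- l) * ((b - \<rho>) - x)"
            using x v by (intro mult_left_mono) auto
          also have "\<dots> \<le> logistic (b - \<rho>) - ?\<theta>"
            using x \<rho>(1) V1 by (intro logistic_diff_ge[of a _ _ b]) auto
          finally show ?thesis by (simp add: d_def)
        qed
        have "1 - \<delta> \<le> measure_pmf.expectation ?Bin
            (\<lambda>k. 1 - \<bar>binomial_dev n ?\<theta> k\<bar> powr 2 / (real n * d\<^sup>2))"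
        proof -
          have "measure_pmf.expectation ?Bin (\<lambda>k. \<bar>binomial_dev n ?\<theta> k\<bar> powr 2) \<le> 8 * exp 2"
            using binomial_dev_moment_le[OF th elim(3), of 2] by simp
          then have "measure_pmf.expectation ?Bin (\<lambda>k. \<bar>binomial_dev n ?\<theta> k\<bar> powr 2) / (real n * d\<^sup>2)
              \<le> 8 * exp 2 / (real n * d\<^sup>2)"
            using dn by (intro divide_right_mono) auto
          then show ?thesis using elim(2) th by (subst Bochner_Integration.integral_diff) auto
        qed
        also have "\<dots> \<le> measure_pmf.expectation ?Bin
            (indicator {k. logistic (a + \<rho>) \<le> real k / real n \<and> real k / real n \<le> logistic (b - \<rho>)})"
        proof (intro integral_mono integrable_binomial_pmf th)
          fix k
          show "1 - \<bar>binomial_dev n ?\<theta> k\<bar> powr 2 / (real n * d\<^sup>2)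
            \<le> indicator {k. logistic (a + \<rho>) \<le> real k / real n \<and> real k / real n \<le> logistic (b - \<rho>)} k"
          proof (cases "logistic (a + \<rho>) \<le> real k / real n \<and> real k / real n \<le> logistic (b - \<rho>)")
            case True
            then show ?thesis using dn by simp
          next
            case False
            then have "d \<le> \<bar>real k / real n - ?\<theta>\<bar>" using lo hi by linarith
            also have "\<dots> = \<bar>binomial_dev n ?\<theta> k\<bar> / sqrt (real n)"
              by (simp only: binomial_dev_div_sqrt[OF elim(3), symmetric] abs_divide) simp
            finally have "d * sqrt (real n) \<le> \<bar>binomial_dev n ?\<theta> k\<bar>"
              using elim(3) by (simp add: pos_le_divide_eq)
            then have "(d * sqrt (real n))\<^sup>2 \<le> \<bar>binomial_dev n ?\<theta> k\<bar>\<^sup>2"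
              using d by (intro power_mono) auto
            then have "real n * d\<^sup>2 \<le> \<bar>binomial_dev n ?\<theta> k\<bar> powr 2"
              by (simp add: power_mult_distrib mult.commute)
            then have "1 \<le> \<bar>binomial_dev n ?\<theta> k\<bar> powr 2 / (real n * d\<^sup>2)"
              using dn by (simp only: pos_le_divide_eq mult_1)
            then show ?thesis using False by simp
          qed
        qed
        also have "\<dots> = measure_pmf.expectation (replicate_pmf n (Q x)) (\<lambda>v.
            indicator {k. logistic (a + \<rho>) \<le> real k / real n \<and> real k / real n \<le> logistic (b - \<rho>)} (K v))"
        proof -
          have "?Bin = map_pmf K (replicate_pmf n (Q x))"
            using filter_length_replicate_pmf[of "\<lambda>b. b = i" n "Q x"] Qi
            by (simp add: K_def[abs_def] pmf.rep_eq)
          then show ?thesis by (simp only: integral_map_pmf)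
        qed
        also have "\<dots> = (\<Sum>v\<in>\<Omega>. W v * exp (g v x) *
            indicator {k. logistic (a + \<rho>) \<le> real k / real n \<and> real k / real n \<le> logistic (b - \<rho>)} (K v))"
          unfolding expectation_replicate_pmf \<Omega>_def[symmetric] by (intro sum.cong) (auto simp: lik)
        also have "\<dots> = (\<Sum>v\<in>G. W v * exp (g v x))"
          using fin by (intro sum.mono_neutral_cong_right) (auto simp: G_def indicator_def)
        finally show ?thesis by (rule ennreal_leI)
      qed
      define A where "A = real n powr (- p / 2) * v powr (p / 2) * exp (- ((3 * p / 2 + 1) * l))"
      have A0: "0 \<le> A" by (simp add: A_def)
      define B where "B = ennreal A * trunc_gauss_moment p (\<rho> * sqrt (real n * (v * exp l)))"
      have lap: "B * (\<integral>\<^sup>+x. ennreal (exp (g w x)) * indicator {a..b} x \<partial>lborel)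
          \<le> (\<integral>\<^sup>+x. ennreal (\<bar>logistic x - T w\<bar> powr p * exp (g w x)) * indicator {a..b} x \<partial>lborel)"
        if w: "w \<in> G" for w
      proof -
        define t where "t = real (K w) / real n"
        have t: "logistic (a + \<rho>) \<le> t" "t \<le> logistic (b - \<rho>)" using w by (auto simp: G_def t_def)
        have t01: "0 < t" "t < 1" using t logistic_range[of "a + \<rho>"] logistic_range[of "b - \<rho>"] by auto
        define x0 where "x0 = ln (t / (1 - t))"
        have x0: "logistic x0 = t" unfolding x0_def by (rule logistic_logit[OF t01])
        have "a + \<rho> \<le> x0" "x0 \<le> b - \<rho>"
          using t unfolding x0[symmetric] by (simp_all add: strict_mono_less_eq[OF strict_mono_logistic])
        moreover have "real (K w) = real n * logistic x0" using elim(3) by (simp add: x0 t_def)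
        ultimately show ?thesis
          unfolding B_def A_def g_def
          by (intro laplace_risk_ge[OF p _ v _ \<rho>(1) _ _ V1 V2]) (use elim(3) in auto)
      qed
      have Ble: "ennreal ((1 - \<delta>) ^ 2 * real n powr (- p / 2) * v powr (p / 2) * c) \<le> B"
      proof -
        have "1 - \<delta> \<le> exp (- ((3 * p / 2 + 1) * l))"
          using exp_ge_add_one_self[of "- ((3 * p / 2 + 1) * l)"] l(2) by linarith
        then have "real n powr (- p / 2) * v powr (p / 2) * (1 - \<delta>) \<le> A"
          unfolding A_def by (intro mult_left_mono) auto
        then have "ennreal (real n powr (- p / 2) * v powr (p / 2) * (1 - \<delta>)) * ennreal ((1 - \<delta>) * c) \<le> B"
          unfolding B_def by (intro mult_mono ennreal_leI elim(1)) auto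
        also have "ennreal (real n powr (- p / 2) * v powr (p / 2) * (1 - \<delta>)) * ennreal ((1 - \<delta>) * c)
            = ennreal ((real n powr (- p / 2) * v powr (p / 2) * (1 - \<delta>)) * ((1 - \<delta>) * c))"
          using \<delta> c by (subst ennreal_mult) auto
        also have "(real n powr (- p / 2) * v powr (p / 2) * (1 - \<delta>)) * ((1 - \<delta>) * c)
            = (1 - \<delta>) ^ 2 * real n powr (- p / 2) * v powr (p / 2) * c"
          by (simp add: power2_eq_square)
        finally show ?thesis .
      qed
      have [measurable]: "g w \<in> borel_measurable borel" for w unfolding g_def by measurable
      have "ennreal (l * ((1 - \<delta>) ^ 4 * real n powr (- p / 2) * v powr (p / 2) * c))
          = ennreal ((1 - \<delta>) ^ 2 * real n powr (- p / 2) * v powr (p / 2) * c)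
            * (ennreal (1 - \<delta>) * ennreal (l * (1 - \<delta>)))"
        using \<delta> c l by (simp add: ennreal_mult[symmetric] eval_nat_numeral mult_ac)
      also have "\<dots> \<le> B * (ennreal (1 - \<delta>) * ennreal (l * (1 - \<delta>)))"
        by (intro mult_right_mono Ble) auto
      also have "ennreal (1 - \<delta>) * ennreal (l * (1 - \<delta>))
          = (\<integral>\<^sup>+x. ennreal (1 - \<delta>) * indicator {a + 2 * \<rho>..b - 2 * \<rho>} x \<partial>lborel)"
      proof -
        have "b - 2 * \<rho> - (a + 2 * \<rho>) = l * (1 - \<delta>)" using \<rho>(2) by (simp add: b_def algebra_simps)
        moreover have "0 \<le> l * (1 - \<delta>)" using \<delta> l by simp
        ultimately show ?thesis by (simp add: nn_integral_cmult_indicator)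
      qed
      also have "B * \<dots> \<le> B * (\<integral>\<^sup>+x. ennreal (\<Sum>w\<in>G. W w * exp (g w x)) * indicator {a..b} x \<partial>lborel)"
      proof (intro mult_left_mono nn_integral_mono)
        fix x
        show "ennreal (1 - \<delta>) * indicator {a + 2 * \<rho>..b - 2 * \<rho>} x
            \<le> ennreal (\<Sum>w\<in>G. W w * exp (g w x)) * indicator {a..b} x"
          using good[of x] \<rho>(1) by (auto simp: indicator_def)
      qed simp
      also have "(\<integral>\<^sup>+x. ennreal (\<Sum>w\<in>G. W w * exp (g w x)) * indicator {a..b} x \<partial>lborel) = (\<integral>\<^sup>+x. (\<Sum>w\<in>G. ennreal (W w) * (ennreal (exp (g w x)) * indicator {a..b} x)) \<partial>lborel)"
        using W0 by (intro nn_integral_cong)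
          (simp add: sum_ennreal[symmetric] sum_distrib_right ennreal_mult' mult.assoc)
      also have "\<dots> = (\<Sum>w\<in>G. ennreal (W w) * (\<integral>\<^sup>+x. ennreal (exp (g w x)) * indicator {a..b} x \<partial>lborel))"
        by (subst nn_integral_sum) (auto simp: nn_integral_cmult)
      also have "B * \<dots> = (\<Sum>w\<in>G. ennreal (W w) * (B * (\<integral>\<^sup>+x. ennreal (exp (g w x)) * indicator {a..b} x \<partial>lborel)))"
        by (simp add: sum_distrib_left mult.left_commute)
      also have "\<dots> \<le> (\<Sum>w\<in>G. ennreal (W w) * (\<integral>\<^sup>+x. ennreal (\<bar>logistic x - T w\<bar> powr p * exp (g w x)) * indicator {a..b} x \<partial>lborel))"
        by (intro sum_mono mult_left_mono lap) auto
      also have "\<dots> \<le> (\<Sum>w\<in>\<Omega>. ennreal (W w) * (\<integral>\<^sup>+x. ennreal (\<bar>logistic x - T w\<bar> powr p * exp (g w x)) * indicator {a..b} x \<partial>lborel))"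
        using G fin by (intro sum_mono2) auto
      also have "\<dots> = (\<integral>\<^sup>+x. (\<Sum>w\<in>\<Omega>. ennreal (W w) * (ennreal (\<bar>logistic x - T w\<bar> powr p * exp (g w x)) * indicator {a..b} x)) \<partial>lborel)"
        by (subst nn_integral_sum) (auto simp: nn_integral_cmult)
      also have "\<dots> = (\<integral>\<^sup>+x. ennreal (measure_pmf.expectation (replicate_pmf n (Q x))
                   (\<lambda>v. \<bar>logistic x - T v\<bar> powr p)) * indicator {a..a + l} x \<partial>lborel)"
      proof (intro nn_integral_cong)
        fix x
        have "measure_pmf.expectation (replicate_pmf n (Q x)) (\<lambda>v. \<bar>logistic x - T v\<bar> powr p)
            = (\<Sum>w\<in>\<Omega>. W w * (\<bar>logistic x - T w\<bar> powr p * exp (g w x)))"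
          unfolding expectation_replicate_pmf \<Omega>_def[symmetric] by (intro sum.cong) (auto simp: lik)
        then show "(\<Sum>w\<in>\<Omega>. ennreal (W w) * (ennreal (\<bar>logistic x - T w\<bar> powr p * exp (g w x)) * indicator {a..b} x))
            = ennreal (measure_pmf.expectation (replicate_pmf n (Q x))
                   (\<lambda>v. \<bar>logistic x - T v\<bar> powr p)) * indicator {a..a + l} x"
          using W0 by (simp add: sum_ennreal[symmetric] sum_distrib_right ennreal_mult' mult.assoc b_def)
      qed
      finally show "ennreal (l * ((1 - \<delta>) ^ 4 * real n powr (- p / 2) * logistic_var \<mu> powr (p / 2) * gauss_abs_moment p))
          \<le> (\<integral>\<^sup>+x. ennreal (measure_pmf.expectation (replicate_pmf n (Q x))
                   (\<lambda>v. \<bar>logistic x - T v\<bar> powr p)) * indicator {a..a + l} x \<partial>lborel)"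
        by (simp add: v_def c_def)
    qed
  qed
qed

section \<open>The sharp lower bound for univariate estimation\<close>

definition softmax :: "('a::finite \<Rightarrow> real) \<Rightarrow> 'a pmf" where
  "softmax x = embed_pmf (\<lambda>a. exp (x a) / (\<Sum>b\<in>UNIV. exp (x b)))"

lemma pmf_softmax: "pmf (softmax x) a = exp (x a) / (\<Sum>b\<in>UNIV. exp (x b))"
proof -
  have pos: "0 < (\<Sum>b\<in>(UNIV :: 'a set). exp (x b))" by (intro sum_pos) auto
  show ?thesis
    unfolding softmax_def
  proof (rule pmf_embed_pmf)
    show "0 \<le> exp (x a) / (\<Sum>b\<in>UNIV. exp (x b))" for a
      using pos by (intro divide_nonneg_pos) auto
    have "(\<integral>\<^sup>+a. ennreal (exp (x a) / (\<Sum>b\<in>UNIV. exp (x b))) \<partial>count_space UNIV)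
        = (\<Sum>a\<in>UNIV. ennreal (exp (x a) / (\<Sum>b\<in>UNIV. exp (x b))))"
      by (rule nn_integral_count_space_finite) simp
    also have "\<dots> = ennreal (\<Sum>a\<in>UNIV. exp (x a) / (\<Sum>b\<in>UNIV. exp (x b)))"
      using pos by (intro sum_ennreal) (auto intro: divide_nonneg_pos)
    also have "(\<Sum>a\<in>UNIV. exp (x a) / (\<Sum>b\<in>UNIV. exp (x b))) = 1"
      using pos by (simp flip: sum_divide_distrib)
    finally show "(\<integral>\<^sup>+a. ennreal (exp (x a) / (\<Sum>b\<in>UNIV. exp (x b))) \<partial>count_space UNIV) = 1" by simp
  qed
qed

definition coordinate_risk :: "real \<Rightarrow> nat \<Rightarrow> ('a::finite list \<Rightarrow> 'a \<Rightarrow> real) \<Rightarrow> 'a \<Rightarrow> 'a pmf \<Rightarrow> real" where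
  "coordinate_risk p n T i q =
     measure_pmf.expectation (replicate_pmf n q) (\<lambda>v. \<bar>pmf q i - T v i\<bar> powr p)"

lemma measurable_coordinate_risk_softmax:
  assumes [measurable]: "\<And>a. (\<lambda>z. h z a) \<in> borel_measurable N"
  shows "(\<lambda>z. coordinate_risk p n T i (softmax (h z))) \<in> borel_measurable N"
proof -
  have [measurable]: "(\<lambda>z. pmf (softmax (h z)) a) \<in> borel_measurable N" for a
    unfolding pmf_softmax by measurable
  have [measurable]: "(\<lambda>z. prod_list (map (pmf (softmax (h z))) v)) \<in> borel_measurable N" for v
    by (induction v) simp_all
  show ?thesis
    unfolding coordinate_risk_def expectation_replicate_pmf by measurable
qed

lemma coordinate_risk_nonneg: "0 \<le> coordinate_risk p n T i q"
  unfolding coordinate_risk_def by (intro integral_nonneg_AE) auto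

lemma sum_coordinate_risk:
  "(\<Sum>i\<in>UNIV. coordinate_risk p n T i q)
     = measure_pmf.expectation (replicate_pmf n q) (\<lambda>v. \<Sum>i\<in>UNIV. \<bar>pmf q i - T v i\<bar> powr p)"
  unfolding coordinate_risk_def
  by (rule Bochner_Integration.integral_sum[symmetric], rule integrable_measure_pmf_finite,
      rule finite_set_replicate_pmf)

text \<open>
  The prior is the law of the softmax of independent log weights, the \<open>a\<close>-th uniform on
  \<open>{ln (pmf q0 a)..ln (pmf q0 a) + l}\<close>. Moving the \<open>i\<close>-th log weight alone moves \<open>q\<close> along a curve on
  which only the odds of \<open>i\<close> change, which is the one parameter problem treated before: the log
  odds of \<open>i\<close> is that log weight shifted by \<open>ln S\<close>, where \<open>S\<close> is the total weight of the other letters.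
  Since the risk is a sum over coordinates, Fubini's theorem can be applied with a different curve for
  each coordinate under the same prior.
\<close>

lemma interior_bayes_risk_ge:
  fixes q0 :: "'a::finite pmf"
  assumes p: "1 \<le> p" and \<delta>: "0 < \<delta>" "\<delta> < 1" and q0: "\<And>a. 0 < pmf q0 a"
  shows "eventually (\<lambda>n. \<forall>(T :: 'a list \<Rightarrow> 'a \<Rightarrow> real) D. (\<forall>q. (\<Sum>i\<in>UNIV. coordinate_risk p n T i q) \<le> D) \<longrightarrow>
           (\<Sum>i\<in>UNIV. (1 - \<delta>) ^ 4 * real n powr (- p / 2) *
              (pmf q0 i * (1 - pmf q0 i)) powr (p / 2) * gauss_abs_moment p) \<le> D) sequentially"
proof -
  define l where "l = \<delta> / (3 * p / 2 + 1)"
  have l: "0 < l" "(3 * p / 2 + 1) * l \<le> \<delta>" using p \<delta> by (auto simp: l_def)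
  define B where "B = (\<lambda>n i. (1 - \<delta>) ^ 4 * real n powr (- p / 2) *
              (pmf q0 i * (1 - pmf q0 i)) powr (p / 2) * gauss_abs_moment p)"
  define lo where "lo = (\<lambda>a. ln (pmf q0 a))"
  define M where "M = (\<lambda>a::'a. uniform_measure lborel {lo a..lo a + l})"
  have setsM [measurable_cong]: "sets (M a) = sets borel" for a by (simp add: M_def)
  have PM: "prob_space (M a)" for a
    unfolding M_def using l by (intro prob_space_uniform_measure) auto
  interpret product_sigma_finite M
    unfolding product_sigma_finite_def using PM by (blast intro: prob_space_imp_sigma_finite)
  have compl: "(\<Sum>b\<in>UNIV - {i}. pmf q0 b) = 1 - pmf q0 i" for i
  proof -
    have "(\<Sum>b\<in>UNIV. pmf q0 b) = 1" by (rule sum_pmf_eq_1) auto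
    then show ?thesis by (simp add: sum_diff1)
  qed
  define \<mu> where "\<mu> = (\<lambda>i. ln (pmf q0 i / (1 - pmf q0 i)))"
  have "eventually (\<lambda>n. \<forall>i. \<forall>a (Q :: real \<Rightarrow> 'a pmf) r T.
           \<mu> i - l \<le> a \<and> a \<le> \<mu> i \<and> (\<forall>x. pmf (Q x) i = logistic x) \<and>
           (\<forall>x b. b \<noteq> i \<longrightarrow> pmf (Q x) b = (1 - logistic x) * r b) \<longrightarrow>
           ennreal (l * ((1 - \<delta>) ^ 4 * real n powr (- p / 2) * logistic_var (\<mu> i) powr (p / 2) * gauss_abs_moment p))
             \<le> (\<integral>\<^sup>+x. ennreal (measure_pmf.expectation (replicate_pmf n (Q x))
                   (\<lambda>v. \<bar>logistic x - T v\<bar> powr p)) * indicator {a..a + l} x \<partial>lborel)) sequentially"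
    by (intro eventually_all_finite logistic_bayes_risk_ge p \<delta> l)
  then show ?thesis
  proof eventually_elim
    case (elim n)
    show ?case
    proof (intro allI impI)
      fix T :: "'a list \<Rightarrow> 'a \<Rightarrow> real" and D
      assume D: "\<forall>q. (\<Sum>i\<in>UNIV. coordinate_risk p n T i q) \<le> D"
      define R where "R = (\<lambda>i x. coordinate_risk p n T i (softmax x))"
      have R[measurable]: "R i \<in> borel_measurable (PiM UNIV M)" for i
        unfolding R_def by (intro measurable_coordinate_risk_softmax) simp
      \<comment> \<open>The average risk of coordinate \<open>i\<close> on the curve through \<open>x\<close> in direction \<open>i\<close>.\<close>
      have line: "ennreal (B n i) \<le> (\<integral>\<^sup>+y. ennreal (R i (x(i := y))) \<partial>M i)"
        if x: "\<And>b. b \<noteq> i \<Longrightarrow> x b \<in> {lo b..lo b + l}" for i x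
      proof (cases "pmf q0 i = 1")
        case True
        then show ?thesis by (simp add: B_def)
      next
        case False
        define t where "t = pmf q0 i"
        have t: "0 < t" "t < 1" using q0[of i] pmf_le_1[of q0 i] False by (auto simp: t_def)
        define S where "S = (\<Sum>b\<in>UNIV - {i}. exp (x b))"
        have ex: "pmf q0 b \<le> exp (x b)" "exp (x b) \<le> exp l * pmf q0 b" if "b \<noteq> i" for b
        proof -
          have "exp (lo b) = pmf q0 b" using q0[of b] by (simp add: lo_def)
          then show "pmf q0 b \<le> exp (x b)" "exp (x b) \<le> exp l * pmf q0 b"
            using x[OF that] by (metis atLeastAtMost_iff exp_le_cancel_iff, 
              metis add.commute atLeastAtMost_iff exp_add exp_le_cancel_iff)
        qed
        \<comment> \<open>Since \<open>S\<close> is \<open>1 - t\<close> up to a factor in \<open>{1..exp l}\<close>, the interval of log odds starts within \<open>l\<close> of \<open>\<mu> i\<close>.\<close>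
        have S_lo: "1 - t \<le> S" unfolding S_def t_def compl[symmetric] by (intro sum_mono ex) auto
        have S_hi: "S \<le> exp l * (1 - t)"
          unfolding S_def t_def compl[symmetric] sum_distrib_left by (intro sum_mono ex) auto
        have S: "0 < S" using S_lo t by simp
        define a where "a = lo i - ln S"
        have mu: "\<mu> i = lo i - ln (1 - t)" using t by (simp add: \<mu>_def lo_def t_def ln_div)
        have "ln (1 - t) \<le> ln S" using S_lo t S by simp
        moreover have "ln S \<le> ln (exp l * (1 - t))" using S_hi t S by simp
        then have "ln S \<le> l + ln (1 - t)" using t by (simp add: ln_mult)
        ultimately have a: "\<mu> i - l \<le> a" "a \<le> \<mu> i" by (simp_all add: mu a_def)
        define Q where "Q = (\<lambda>z. softmax (x(i := z + ln S)))"
        have tot: "(\<Sum>b\<in>UNIV. exp ((x(i := z + ln S)) b)) = S * (1 + exp z)" for z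
        proof -
          have "(\<Sum>b\<in>UNIV. exp ((x(i := z + ln S)) b)) = exp (z + ln S) + (\<Sum>b\<in>UNIV - {i}. exp ((x(i := z + ln S)) b))"
            by (subst sum.remove[of _ i]) auto
          also have "(\<Sum>b\<in>UNIV - {i}. exp ((x(i := z + ln S)) b)) = S"
            unfolding S_def by (intro sum.cong) auto
          finally show ?thesis using S by (simp add: exp_add algebra_simps)
        qed
        have Qi: "pmf (Q z) i = logistic z" for z
          unfolding Q_def pmf_softmax tot using S by (simp add: exp_add logistic_def)
        have Qb: "pmf (Q z) b = (1 - logistic z) * (exp (x b) / S)" if "b \<noteq> i" for z b
          unfolding Q_def pmf_softmax tot one_minus_logistic using that by simp
        have var: "logistic_var (\<mu> i) = t * (1 - t)"
          unfolding logistic_var_def \<mu>_def t_def[symmetric] logistic_logit[OF t] ..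
        have "ennreal (l * B n i) \<le> (\<integral>\<^sup>+z. ennreal (measure_pmf.expectation (replicate_pmf n (Q z))
                   (\<lambda>v. \<bar>logistic z - T v i\<bar> powr p)) * indicator {a..a + l} z \<partial>lborel)"
          using elim[rule_format, of i a Q "\<lambda>b. exp (x b) / S" "\<lambda>v. T v i"] a Qi Qb
          by (simp add: B_def var t_def)
        also have "\<dots> = (\<integral>\<^sup>+z. ennreal (R i (x(i := ln S + 1 * z))) * indicator {lo i..lo i + l} (ln S + 1 * z) \<partial>lborel)"
          by (intro nn_integral_cong)
            (simp add: R_def coordinate_risk_def Qi[symmetric] Q_def[symmetric] add.commute indicator_def a_def,
              simp add: Q_def add.commute algebra_simps)
        also have "\<dots> = (\<integral>\<^sup>+y. ennreal (R i (x(i := y))) * indicator {lo i..lo i + l} y \<partial>lborel)"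
        proof -
          have [measurable]: "(\<lambda>y. R i (x(i := y))) \<in> borel_measurable borel"
            unfolding R_def by (intro measurable_coordinate_risk_softmax) (simp add: fun_upd_def)
          show ?thesis
            using nn_integral_real_affine[of "\<lambda>y. ennreal (R i (x(i := y))) * indicator {lo i..lo i + l} y" 1 "ln S"]
            by simp
        qed
        finally have "ennreal (l * B n i) / ennreal l
            \<le> (\<integral>\<^sup>+y. ennreal (R i (x(i := y))) * indicator {lo i..lo i + l} y \<partial>lborel) / ennreal l"
          by (rule divide_right_mono_ennreal)
        moreover have "ennreal (l * B n i) / ennreal l = ennreal (B n i)"
        proof -
          have "0 \<le> B n i" using \<delta> by (simp add: B_def gauss_abs_moment_nonneg)
          then show ?thesis using l by (simp add: divide_ennreal)
        qed
        moreover have "(\<integral>\<^sup>+y. ennreal (R i (x(i := y))) \<partial>M i)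
            = (\<integral>\<^sup>+y. ennreal (R i (x(i := y))) * indicator {lo i..lo i + l} y \<partial>lborel) / ennreal l"
        proof -
          have [measurable]: "(\<lambda>y. R i (x(i := y))) \<in> borel_measurable borel"
            unfolding R_def by (intro measurable_coordinate_risk_softmax) (simp add: fun_upd_def)
          show ?thesis unfolding M_def using l by (subst nn_integral_uniform_measure) auto
        qed
        ultimately show ?thesis by simp
      qed
      have avg: "ennreal (B n i) \<le> (\<integral>\<^sup>+x. ennreal (R i x) \<partial>PiM UNIV M)" for i
      proof -
        let ?I = "UNIV - {i}"
        interpret P: prob_space "PiM ?I M" by (intro prob_space_PiM PM)
        have "AE x in PiM ?I M. x b \<in> {lo b..lo b + l}" if "b \<in> ?I" for b
        proof -
          have "AE y in M b. y \<in> {lo b..lo b + l}"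
            unfolding M_def using l by (intro AE_uniform_measureI) auto
          then show ?thesis using that PM by (intro AE_PiM_component) auto
        qed
        then have "AE x in PiM ?I M. \<forall>b\<in>?I. x b \<in> {lo b..lo b + l}"
          by (intro AE_finite_allI) auto
        then have ae: "AE x in PiM ?I M. ennreal (B n i) \<le> (\<integral>\<^sup>+y. ennreal (R i (x(i := y))) \<partial>M i)"
          by eventually_elim (intro line, auto)
        have "ennreal (B n i) = (\<integral>\<^sup>+x. ennreal (B n i) \<partial>PiM ?I M)"
          by (simp add: P.emeasure_space_1)
        also have "\<dots> \<le> (\<integral>\<^sup>+x. (\<integral>\<^sup>+y. ennreal (R i (x(i := y))) \<partial>M i) \<partial>PiM ?I M)"
          by (rule nn_integral_mono_AE[OF ae])
        also have "\<dots> = (\<integral>\<^sup>+x. ennreal (R i x) \<partial>PiM (insert i ?I) M)"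
          by (rule product_nn_integral_insert[symmetric]) (auto simp: insert_absorb)
        finally show ?thesis by (simp add: insert_absorb)
      qed
      have "0 \<le> (\<Sum>i\<in>UNIV. coordinate_risk p n T i q0)" by (intro sum_nonneg coordinate_risk_nonneg)
      with D have D0: "0 \<le> D" by (meson order_trans)
      interpret P: prob_space "PiM UNIV M" by (intro prob_space_PiM PM)
      have "ennreal (\<Sum>i\<in>UNIV. B n i) = (\<Sum>i\<in>UNIV. ennreal (B n i))"
        using \<delta> by (intro sum_ennreal[symmetric]) (simp add: B_def gauss_abs_moment_nonneg)
      also have "\<dots> \<le> (\<Sum>i\<in>UNIV. \<integral>\<^sup>+x. ennreal (R i x) \<partial>PiM UNIV M)" by (intro sum_mono avg)
      also have "\<dots> = (\<integral>\<^sup>+x. (\<Sum>i\<in>UNIV. ennreal (R i x)) \<partial>PiM UNIV M)"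
        by (rule nn_integral_sum[symmetric]) measurable
      also have "\<dots> \<le> (\<integral>\<^sup>+x. ennreal D \<partial>PiM UNIV M)"
      proof (intro nn_integral_mono)
        fix x
        have "(\<Sum>i\<in>UNIV. ennreal (R i x)) = ennreal (\<Sum>i\<in>UNIV. R i x)"
          by (intro sum_ennreal) (auto simp: R_def coordinate_risk_nonneg)
        also have "\<dots> \<le> ennreal D" using D by (intro ennreal_leI) (simp add: R_def)
        finally show "(\<Sum>i\<in>UNIV. ennreal (R i x)) \<le> ennreal D" .
      qed
      also have "\<dots> = ennreal D" by (simp add: P.emeasure_space_1)
      finally show "(\<Sum>i\<in>UNIV. (1 - \<delta>) ^ 4 * real n powr (- p / 2) *
              (pmf q0 i * (1 - pmf q0 i)) powr (p / 2) * gauss_abs_moment p) \<le> D"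
        using D0 by (simp add: B_def)
    qed
  qed
qed

lemma pmf_bernoulli_mixture:
  assumes "s \<in> {0..1}"
  shows "pmf (bind_pmf (bernoulli_pmf s) (\<lambda>b. if b then u else q)) a = s * pmf u a + (1 - s) * pmf q a"
  using assms by (simp add: pmf_bind integral_bernoulli_pmf)

text \<open>
  The least favourable distribution may lie on the boundary of the simplex. Mixing it with the uniform
  distribution moves it into the interior at an arbitrarily small cost. The estimator \<open>T\<close> has arbitrary
  real values because in the semi-supervised problem it will be a slice of an estimated joint
  distribution, which need not have total mass one.
\<close>

proposition estimation_risk_ge:
  assumes p: "1 \<le> p" and \<epsilon>: "0 < \<epsilon>"
  shows "eventually (\<lambda>n. \<forall>(T :: 'a::finite list \<Rightarrow> 'a \<Rightarrow> real) D.
           (\<forall>q. (\<Sum>i\<in>UNIV. coordinate_risk p n T i q) \<le> D) \<longrightarrow>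
           (sharp_risk_const TYPE('a) p - \<epsilon>) * real n powr (- p / 2) \<le> D) sequentially"
proof -
  define c where "c = gauss_abs_moment p"
  have c: "0 < c" using gauss_abs_moment_pos[of p] p by (simp add: c_def)
  define h where "h = (\<lambda>q :: 'a pmf. \<Sum>a\<in>UNIV. (pmf q a * (1 - pmf q a)) powr (p / 2))"
  define C where "C = sharp_risk_const TYPE('a) p"
  have C: "C = c * (SUP q. h q)" by (simp add: C_def c_def h_def sharp_risk_const_def)
  have bdd: "bdd_above (range h)" unfolding h_def using p by (intro multinomial_variance_powr_bdd) auto
  have "(SUP q. h q) - \<epsilon> / c < (SUP q. h q)" using c \<epsilon> by simp
  then obtain q1 where "(SUP q. h q) - \<epsilon> / c < h q1" using bdd by (auto simp: less_cSUP_iff)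
  then have "c * ((SUP q. h q) - \<epsilon> / c) < c * h q1" using c by (intro mult_strict_left_mono)
  then have q1: "C - \<epsilon> < c * h q1" using c by (simp add: C algebra_simps)
  define u where "u = pmf_of_set (UNIV :: 'a set)"
  have u: "pmf u a = 1 / real CARD('a)" for a by (simp add: u_def)
  \<comment> \<open>The double successor keeps the mixing weight strictly below one.\<close>
  define s where "s = (\<lambda>k. inverse (real (Suc (Suc k))))"
  have s: "s k \<in> {0..1}" "0 < s k" "s k < 1" for k by (auto simp: s_def field_simps)
  have s0: "s \<longlonglongrightarrow> 0" unfolding s_def by (rule LIMSEQ_Suc[OF LIMSEQ_inverse_real_of_nat])
  define q where "q = (\<lambda>k. bind_pmf (bernoulli_pmf (s k)) (\<lambda>b. if b then u else q1))"
  have q: "pmf (q k) a = s k * pmf u a + (1 - s k) * pmf q1 a" for k a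
    unfolding q_def by (rule pmf_bernoulli_mixture[OF s(1)])
  have qlim: "(\<lambda>k. pmf (q k) a) \<longlonglongrightarrow> pmf q1 a" for a
  proof -
    have "(\<lambda>k. s k * pmf u a + (1 - s k) * pmf q1 a) \<longlonglongrightarrow> 0 * pmf u a + (1 - 0) * pmf q1 a"
      by (intro tendsto_intros s0)
    then show ?thesis by (simp add: q)
  qed
  have "(\<lambda>k. h (q k)) \<longlonglongrightarrow> h q1"
    unfolding h_def
  proof (rule tendsto_sum)
    fix a
    show "(\<lambda>k. (pmf (q k) a * (1 - pmf (q k) a)) powr (p / 2)) \<longlonglongrightarrow> (pmf q1 a * (1 - pmf q1 a)) powr (p / 2)"
      using p by (intro tendsto_powr' tendsto_intros qlim) (auto simp: pmf_le_1)
  qed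
  then have "(\<lambda>k. (1 - s k) ^ 4 * (c * h (q k))) \<longlonglongrightarrow> (1 - 0) ^ 4 * (c * h q1)"
    by (intro tendsto_intros s0)
  then have "eventually (\<lambda>k. C - \<epsilon> < (1 - s k) ^ 4 * (c * h (q k))) sequentially"
    using q1 by (intro order_tendstoD) auto
  then obtain k where k: "C - \<epsilon> < (1 - s k) ^ 4 * (c * h (q k))"
    using eventually_happens'[OF sequentially_bot] by blast
  have qpos: "0 < pmf (q k) a" for a
    using s[of k] by (simp add: q u add_pos_nonneg)
  from interior_bayes_risk_ge[OF p s(2)[of k] s(3)[of k] qpos] show ?thesis
  proof eventually_elim
    case (elim n)
    show ?case
    proof (intro allI impI)
      fix T :: "'a list \<Rightarrow> 'a \<Rightarrow> real" and D
      assume "\<forall>q. (\<Sum>i\<in>UNIV. coordinate_risk p n T i q) \<le> D"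
      with elim have D: "(\<Sum>i\<in>UNIV. (1 - s k) ^ 4 * real n powr (- p / 2) *
              (pmf (q k) i * (1 - pmf (q k) i)) powr (p / 2) * gauss_abs_moment p) \<le> D" by blast
      have "(C - \<epsilon>) * real n powr (- p / 2) \<le> ((1 - s k) ^ 4 * (c * h (q k))) * real n powr (- p / 2)"
        using k by (intro mult_right_mono) auto
      also have "\<dots> = (\<Sum>i\<in>UNIV. (1 - s k) ^ 4 * real n powr (- p / 2) *
              (pmf (q k) i * (1 - pmf (q k) i)) powr (p / 2) * gauss_abs_moment p)"
        by (simp add: h_def c_def sum_distrib_left sum_distrib_right mult_ac)
      also note D
      finally show "(sharp_risk_const TYPE('a) p - \<epsilon>) * real n powr (- p / 2) \<le> D"
        by (simp add: C_def)
    qed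
  qed
qed

section \<open>Estimation from a binomially thinned sample\<close>

text \<open>
  A Chernoff bound. It decays in \<open>m * a\<close>, and not merely in \<open>m * a\<^sup>2\<close> as Hoeffding's inequality would,
  which is what makes the thinning argument uniform over small \<open>a\<close>.
\<close>

lemma binomial_lower_tail:
  assumes th: "a \<in> {0..1}" and \<eta>: "0 \<le> \<eta>" "\<eta> \<le> 1"
  shows "measure_pmf.expectation (binomial_pmf m a) (\<lambda>k. exp (\<eta> / 4 * ((1 - \<eta>) * real m * a - real k)))
           \<le> exp (- (\<eta>\<^sup>2 / 8 * (real m * a)))"
proof -
  let ?t = "\<eta> / 4"
  have "exp (?t * ((1 - \<eta>) * real m * a - real k)) = exp (?t * (1 - \<eta>) * real m * a) * exp (- ?t) ^ k" for k
    by (simp add: exp_of_nat_mult[symmetric] exp_add[symmetric] algebra_simps)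
  then have "measure_pmf.expectation (binomial_pmf m a) (\<lambda>k. exp (?t * ((1 - \<eta>) * real m * a - real k)))
      = exp (?t * (1 - \<eta>) * real m * a) * (1 - a + a * exp (- ?t)) ^ m"
    using binomial_expectation_power[OF th, of m "exp (- ?t)"] by simp
  also have "\<dots> \<le> exp (?t * (1 - \<eta>) * real m * a) * exp (real m * (a * (- ?t + 2 * ?t\<^sup>2)))"
  proof (intro mult_left_mono)
    have "1 - a + a * exp (- ?t) \<le> 1 - a + a * (1 + - ?t + 2 * (- ?t)\<^sup>2)"
      using th \<eta> by (intro add_left_mono mult_left_mono exp_le_quadratic) auto
    also have "\<dots> = 1 + a * (- ?t + 2 * ?t\<^sup>2)" by (simp add: algebra_simps)
    also have "\<dots> \<le> exp (a * (- ?t + 2 * ?t\<^sup>2))" by (rule exp_ge_add_one_self)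
    finally have "(1 - a + a * exp (- ?t)) ^ m \<le> exp (a * (- ?t + 2 * ?t\<^sup>2)) ^ m"
      using th by (intro power_mono) auto
    then show "(1 - a + a * exp (- ?t)) ^ m \<le> exp (real m * (a * (- ?t + 2 * ?t\<^sup>2)))"
      by (simp only: exp_of_nat_mult)
  qed simp
  also have "\<dots> = exp (- (\<eta>\<^sup>2 / 8 * (real m * a)))"
    unfolding exp_add[symmetric] by (rule arg_cong[where f = exp]) (simp add: field_simps power2_eq_square)
  finally show ?thesis .
qed

lemma powr_le_exp_mult:
  fixes x c p :: real
  assumes "0 \<le> x" "0 < c" "0 < p"
  shows "x powr p \<le> (p / c) powr p * exp (c * x)"
proof -
  have "c * x / p \<le> exp (c * x / p)" using exp_ge_add_one_self[of "c * x / p"] by linarith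
  then have "(c * x / p) powr p \<le> exp (c * x / p) powr p" using assms by (intro powr_mono2) auto
  also have "\<dots> = exp (c * x)" using assms by (simp add: exp_powr_real)
  finally have "(p / c) powr p * (c * x / p) powr p \<le> (p / c) powr p * exp (c * x)"
    by (intro mult_left_mono) auto
  moreover have "(p / c) powr p * (c * x / p) powr p = x powr p"
    using assms by (simp add: powr_mult[symmetric])
  ultimately show ?thesis by simp
qed

text \<open>
  With \<open>m\<close> labelled samples in total, a letter of probability \<open>a\<close> receives a binomial number of them. If
  \<open>m * a\<close> is bounded, then \<open>a powr p\<close> is of order \<open>m powr (- p)\<close> and any bound on \<open>\<rho>\<close> suffices.
  Otherwise the number is at least \<open>(1 - \<eta>) * m * a\<close> up to an exponentially small
  probability, and the rate of \<open>\<rho>\<close> can be inserted.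
\<close>

lemma thinned_risk_le:
  fixes \<rho> :: "nat \<Rightarrow> real"
  assumes p: "0 < p" and R: "0 \<le> R" and \<epsilon>: "0 < \<epsilon>"
    and bound: "\<And>k. \<rho> k \<le> B"
    and rate: "eventually (\<lambda>k. \<rho> k \<le> R * real k powr (- p / 2)) sequentially"
  shows "eventually (\<lambda>m. \<forall>a\<in>{0..1}. a powr p * measure_pmf.expectation (binomial_pmf m a) \<rho>
           \<le> (R * a powr (p / 2) + \<epsilon>) * real m powr (- p / 2)) sequentially"
proof -
  define D where "D = max B 0"
  have D: "0 \<le> D" "\<rho> k \<le> D" for k using bound[of k] by (auto simp: D_def)
  have "(\<lambda>k. R * (1 - inverse (real (Suc (Suc k)))) powr (- p / 2)) \<longlonglongrightarrow> R * (1 - 0) powr (- p / 2)"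
    by (intro tendsto_intros LIMSEQ_Suc[OF LIMSEQ_inverse_real_of_nat]) auto
  then have "eventually (\<lambda>k. R * (1 - inverse (real (Suc (Suc k)))) powr (- p / 2) < R + \<epsilon> / 2) sequentially"
    using \<epsilon> by (intro order_tendstoD) auto
  then obtain j where j: "R * (1 - inverse (real (Suc (Suc j)))) powr (- p / 2) < R + \<epsilon> / 2"
    using eventually_happens'[OF sequentially_bot] by blast
  define \<eta> where "\<eta> = inverse (real (Suc (Suc j)))"
  have \<eta>: "0 < \<eta>" "\<eta> < 1" "R * (1 - \<eta>) powr (- p / 2) \<le> R + \<epsilon> / 2"
    using j by (auto simp: \<eta>_def field_simps)
  obtain k0 where k0: "\<And>k. k0 \<le> k \<Longrightarrow> \<rho> k \<le> R * real k powr (- p / 2)"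
    using rate by (auto simp: eventually_sequentially)
  define k1 where "k1 = real (Suc k0)"
  define c where "c = \<eta>\<^sup>2 / 8"
  have c: "0 < c" using \<eta> by (simp add: c_def)
  define K where "K = D * (k1 / (1 - \<eta>)) powr p + D * (p / c) powr p"
  have Kparts: "D * (k1 / (1 - \<eta>)) powr p \<le> K" "D * (p / c) powr p \<le> K" "0 \<le> K"
    using D by (auto simp: K_def)
  have "(\<lambda>m. K * real m powr (- p / 2)) \<longlonglongrightarrow> K * 0"
    using p by (intro tendsto_mult_left tendsto_neg_powr filterlim_real_sequentially) auto
  then have "eventually (\<lambda>m. K * real m powr (- p / 2) < \<epsilon> / 2) sequentially"
    using \<epsilon> by (intro order_tendstoD) auto
  then show ?thesis
    using eventually_gt_at_top[of 0]
  proof eventually_elim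
    case (elim m)
    have m: "0 < real m" using elim by simp
    have split_m: "real m powr (- p) = real m powr (- p / 2) * real m powr (- p / 2)"
      by (simp flip: powr_add)
    have Km: "K * real m powr (- p) \<le> \<epsilon> / 2 * real m powr (- p / 2)"
      unfolding split_m mult.assoc[symmetric] using elim by (intro mult_right_mono) auto
    show ?case
    proof
      fix a :: real assume a: "a \<in> {0..1}"
      let ?E = "measure_pmf.expectation (binomial_pmf m a)"
      define s where "s = (1 - \<eta>) * real m * a"
      show "a powr p * ?E \<rho> \<le> (R * a powr (p / 2) + \<epsilon>) * real m powr (- p / 2)"
      proof (cases "s < k1")
        case True
        have "real m * a \<le> k1 / (1 - \<eta>)" using True \<eta> by (simp add: s_def field_simps)
        then have "(real m * a) powr p \<le> (k1 / (1 - \<eta>)) powr p" using a p by (intro powr_mono2) auto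
        moreover have ap: "a powr p = (real m * a) powr p * real m powr (- p)"
          using m by (simp add: powr_mult powr_minus)
        ultimately have "a powr p \<le> (k1 / (1 - \<eta>)) powr p * real m powr (- p)"
          by (simp only: ap) (intro mult_right_mono, auto)
        moreover have "?E \<rho> \<le> D"
        proof -
          have "?E \<rho> \<le> ?E (\<lambda>k. D)" using a D by (intro integral_mono) auto
          then show ?thesis by simp
        qed
        ultimately have "a powr p * ?E \<rho> \<le> (k1 / (1 - \<eta>)) powr p * real m powr (- p) * D"
          using D by (intro order_trans[OF mult_left_mono mult_right_mono]) auto
        also have "\<dots> = (D * (k1 / (1 - \<eta>)) powr p) * real m powr (- p)" by simp
        also have "\<dots> \<le> K * real m powr (- p)" by (intro mult_right_mono Kparts) auto
        also note Km
        also have "\<epsilon> / 2 * real m powr (- p / 2) \<le> (R * a powr (p / 2) + \<epsilon>) * real m powr (- p / 2)"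
          using R \<epsilon> by (intro mult_right_mono add_increasing) auto
        finally show ?thesis .
      next
        case False
        have k1: "0 < k1" "real k0 \<le> k1" by (auto simp: k1_def)
        have s: "0 < s" "k1 \<le> s" using False k1 by auto
        have apos: "0 < a" using s(1) a \<eta> m by (auto simp: s_def zero_less_mult_iff)
        have le: "\<rho> k \<le> R * s powr (- p / 2) + D * exp (\<eta> / 4 * (s - real k))" for k
        proof (cases "s \<le> real k")
          case True
          then have "k0 \<le> k" using s k1 by linarith
          then have "\<rho> k \<le> R * real k powr (- p / 2)" by (rule k0)
          also have "\<dots> \<le> R * s powr (- p / 2)"
            using True s p R by (intro mult_left_mono powr_mono2') auto
          finally show ?thesis using D by (simp add: add_increasing2)
        next
          case False
          then have "1 \<le> exp (\<eta> / 4 * (s - real k))" using \<eta> by simp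
          then have "D * 1 \<le> D * exp (\<eta> / 4 * (s - real k))" using D by (intro mult_left_mono)
          then show ?thesis using D(2)[of k] R by (simp add: add_increasing)
        qed
        have "?E \<rho> \<le> ?E (\<lambda>k. R * s powr (- p / 2) + D * exp (\<eta> / 4 * (s - real k)))"
          using a by (intro integral_mono le) auto
        also have "\<dots> = R * s powr (- p / 2) + D * ?E (\<lambda>k. exp (\<eta> / 4 * (s - real k)))"
          using a by (subst Bochner_Integration.integral_add) auto
        also have "\<dots> \<le> R * s powr (- p / 2) + D * exp (- (c * (real m * a)))"
          using binomial_lower_tail[OF a, of \<eta> m] \<eta> D unfolding s_def c_def
          by (intro add_left_mono mult_left_mono) auto
        finally have E: "?E \<rho> \<le> R * s powr (- p / 2) + D * exp (- (c * (real m * a)))" .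
        have t1: "a powr p * (R * s powr (- p / 2)) \<le> (R * a powr (p / 2) + \<epsilon> / 2) * real m powr (- p / 2)"
        proof -
          have e1: "s powr (- p / 2) = (1 - \<eta>) powr (- p / 2) * (real m powr (- p / 2) * a powr (- p / 2))"
            using \<eta> m a by (simp add: s_def powr_mult)
          have e2: "a powr p * a powr (- p / 2) = a powr (p / 2)" by (simp flip: powr_add)
          have "a powr p * (R * s powr (- p / 2))
              = (R * (1 - \<eta>) powr (- p / 2)) * (a powr p * a powr (- p / 2)) * real m powr (- p / 2)"
            by (simp only: e1 mult_ac)
          also have "\<dots> = (R * (1 - \<eta>) powr (- p / 2)) * a powr (p / 2) * real m powr (- p / 2)"
            by (simp only: e2)
          also have "\<dots> \<le> (R + \<epsilon> / 2) * a powr (p / 2) * real m powr (- p / 2)"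
            using \<eta>(3) by (intro mult_right_mono) auto
          also have "\<dots> \<le> (R * a powr (p / 2) + \<epsilon> / 2) * real m powr (- p / 2)"
          proof (intro mult_right_mono)
            have "a powr (p / 2) \<le> 1" using powr_mono2[of "p / 2" a 1] a p by auto
            then have "\<epsilon> / 2 * a powr (p / 2) \<le> \<epsilon> / 2" using \<epsilon> by (intro mult_right_le_one_le) auto
            then show "(R + \<epsilon> / 2) * a powr (p / 2) \<le> R * a powr (p / 2) + \<epsilon> / 2"
              by (simp add: distrib_right)
          qed auto
          finally show ?thesis .
        qed
        have t2: "a powr p * (D * exp (- (c * (real m * a)))) \<le> \<epsilon> / 2 * real m powr (- p / 2)"
        proof -
          have ap: "a powr p = (real m * a) powr p * real m powr (- p)"
            using m by (simp add: powr_mult powr_minus)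
          have "(real m * a) powr p * exp (- (c * (real m * a))) \<le> (p / c) powr p"
            using mult_right_mono[OF powr_le_exp_mult[of "real m * a" c p], of "exp (- (c * (real m * a)))"] a c p
            by (simp only: mult.assoc exp_add[symmetric]) simp
          then have "D * real m powr (- p) * ((real m * a) powr p * exp (- (c * (real m * a))))
              \<le> D * real m powr (- p) * (p / c) powr p"
            using D by (intro mult_left_mono) auto
          then have "a powr p * (D * exp (- (c * (real m * a)))) \<le> (D * (p / c) powr p) * real m powr (- p)"
            by (simp only: ap mult_ac)
          also have "\<dots> \<le> K * real m powr (- p)" by (intro mult_right_mono Kparts) auto
          also note Km
          finally show ?thesis .
        qed
        have "a powr p * ?E \<rho> \<le> a powr p * (R * s powr (- p / 2) + D * exp (- (c * (real m * a))))"
          by (intro mult_left_mono E) auto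
        also have "\<dots> \<le> (R * a powr (p / 2) + \<epsilon> / 2) * real m powr (- p / 2) + \<epsilon> / 2 * real m powr (- p / 2)"
          using add_mono[OF t1 t2] by (simp add: distrib_left)
        also have "\<dots> = (R * a powr (p / 2) + \<epsilon>) * real m powr (- p / 2)" by (simp add: algebra_simps)
        finally show ?thesis .
      qed
    qed
  qed
qed

section \<open>The error of the joint composition\<close>

lemma sum_slice_fst: "(\<Sum>z\<in>{x} \<times> UNIV. g z) = (\<Sum>y\<in>UNIV. g (x, y))"
  by (rule sum.reindex_bij_witness[of _ "Pair x" snd]) auto

lemma sum_slice_snd: "(\<Sum>z\<in>UNIV \<times> {y}. g z) = (\<Sum>x\<in>UNIV. g (x, y))"
  by (rule sum.reindex_bij_witness[of _ "\<lambda>x. (x, y)" fst]) auto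

lemma expectation_replicate_pmf_Suc:
  fixes P :: "'a::finite pmf" and h :: "'a list \<Rightarrow> real"
  shows "measure_pmf.expectation (replicate_pmf (Suc n) P) h
           = (\<Sum>z\<in>UNIV. pmf P z * measure_pmf.expectation (replicate_pmf n P) (\<lambda>l. h (z # l)))"
proof -
  have "replicate_pmf (Suc n) P = bind_pmf P (\<lambda>z. map_pmf ((#) z) (replicate_pmf n P))"
    by (simp add: map_pmf_def)
  then show ?thesis
    by (simp add: pmf_expectation_bind[where A = UNIV] integral_map_pmf)
qed

lemma expectation_binomial_pmf_Suc:
  fixes g :: "nat \<Rightarrow> real"
  assumes a: "a \<in> {0..1}"
  shows "measure_pmf.expectation (binomial_pmf (Suc m) a) g
           = a * measure_pmf.expectation (binomial_pmf m a) (\<lambda>k. g (Suc k))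
             + (1 - a) * measure_pmf.expectation (binomial_pmf m a) g"
proof -
  let ?f = "\<lambda>\<beta>. map_pmf (\<lambda>k. (if \<beta> then 1 else 0) + k) (binomial_pmf m a)"
  have "binomial_pmf (Suc m) a = bind_pmf (bernoulli_pmf a) ?f"
    by (simp only: binomial_pmf_Suc[OF a] map_pmf_def)
  also have "measure_pmf.expectation \<dots> g
      = (\<Sum>\<beta>\<in>UNIV. pmf (bernoulli_pmf a) \<beta> *\<^sub>R measure_pmf.expectation (?f \<beta>) g)"
    using finite_set_pmf_binomial_pmf[OF a] by (intro pmf_expectation_bind) auto
  finally show ?thesis using a by (simp add: UNIV_bool integral_map_pmf)
qed

text \<open>
  The labels seen at \<open>x\<close> are, given their number, independent draws from the conditional law of \<open>y\<close> at
  \<open>x\<close>, and their number is binomial. If \<open>x\<close> has probability zero, then \<open>b\<close> can be arbitrary.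
\<close>

lemma expectation_cond_sample:
  fixes P :: "('x::finite \<times> 'y::finite) pmf" and b :: "'y pmf" and h :: "'y list \<Rightarrow> real"
  assumes a: "a = pmf (map_pmf fst P) x" and b: "\<And>y. pmf P (x, y) = a * pmf b y"
  shows "measure_pmf.expectation (replicate_pmf m P) (\<lambda>l. h (cond_sample x l))
           = measure_pmf.expectation (binomial_pmf m a)
               (\<lambda>k. measure_pmf.expectation (replicate_pmf k b) h)"
proof (induction m arbitrary: h)
  case 0
  have "a \<in> {0..1}" by (simp add: a pmf_le_1)
  then show ?case by (simp add: binomial_pmf_0 cond_sample_def)
next
  case (Suc m)
  have a01: "a \<in> {0..1}" by (simp add: a pmf_le_1)
  let ?E = "\<lambda>h. measure_pmf.expectation (replicate_pmf m P) (\<lambda>l. h (cond_sample x l))"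
  let ?B = "measure_pmf.expectation (binomial_pmf m a)"
  let ?b = "\<lambda>k. measure_pmf.expectation (replicate_pmf k b)"
  have "(\<Sum>z\<in>UNIV. pmf P z) = 1" by (rule sum_pmf_eq_1) auto
  moreover have "(\<Sum>z\<in>UNIV. pmf P z) = (\<Sum>z\<in>{x} \<times> UNIV. pmf P z) + (\<Sum>z\<in>UNIV - {x} \<times> UNIV. pmf P z)"
    by (subst sum.subset_diff[of "{x} \<times> UNIV"]) (auto simp: add.commute)
  moreover have "(\<Sum>z\<in>{x} \<times> UNIV. pmf P z) = (\<Sum>y\<in>UNIV. pmf P (x, y))"
    by (rule sum_slice_fst)
  moreover have "(\<Sum>y\<in>UNIV. pmf P (x, y)) = a"
    using sum_pmf_eq_1[of UNIV b] by (simp add: b flip: sum_distrib_left)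
  ultimately have rest: "(\<Sum>z\<in>UNIV - {x} \<times> UNIV. pmf P z) = 1 - a" by simp
  have "measure_pmf.expectation (replicate_pmf (Suc m) P) (\<lambda>l. h (cond_sample x l))
      = (\<Sum>z\<in>UNIV. pmf P z * measure_pmf.expectation (replicate_pmf m P) (\<lambda>l. h (cond_sample x (z # l))))"
    by (rule expectation_replicate_pmf_Suc)
  also have "\<dots> = (\<Sum>z\<in>{x} \<times> UNIV. pmf P z * measure_pmf.expectation (replicate_pmf m P) (\<lambda>l. h (cond_sample x (z # l))))
                + (\<Sum>z\<in>UNIV - {x} \<times> UNIV. pmf P z * measure_pmf.expectation (replicate_pmf m P) (\<lambda>l. h (cond_sample x (z # l))))"
    by (subst sum.subset_diff[of "{x} \<times> UNIV"]) (auto simp: add.commute)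
  also have "(\<Sum>z\<in>{x} \<times> UNIV. pmf P z * measure_pmf.expectation (replicate_pmf m P) (\<lambda>l. h (cond_sample x (z # l))))
      = (\<Sum>y\<in>UNIV. pmf P (x, y) * ?E (\<lambda>v. h (y # v)))"
    by (simp only: sum_slice_fst) (simp add: cond_sample_def)
  also have "\<dots> = (\<Sum>y\<in>UNIV. a * pmf b y * ?B (\<lambda>k. ?b k (\<lambda>v. h (y # v))))"
  proof (intro sum.cong refl)
    fix y
    show "pmf P (x, y) * ?E (\<lambda>v. h (y # v)) = a * pmf b y * ?B (\<lambda>k. ?b k (\<lambda>v. h (y # v)))"
      using Suc.IH[of "\<lambda>v. h (y # v)"] by (simp only: b)
  qed
  also have "\<dots> = a * ?B (\<lambda>k. \<Sum>y\<in>UNIV. pmf b y * ?b k (\<lambda>v. h (y # v)))"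
    using a01 by (subst Bochner_Integration.integral_sum) (auto simp: sum_distrib_left mult.assoc)
  also have "\<dots> = a * ?B (\<lambda>k. ?b (Suc k) h)"
    by (simp only: expectation_replicate_pmf_Suc)
  also have "(\<Sum>z\<in>UNIV - {x} \<times> UNIV. pmf P z * measure_pmf.expectation (replicate_pmf m P) (\<lambda>l. h (cond_sample x (z # l))))
      = (\<Sum>z\<in>UNIV - {x} \<times> UNIV. pmf P z * ?E h)"
  proof (intro sum.cong refl)
    fix z assume "z \<in> UNIV - {x} \<times> (UNIV :: 'y set)"
    then have "fst z \<noteq> x" by (cases z) auto
    then show "pmf P z * measure_pmf.expectation (replicate_pmf m P) (\<lambda>l. h (cond_sample x (z # l))) = pmf P z * ?E h"
      by (simp add: cond_sample_def)
  qed
  also have "\<dots> = (1 - a) * ?B (\<lambda>k. ?b k h)"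
    by (simp only: sum_distrib_right[symmetric] rest Suc.IH)
  also have "a * ?B (\<lambda>k. ?b (Suc k) h) + (1 - a) * ?B (\<lambda>k. ?b k h)
      = measure_pmf.expectation (binomial_pmf (Suc m) a) (\<lambda>k. ?b k h)"
    by (rule expectation_binomial_pmf_Suc[OF a01, symmetric])
  finally show ?case .
qed

text \<open>
  Convexity with weights \<open>1 - w\<close> and \<open>w\<close>. For small \<open>w\<close> the main term \<open>s\<close> is charged a factor close
  to one, and the negligible term \<open>t\<close> pays with a large constant.
\<close>

lemma add_powr_le:
  fixes s t p w :: real
  assumes "1 \<le> p" "0 \<le> s" "0 \<le> t" "0 < w" "w < 1"
  shows "(s + t) powr p \<le> (1 - w) powr (1 - p) * s powr p + w powr (1 - p) * t powr p"
proof (cases "s = 0 \<or> t = 0")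
  case True
  have "1 \<le> (1 - w) powr (1 - p)" "1 \<le> w powr (1 - p)"
    using powr_mono'[of "1 - p" 0 "1 - w"] powr_mono'[of "1 - p" 0 w] assms by simp_all
  then have "1 * s powr p \<le> (1 - w) powr (1 - p) * s powr p" "1 * t powr p \<le> w powr (1 - p) * t powr p"
    by (intro mult_right_mono; simp)+
  then show ?thesis using True assms by auto
next
  case False
  then have st: "0 < s" "0 < t" using assms by auto
  have "(s + t) powr p = ((1 - w) * (s / (1 - w)) + w * (t / w)) powr p" using assms by simp
  also have "\<dots> \<le> (1 - w) * (s / (1 - w)) powr p + w * (t / w) powr p"
    using convex_onD[OF powr_convex[OF assms(1)], of w "s / (1 - w)" "t / w"] assms st by simp
  also have "(1 - w) * (s / (1 - w)) powr p = (1 - w) powr (1 - p) * s powr p"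
    using assms by (simp add: powr_divide powr_diff)
  also have "w * (t / w) powr p = w powr (1 - p) * t powr p"
    using assms by (simp add: powr_divide powr_diff)
  finally show ?thesis .
qed

text \<open>
  For \<open>x\<close> of probability zero this is unspecified.
\<close>

definition cond_law :: "('x \<times> 'y) pmf \<Rightarrow> 'x \<Rightarrow> 'y pmf" where
  "cond_law P x = map_pmf snd (cond_pmf P {z. fst z = x})"

lemma pmf_map_fst: 
  fixes P :: "('x::finite \<times> 'y::finite) pmf"
  shows "pmf (map_pmf fst P) x = (\<Sum>y\<in>UNIV. pmf P (x, y))"
proof -
  have "pmf (map_pmf fst P) x = measure_pmf.prob P ({x} \<times> UNIV)"
    by (simp add: pmf_map, rule arg_cong[where f = "measure_pmf.prob P"], auto)
  also have "\<dots> = (\<Sum>z\<in>{x} \<times> UNIV. pmf P z)" by (rule measure_measure_pmf_finite) auto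
  finally show ?thesis by (simp only: sum_slice_fst)
qed

lemma pmf_eq_marginal_times_cond:
  fixes P :: "('x::finite \<times> 'y::finite) pmf"
  shows "pmf P (x, y) = pmf (map_pmf fst P) x * pmf (cond_law P x) y"
proof (cases "pmf (map_pmf fst P) x = 0")
  case True
  then have "(\<Sum>y\<in>UNIV. pmf P (x, y)) = 0" by (simp add: pmf_map_fst)
  then have "pmf P (x, y) = 0" by (subst (asm) sum_nonneg_eq_0_iff) auto
  with True show ?thesis by simp
next
  case False
  then have "x \<in> set_pmf (map_pmf fst P)" by (simp only: set_pmf_iff not_False_eq_True)
  then have ne: "set_pmf P \<inter> {z. fst z = x} \<noteq> {}" by auto
  have m: "measure_pmf.prob P {z. fst z = x} = pmf (map_pmf fst P) x"
    by (simp add: pmf_map vimage_def)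
  have "pmf (cond_law P x) y = measure_pmf.prob (cond_pmf P {z. fst z = x}) (snd -` {y})"
    by (simp add: cond_law_def pmf_map)
  also have "\<dots> = (\<Sum>z\<in>UNIV \<times> {y}. pmf (cond_pmf P {z. fst z = x}) z)"
    by (subst measure_measure_pmf_finite[symmetric]) (auto intro: arg_cong[where f = "measure_pmf.prob _"])
  also have "\<dots> = (\<Sum>x'\<in>UNIV. pmf (cond_pmf P {z. fst z = x}) (x', y))"
    by (rule sum_slice_snd)
  also have "\<dots> = pmf P (x, y) / pmf (map_pmf fst P) x"
    using ne by (simp add: pmf_cond m if_distrib sum.If_cases)
  finally show ?thesis using False by simp
qed

text \<open>
  The error at \<open>(x, y)\<close> is \<open>A * (b - b') + (A - A') * b'\<close>, where \<open>A\<close> and \<open>b\<close> are the marginal and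
  conditional probabilities and \<open>A'\<close> and \<open>b'\<close> are their estimates.
\<close>

lemma joint_comp_loss_le:
  fixes P :: "('x::finite \<times> 'y::finite) pmf"
  assumes p: "1 \<le> p" and w: "0 < w" "w < 1"
  shows "lp_loss p P (joint_comp qs u l)
    \<le> (1 - w) powr (1 - p) * (\<Sum>x\<in>UNIV. pmf (map_pmf fst P) x powr p * lp_loss p (cond_law P x) (cond_comp qs l x))
      + w powr (1 - p) * real CARD('y) * lp_loss p (map_pmf fst P) (empirical (u @ map fst l))"
proof -
  let ?A = "pmf (map_pmf fst P)" and ?A' = "pmf (empirical (u @ map fst l))"
  let ?b = "\<lambda>x. pmf (cond_law P x)" and ?b' = "\<lambda>x. pmf (cond_comp qs l x)"
  have pt: "\<bar>pmf P (x, y) - pmf (joint_comp qs u l) (x, y)\<bar> powr p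
      \<le> (1 - w) powr (1 - p) * (?A x powr p * \<bar>?b x y - ?b' x y\<bar> powr p)
        + w powr (1 - p) * \<bar>?A x - ?A' x\<bar> powr p" for x y
  proof -
    have "pmf P (x, y) - pmf (joint_comp qs u l) (x, y)
        = ?A x * (?b x y - ?b' x y) + (?A x - ?A' x) * ?b' x y"
      by (simp add: pmf_joint_comp pmf_eq_marginal_times_cond[of P] algebra_simps)
    also have "\<bar>\<dots>\<bar> \<le> \<bar>?A x * (?b x y - ?b' x y)\<bar> + \<bar>(?A x - ?A' x) * ?b' x y\<bar>"
      by (rule abs_triangle_ineq)
    also have "\<dots> \<le> ?A x * \<bar>?b x y - ?b' x y\<bar> + \<bar>?A x - ?A' x\<bar>"
      by (simp add: abs_mult mult_left_le pmf_le_1)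
    finally have "\<bar>pmf P (x, y) - pmf (joint_comp qs u l) (x, y)\<bar> powr p
        \<le> (?A x * \<bar>?b x y - ?b' x y\<bar> + \<bar>?A x - ?A' x\<bar>) powr p"
      using p by (intro powr_mono2) auto
    also have "\<dots> \<le> (1 - w) powr (1 - p) * (?A x * \<bar>?b x y - ?b' x y\<bar>) powr p
        + w powr (1 - p) * \<bar>?A x - ?A' x\<bar> powr p"
      using p w by (intro add_powr_le) auto
    finally show ?thesis by (simp add: powr_mult)
  qed
  have "lp_loss p P (joint_comp qs u l)
      = (\<Sum>x\<in>UNIV. \<Sum>y\<in>UNIV. \<bar>pmf P (x, y) - pmf (joint_comp qs u l) (x, y)\<bar> powr p)"
    unfolding lp_loss_def by (simp add: sum.cartesian_product)
  also have "\<dots> \<le> (\<Sum>x\<in>UNIV. \<Sum>y\<in>UNIV. (1 - w) powr (1 - p) * (?A x powr p * \<bar>?b x y - ?b' x y\<bar> powr p)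
        + w powr (1 - p) * \<bar>?A x - ?A' x\<bar> powr p)"
    by (intro sum_mono pt)
  also have "\<dots> = (1 - w) powr (1 - p) * (\<Sum>x\<in>UNIV. ?A x powr p * lp_loss p (cond_law P x) (cond_comp qs l x))
      + w powr (1 - p) * real CARD('y) * lp_loss p (map_pmf fst P) (empirical (u @ map fst l))"
    by (simp add: lp_loss_def sum.distrib sum_distrib_left mult_ac)
  finally show ?thesis .
qed

lemma finite_set_semi_sample:
  "finite (set_pmf (semi_sample m n (P :: ('x::finite \<times> 'y::finite) pmf)))"
  by (simp add: semi_sample_def)

text \<open>
  The \<open>x\<close>-values of the unlabelled and of the labelled sample together form one sample from the marginal.
\<close>

lemma semi_sample_marginal_list:
  "map_pmf (\<lambda>(u, l). u @ map fst l) (semi_sample m n P) = replicate_pmf (n + m) (map_pmf fst P)"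
  unfolding semi_sample_def replicate_pmf_distrib map_replicate_pmf[where f = fst, symmetric]
  by (simp add: pair_pmf_def map_bind_pmf bind_map_pmf)

lemma expectation_semi_sample_labelled:
  fixes h :: "('x::finite \<times> 'y::finite) list \<Rightarrow> real"
  shows "measure_pmf.expectation (semi_sample m n P) (\<lambda>(u, l). h l)
           = measure_pmf.expectation (replicate_pmf m P) h"
proof -
  have "measure_pmf.expectation (map_pmf snd (semi_sample m n P)) h
      = measure_pmf.expectation (replicate_pmf m P) h"
    by (simp only: semi_sample_def map_snd_pair_pmf)
  then show ?thesis by (simp add: integral_map_pmf case_prod_beta')
qed

lemma conditional_risk_le:
  fixes P :: "('x::finite \<times> 'y::finite) pmf"
  assumes "0 \<le> p"
  shows "measure_pmf.expectation (replicate_pmf m P) (\<lambda>l. lp_loss p (cond_law P x) (cond_comp qs l x))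
           \<le> measure_pmf.expectation (binomial_pmf m (pmf (map_pmf fst P) x)) (\<lambda>k. max_risk p k (qs k))"
proof -
  let ?b = "cond_law P x" and ?a = "pmf (map_pmf fst P) x"
  have a: "?a \<in> {0..1}" by (simp add: pmf_le_1)
  have "measure_pmf.expectation (replicate_pmf m P) (\<lambda>l. lp_loss p ?b (cond_comp qs l x))
      = measure_pmf.expectation (binomial_pmf m ?a)
          (\<lambda>k. measure_pmf.expectation (replicate_pmf k ?b) (\<lambda>v. lp_loss p ?b (qs (length v) v)))"
    unfolding cond_comp_def
    by (rule expectation_cond_sample[where h = "\<lambda>v. lp_loss p ?b (qs (length v) v)"])
      (simp_all only: pmf_eq_marginal_times_cond)
  also have "\<dots> \<le> measure_pmf.expectation (binomial_pmf m ?a) (\<lambda>k. max_risk p k (qs k))"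
  proof (intro integral_mono integrable_binomial_pmf a)
    fix k
    have "measure_pmf.expectation (replicate_pmf k ?b) (\<lambda>v. lp_loss p ?b (qs (length v) v))
        = measure_pmf.expectation (replicate_pmf k ?b) (\<lambda>v. lp_loss p ?b (qs k v))"
      by (intro integral_cong_AE AE_pmfI) (auto simp: set_replicate_pmf)
    also have "\<dots> \<le> max_risk p k (qs k)"
      unfolding max_risk_def by (intro cSUP_upper max_risk_bdd assms) auto
    finally show "measure_pmf.expectation (replicate_pmf k ?b) (\<lambda>v. lp_loss p ?b (qs (length v) v))
        \<le> max_risk p k (qs k)" .
  qed
  finally show ?thesis .
qed

lemma joint_comp_risk_le:
  fixes P :: "('x::finite \<times> 'y::finite) pmf"
  assumes p: "1 \<le> p" and w: "0 < w" "w < 1"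
  shows "measure_pmf.expectation (semi_sample m n P) (\<lambda>(u, l). lp_loss p P (joint_comp qs u l))
    \<le> (1 - w) powr (1 - p) * (\<Sum>x\<in>UNIV. pmf (map_pmf fst P) x powr p *
          measure_pmf.expectation (binomial_pmf m (pmf (map_pmf fst P) x)) (\<lambda>k. max_risk p k (qs k)))
      + w powr (1 - p) * real CARD('y) *
          measure_pmf.expectation (replicate_pmf (n + m) (map_pmf fst P)) (\<lambda>v. lp_loss p (map_pmf fst P) (empirical v))"
proof -
  let ?S = "measure_pmf.expectation (semi_sample m n P)" and ?A = "pmf (map_pmf fst P)"
  have int: "integrable (measure_pmf (semi_sample m n P)) f" for f :: "_ \<Rightarrow> real"
    by (rule integrable_measure_pmf_finite[OF finite_set_semi_sample])
  have "?S (\<lambda>(u, l). lp_loss p P (joint_comp qs u l))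
      \<le> ?S (\<lambda>z. (1 - w) powr (1 - p) * (\<Sum>x\<in>UNIV. ?A x powr p * lp_loss p (cond_law P x) (cond_comp qs (snd z) x))
      + w powr (1 - p) * real CARD('y) * lp_loss p (map_pmf fst P) (empirical (fst z @ map fst (snd z))))"
    by (intro integral_mono int) (use joint_comp_loss_le[OF p w] in \<open>auto simp: case_prod_beta'\<close>)
  also have "\<dots> = (1 - w) powr (1 - p) * (\<Sum>x\<in>UNIV. ?A x powr p * ?S (\<lambda>z. lp_loss p (cond_law P x) (cond_comp qs (snd z) x)))
      + w powr (1 - p) * real CARD('y) * ?S (\<lambda>z. lp_loss p (map_pmf fst P) (empirical (fst z @ map fst (snd z))))"
    by (simp add: Bochner_Integration.integral_add[OF int int] Bochner_Integration.integral_sum[OF int])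
  also have "?S (\<lambda>z. lp_loss p (map_pmf fst P) (empirical (fst z @ map fst (snd z))))
      = measure_pmf.expectation (replicate_pmf (n + m) (map_pmf fst P)) (\<lambda>v. lp_loss p (map_pmf fst P) (empirical v))"
    using integral_map_pmf[of "\<lambda>(u, l). u @ map fst l" "semi_sample m n P" "\<lambda>v. lp_loss p (map_pmf fst P) (empirical v)"]
    by (simp only: semi_sample_marginal_list) (simp only: case_prod_beta')
  also have "(\<Sum>x\<in>UNIV. ?A x powr p * ?S (\<lambda>z. lp_loss p (cond_law P x) (cond_comp qs (snd z) x)))
      \<le> (\<Sum>x\<in>UNIV. ?A x powr p * measure_pmf.expectation (binomial_pmf m (?A x)) (\<lambda>k. max_risk p k (qs k)))"
  proof (intro sum_mono mult_left_mono)
    fix x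
    have "?S (\<lambda>z. lp_loss p (cond_law P x) (cond_comp qs (snd z) x))
        = measure_pmf.expectation (replicate_pmf m P) (\<lambda>l. lp_loss p (cond_law P x) (cond_comp qs l x))"
      using expectation_semi_sample_labelled[of m n P "\<lambda>l. lp_loss p (cond_law P x) (cond_comp qs l x)"]
      by (simp add: case_prod_beta')
    also have "\<dots> \<le> measure_pmf.expectation (binomial_pmf m (?A x)) (\<lambda>k. max_risk p k (qs k))"
      using p by (intro conditional_risk_le) auto
    finally show "?S (\<lambda>z. lp_loss p (cond_law P x) (cond_comp qs (snd z) x))
        \<le> measure_pmf.expectation (binomial_pmf m (?A x)) (\<lambda>k. max_risk p k (qs k))" .
  qed auto
  finally show ?thesis by (simp add: mult_left_mono)
qed

lemma max_risk_le_card: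
  fixes qh :: "'a::finite list \<Rightarrow> 'a pmf"
  assumes "0 \<le> p"
  shows "max_risk p n qh \<le> real CARD('a)"
  unfolding max_risk_def using assms
  by (intro cSUP_least) (auto intro!: expectation_bounds lp_loss_nonneg lp_loss_le)

text \<open>
  The weights \<open>a powr (p / 2)\<close> of the conditional errors sum to at most one because \<open>p \<ge> 2\<close>, and the
  error of the marginal is absorbed since \<open>m\<close> is \<open>o(n)\<close>.
\<close>

proposition joint_comp_max_risk_le:
  fixes qs :: "nat \<Rightarrow> 'y::finite list \<Rightarrow> 'y pmf" and m n :: "nat \<Rightarrow> nat"
  assumes p: "2 \<le> p" and R: "0 \<le> R" and \<epsilon>: "0 < \<epsilon>"
    and rate: "eventually (\<lambda>k. max_risk p k (qs k) \<le> R * real k powr (- p / 2)) sequentially"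
    and m: "filterlim m at_top sequentially" and mn: "(\<lambda>k. real (m k)) \<in> o(\<lambda>k. real (n k))"
  shows "eventually (\<lambda>k. semi_max_risk p (m k) (n k)
             (joint_comp qs :: 'x::finite list \<Rightarrow> ('x \<times> 'y) list \<Rightarrow> ('x \<times> 'y) pmf)
           \<le> (R + \<epsilon>) * real (m k) powr (- p / 2)) sequentially"
proof -
  define cX where "cX = real CARD('x)"
  have cX: "0 < cX" by (simp add: cX_def)
  define \<epsilon>1 where "\<epsilon>1 = \<epsilon> / (4 * cX)"
  have \<epsilon>1: "0 < \<epsilon>1" "cX * \<epsilon>1 = \<epsilon> / 4" using \<epsilon> cX by (auto simp: \<epsilon>1_def)
  have "(\<lambda>k. (1 - inverse (real (Suc (Suc k)))) powr (1 - p) * (R + \<epsilon> / 4)) \<longlonglongrightarrow> (1 - 0) powr (1 - p) * (R + \<epsilon> / 4)"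
    by (intro tendsto_intros LIMSEQ_Suc[OF LIMSEQ_inverse_real_of_nat]) auto
  then have "eventually (\<lambda>k. (1 - inverse (real (Suc (Suc k)))) powr (1 - p) * (R + \<epsilon> / 4) < R + \<epsilon> / 2) sequentially"
    using \<epsilon> by (intro order_tendstoD) auto
  then obtain j where j: "(1 - inverse (real (Suc (Suc j)))) powr (1 - p) * (R + \<epsilon> / 4) < R + \<epsilon> / 2"
    using eventually_happens'[OF sequentially_bot] by blast
  define w where "w = inverse (real (Suc (Suc j)))"
  have w: "0 < w" "w < 1" "(1 - w) powr (1 - p) * (R + \<epsilon> / 4) \<le> R + \<epsilon> / 2"
    using j by (auto simp: w_def field_simps)
  define CX where "CX = sharp_risk_const TYPE('x) p"
  define K where "K = w powr (1 - p) * real CARD('y) * \<bar>CX + 1\<bar>"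
  have K: "0 \<le> K" by (simp add: K_def)
  \<comment> \<open>If \<open>m \<le> c * n\<close>, then the error of the marginal is at most \<open>\<epsilon> / 2 * m powr (- p / 2)\<close>.\<close>
  define c where "c = (\<epsilon> / (2 * (K + 1))) powr (2 / p)"
  have c: "0 < c" using \<epsilon> K by (simp add: c_def)
  have cK: "K * c powr (p / 2) \<le> \<epsilon> / 2"
  proof -
    have "c powr (p / 2) = \<epsilon> / (2 * (K + 1))" using \<epsilon> K p by (simp add: c_def powr_powr)
    moreover have "K * (\<epsilon> / (2 * (K + 1))) \<le> (K + 1) * (\<epsilon> / (2 * (K + 1)))"
      using \<epsilon> K by (intro mult_right_mono) auto
    moreover have "d * (\<epsilon> / (2 * d)) = \<epsilon> / 2" if "0 < d" for d using that by simp
    from this[of "K + 1"] have "(K + 1) * (\<epsilon> / (2 * (K + 1))) = \<epsilon> / 2" using K by linarith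
    ultimately show ?thesis by (simp only:)
  qed
  have nm: "filterlim (\<lambda>k. n k + m k) at_top sequentially"
    by (rule filterlim_at_top_mono[OF m]) auto
  have ev1: "eventually (\<lambda>k. \<forall>a\<in>{0..1}. a powr p * measure_pmf.expectation (binomial_pmf (m k) a) (\<lambda>k. max_risk p k (qs k))
           \<le> (R * a powr (p / 2) + \<epsilon>1) * real (m k) powr (- p / 2)) sequentially"
    using p max_risk_le_card[of p _ "qs _"]
    by (intro eventually_compose_filterlim[OF thinned_risk_le m] R \<epsilon>1 rate) auto
  have ev2: "eventually (\<lambda>k. \<forall>q :: 'x pmf. measure_pmf.expectation (replicate_pmf (n k + m k) q) (\<lambda>v. lp_loss p q (empirical v))
             \<le> (CX + 1) * real (n k + m k) powr (- p / 2)) sequentially"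
    unfolding CX_def using p by (intro eventually_compose_filterlim[OF empirical_risk_le nm]) auto
  have ev3: "eventually (\<lambda>k. real (m k) \<le> c * real (n k)) sequentially"
    using landau_o.smallD[OF mn c] by simp
  have ev4: "eventually (\<lambda>k. 0 < m k) sequentially"
    using m by (rule eventually_compose_filterlim[OF eventually_gt_at_top])
  show ?thesis
    using ev1 ev2 ev3 ev4
  proof eventually_elim
    case (elim k)
    have mk: "0 < real (m k)" using elim(4) by simp
    have nk: "0 < real (n k)" using elim(3) mk c by (metis less_le_trans mult_pos_pos zero_less_mult_pos)
    have small: "K * real (n k + m k) powr (- p / 2) \<le> \<epsilon> / 2 * real (m k) powr (- p / 2)"
    proof -
      have "real (m k) / c \<le> real (n k)" using elim(3) c by (simp add: field_simps)
      then have "real (m k) / c \<le> real (n k + m k)" by simp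
      then have "real (n k + m k) powr (- p / 2) \<le> (real (m k) / c) powr (- p / 2)"
        using mk c p by (intro powr_mono2') auto
      also have "\<dots> = real (m k) powr (- p / 2) * c powr (p / 2)"
        using c by (simp add: powr_divide powr_minus field_simps)
      finally have "K * real (n k + m k) powr (- p / 2) \<le> K * (real (m k) powr (- p / 2) * c powr (p / 2))"
        using K by (rule mult_left_mono)
      also have "\<dots> = K * c powr (p / 2) * real (m k) powr (- p / 2)" by simp
      also have "\<dots> \<le> \<epsilon> / 2 * real (m k) powr (- p / 2)" using cK by (intro mult_right_mono) auto
      finally show ?thesis .
    qed
    have "measure_pmf.expectation (semi_sample (m k) (n k) P) (\<lambda>(u, l). lp_loss p P (joint_comp qs u l))
        \<le> (R + \<epsilon>) * real (m k) powr (- p / 2)" for P :: "('x \<times> 'y) pmf"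
    proof -
      let ?A = "pmf (map_pmf fst P)"
      let ?r = "real (m k) powr (- p / 2)"
      have sumA: "(\<Sum>x\<in>UNIV. ?A x) = 1" by (rule sum_pmf_eq_1) auto
      have "(\<Sum>x\<in>UNIV. ?A x powr p * measure_pmf.expectation (binomial_pmf (m k) (?A x)) (\<lambda>k. max_risk p k (qs k)))
          \<le> (\<Sum>x\<in>UNIV. (R * ?A x + \<epsilon>1) * ?r)"
      proof (rule sum_mono)
        fix x
        have A: "?A x \<in> {0..1}" by (simp add: pmf_le_1)
        then have "?A x powr p * measure_pmf.expectation (binomial_pmf (m k) (?A x)) (\<lambda>k. max_risk p k (qs k))
            \<le> (R * ?A x powr (p / 2) + \<epsilon>1) * ?r" using elim(1) by blast
        also have "\<dots> \<le> (R * ?A x + \<epsilon>1) * ?r"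
        proof (intro mult_right_mono add_right_mono mult_left_mono R)
          show "?A x powr (p / 2) \<le> ?A x"
            using powr_mono'[of 1 "p / 2" "?A x"] A p by simp
        qed auto
        finally show "?A x powr p * measure_pmf.expectation (binomial_pmf (m k) (?A x)) (\<lambda>k. max_risk p k (qs k))
            \<le> (R * ?A x + \<epsilon>1) * ?r" .
      qed
      also have "\<dots> = (R * (\<Sum>x\<in>UNIV. ?A x) + cX * \<epsilon>1) * ?r"
        by (simp add: sum.distrib cX_def flip: sum_distrib_left sum_distrib_right)
      also have "\<dots> = (R + \<epsilon> / 4) * ?r" by (simp only: sumA \<epsilon>1(2) mult_1_right)
      finally have T1: "(\<Sum>x\<in>UNIV. ?A x powr p * measure_pmf.expectation (binomial_pmf (m k) (?A x)) (\<lambda>k. max_risk p k (qs k)))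
          \<le> (R + \<epsilon> / 4) * ?r" .
      have "measure_pmf.expectation (replicate_pmf (n k + m k) (map_pmf fst P)) (\<lambda>v. lp_loss p (map_pmf fst P) (empirical v))
          \<le> (CX + 1) * real (n k + m k) powr (- p / 2)" using elim(2) by blast
      also have "\<dots> \<le> \<bar>CX + 1\<bar> * real (n k + m k) powr (- p / 2)" by (intro mult_right_mono) auto
      finally have "w powr (1 - p) * real CARD('y) *
            measure_pmf.expectation (replicate_pmf (n k + m k) (map_pmf fst P)) (\<lambda>v. lp_loss p (map_pmf fst P) (empirical v))
          \<le> w powr (1 - p) * real CARD('y) * (\<bar>CX + 1\<bar> * real (n k + m k) powr (- p / 2))"
        by (intro mult_left_mono) auto
      also have "\<dots> = K * real (n k + m k) powr (- p / 2)" by (simp add: K_def)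
      also note small
      finally have T2: "w powr (1 - p) * real CARD('y) *
            measure_pmf.expectation (replicate_pmf (n k + m k) (map_pmf fst P)) (\<lambda>v. lp_loss p (map_pmf fst P) (empirical v))
          \<le> \<epsilon> / 2 * ?r" .
      have "measure_pmf.expectation (semi_sample (m k) (n k) P) (\<lambda>(u, l). lp_loss p P (joint_comp qs u l))
          \<le> (1 - w) powr (1 - p) * ((R + \<epsilon> / 4) * ?r) + \<epsilon> / 2 * ?r"
        using p w by (intro order_trans[OF joint_comp_risk_le[of p w]] add_mono mult_left_mono T1 T2) auto
      also have "(1 - w) powr (1 - p) * ((R + \<epsilon> / 4) * ?r) \<le> (R + \<epsilon> / 2) * ?r"
        unfolding mult.assoc[symmetric] using w(3) by (intro mult_right_mono) auto
      finally show ?thesis by (simp add: algebra_simps)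
    qed
    then show ?case unfolding semi_max_risk_def by (intro cSUP_least) auto
  qed
qed

section \<open>First order optimality of the joint composition\<close>

lemma smallo_of_sharp_bounds:
  fixes f g a :: "nat \<Rightarrow> real"
  assumes C: "0 < C"
    and up: "\<And>\<epsilon>. 0 < \<epsilon> \<Longrightarrow> eventually (\<lambda>k. f k \<le> (C + \<epsilon>) * a k) sequentially"
    and lo: "\<And>\<epsilon>. 0 < \<epsilon> \<Longrightarrow> eventually (\<lambda>k. (C - \<epsilon>) * a k \<le> g k) sequentially"
    and gf: "\<And>k. g k \<le> f k" and a: "\<And>k. 0 \<le> a k"
  shows "(\<lambda>k. f k - g k) \<in> o(g)"
proof (rule landau_o.smallI)
  fix c :: real assume c: "0 < c"
  define \<epsilon> where "\<epsilon> = min (C / 2) (c * C / 4)"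
  have \<epsilon>: "0 < \<epsilon>" "\<epsilon> \<le> C / 2" "2 * \<epsilon> \<le> c * (C / 2)" using c C by (auto simp: \<epsilon>_def)
  show "eventually (\<lambda>k. norm (f k - g k) \<le> c * norm (g k)) sequentially"
    using up[OF \<epsilon>(1)] lo[OF \<epsilon>(1)]
  proof eventually_elim
    case (elim k)
    have "C / 2 * a k \<le> (C - \<epsilon>) * a k" using \<epsilon> by (intro mult_right_mono a) auto
    with elim(2) have g: "C / 2 * a k \<le> g k" by linarith
    have "f k - g k \<le> 2 * \<epsilon> * a k" using elim by (simp add: algebra_simps)
    also have "\<dots> \<le> c * (C / 2) * a k" using \<epsilon> by (intro mult_right_mono a) auto
    also have "\<dots> = c * (C / 2 * a k)" by (simp only: mult.assoc)
    also have "\<dots> \<le> c * g k" using g c by (intro mult_left_mono) auto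
    finally have "f k - g k \<le> c * g k" .
    moreover have "0 \<le> C / 2 * a k" using C a by simp
    then have "0 \<le> g k" using g by linarith
    ultimately show ?case using gf[of k] by simp
  qed
qed

lemma replicate_return_pmf: "replicate_pmf n (return_pmf x) = return_pmf (replicate n x)"
  by (induction n) (simp_all add: bind_return_pmf)

lemma risk_le_semi_max_risk:
  fixes Qh :: "'x::finite list \<Rightarrow> ('x \<times> 'y::finite) list \<Rightarrow> ('x \<times> 'y) pmf"
  assumes "0 \<le> p"
  shows "measure_pmf.expectation (semi_sample m n P) (\<lambda>(u, l). lp_loss p P (Qh u l)) \<le> semi_max_risk p m n Qh"
  unfolding semi_max_risk_def by (rule cSUP_upper[OF UNIV_I semi_max_risk_bdd(1)[OF assms]])

lemma semi_minimax_risk_le: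
  fixes Qh :: "'x::finite list \<Rightarrow> ('x \<times> 'y::finite) list \<Rightarrow> ('x \<times> 'y) pmf"
  assumes "0 \<le> p"
  shows "semi_minimax_risk TYPE('x) TYPE('y) p m n \<le> semi_max_risk p m n Qh"
  unfolding semi_minimax_risk_def
  by (rule cINF_lower) (auto intro!: bdd_belowI[where m = 0] semi_max_risk_bdd(2)[OF assms])

text \<open>
  If \<open>x\<close> is known to equal \<open>x0\<close>, then the unlabelled sample is constant, and a semi-supervised estimator
  becomes a univariate estimator from \<open>m\<close> samples. Its slice at \<open>x0\<close> may have mass less than one, and
  discarding the rest of the error can only decrease the loss.
\<close>

lemma coordinate_risk_le_semi_max_risk_point_mass:
  fixes Qh :: "'x::finite list \<Rightarrow> ('x \<times> 'y::finite) list \<Rightarrow> ('x \<times> 'y) pmf"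
  assumes p: "0 \<le> p"
  shows "(\<Sum>y\<in>UNIV. coordinate_risk p m
            (\<lambda>v y. pmf (Qh (replicate n x0) (map (Pair x0) v)) (x0, y)) y q) \<le> semi_max_risk p m n Qh"
proof -
  define P where "P = map_pmf (Pair x0) q"
  have "map_pmf fst P = return_pmf x0" by (simp add: P_def pmf.map_comp o_def map_pmf_const)
  then have S: "semi_sample m n P = map_pmf (\<lambda>v. (replicate n x0, map (Pair x0) v)) (replicate_pmf m q)"
    by (simp add: semi_sample_def replicate_return_pmf P_def pair_return_pmf1 pmf.map_comp o_def
        flip: map_replicate_pmf)
  have P: "pmf P (x0, y) = pmf q y" for y by (simp add: P_def pmf_map_inj' inj_def)
  have "(\<Sum>y\<in>UNIV. coordinate_risk p m (\<lambda>v y. pmf (Qh (replicate n x0) (map (Pair x0) v)) (x0, y)) y q)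
      = measure_pmf.expectation (replicate_pmf m q) (\<lambda>v. \<Sum>y\<in>UNIV.
          \<bar>pmf q y - pmf (Qh (replicate n x0) (map (Pair x0) v)) (x0, y)\<bar> powr p)"
    by (rule sum_coordinate_risk)
  also have "\<dots> \<le> measure_pmf.expectation (replicate_pmf m q)
      (\<lambda>v. lp_loss p P (Qh (replicate n x0) (map (Pair x0) v)))"
  proof (rule integral_mono)
    fix v
    let ?f = "\<lambda>z. \<bar>pmf P z - pmf (Qh (replicate n x0) (map (Pair x0) v)) z\<bar> powr p"
    have "(\<Sum>y\<in>UNIV. \<bar>pmf q y - pmf (Qh (replicate n x0) (map (Pair x0) v)) (x0, y)\<bar> powr p)
        = (\<Sum>z\<in>{x0} \<times> UNIV. ?f z)" by (simp only: sum_slice_fst P)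
    also have "\<dots> \<le> (\<Sum>z\<in>UNIV. ?f z)" by (intro sum_mono2) auto
    finally show "(\<Sum>y\<in>UNIV. \<bar>pmf q y - pmf (Qh (replicate n x0) (map (Pair x0) v)) (x0, y)\<bar> powr p)
        \<le> lp_loss p P (Qh (replicate n x0) (map (Pair x0) v))" by (simp add: lp_loss_def)
  qed (rule integrable_measure_pmf_finite[OF finite_set_replicate_pmf])+
  also have "\<dots> = measure_pmf.expectation (semi_sample m n P) (\<lambda>(u, l). lp_loss p P (Qh u l))"
    by (simp add: S integral_map_pmf)
  also have "\<dots> \<le> semi_max_risk p m n Qh" by (rule risk_le_semi_max_risk[OF p])
  finally show ?thesis .
qed

lemma semi_minimax_risk_ge_labelled:
  assumes p: "1 \<le> p" and \<epsilon>: "0 < \<epsilon>" and m: "filterlim m at_top sequentially"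
  shows "eventually (\<lambda>k. (sharp_risk_const TYPE('y::finite) p - \<epsilon>) * real (m k) powr (- p / 2)
           \<le> semi_minimax_risk TYPE('x::finite) TYPE('y) p (m k) (n k)) sequentially"
  using eventually_compose_filterlim[OF estimation_risk_ge[where 'a = 'y, OF p \<epsilon>] m]
proof eventually_elim
  case (elim k)
  show ?case
    unfolding semi_minimax_risk_def
  proof (rule cINF_greatest)
    fix Qh :: "'x list \<Rightarrow> ('x \<times> 'y) list \<Rightarrow> ('x \<times> 'y) pmf"
    show "(sharp_risk_const TYPE('y) p - \<epsilon>) * real (m k) powr (- p / 2) \<le> semi_max_risk p (m k) (n k) Qh"
      using p by (intro elim[rule_format, OF coordinate_risk_le_semi_max_risk_point_mass]) simp
  qed simp
qed

lemma pmf_singleton: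
  fixes P :: "('x::finite \<times> 'y::finite) pmf"
  assumes "UNIV = {y0 :: 'y}"
  shows "pmf P (x, y0) = pmf (map_pmf fst P) x"
  by (simp add: pmf_map_fst assms)

lemma lp_loss_singleton:
  fixes P Q :: "('x::finite \<times> 'y::finite) pmf"
  assumes "UNIV = {y0 :: 'y}"
  shows "lp_loss p P Q = lp_loss p (map_pmf fst P) (map_pmf fst Q)"
proof -
  have "lp_loss p P Q = (\<Sum>z\<in>UNIV \<times> {y0}. \<bar>pmf P z - pmf Q z\<bar> powr p)"
    unfolding lp_loss_def by (rule sum.cong) (use assms in auto)
  also have "\<dots> = (\<Sum>x\<in>UNIV. \<bar>pmf P (x, y0) - pmf Q (x, y0)\<bar> powr p)" by (rule sum_slice_snd)
  finally show ?thesis by (simp add: lp_loss_def pmf_singleton[OF assms])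
qed

lemma map_fst_joint_comp: "map_pmf fst (joint_comp qs u l) = empirical (u @ map fst l)"
  by (simp add: joint_comp_def map_bind_pmf pmf.map_comp o_def map_pmf_const bind_return_pmf')

text \<open>
  With a single label, labelled and unlabelled samples carry the same information, so a univariate sample
  of size \<open>n + m\<close> can be split into an unlabelled and a labelled part.
\<close>

lemma coordinate_risk_le_semi_max_risk_singleton:
  fixes Qh :: "'x::finite list \<Rightarrow> ('x \<times> 'y::finite) list \<Rightarrow> ('x \<times> 'y) pmf"
  assumes p: "0 \<le> p" and y0: "UNIV = {y0 :: 'y}"
  shows "(\<Sum>x\<in>UNIV. coordinate_risk p (n + m)
            (\<lambda>v x. pmf (Qh (take n v) (map (\<lambda>x. (x, y0)) (drop n v))) (x, y0)) x q) \<le> semi_max_risk p m n Qh"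
proof -
  define P where "P = map_pmf (\<lambda>x. (x, y0)) q"
  have fstP: "map_pmf fst P = q" by (simp add: P_def pmf.map_comp o_def)
  have P: "pmf P (x, y0) = pmf q x" for x using pmf_singleton[OF y0, of P x] by (simp add: fstP)
  have lists: "map (\<lambda>x. (x, y0)) (map fst l) = l" for l :: "('x \<times> 'y) list"
    using y0 by (induction l) auto
  let ?f = "\<lambda>u w. \<Sum>x\<in>UNIV. \<bar>pmf q x - pmf (Qh u (map (\<lambda>x. (x, y0)) w)) (x, y0)\<bar> powr p"
  have "(\<Sum>x\<in>UNIV. coordinate_risk p (n + m)
            (\<lambda>v x. pmf (Qh (take n v) (map (\<lambda>x. (x, y0)) (drop n v))) (x, y0)) x q)
      = measure_pmf.expectation (replicate_pmf (n + m) q) (\<lambda>v. ?f (take n v) (drop n v))"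
    by (rule sum_coordinate_risk)
  also have "\<dots> = measure_pmf.expectation (semi_sample m n P)
      (\<lambda>z. ?f (take n (fst z @ map fst (snd z))) (drop n (fst z @ map fst (snd z))))"
    unfolding semi_sample_marginal_list[of m n P, unfolded fstP, symmetric]
    by (simp only: integral_map_pmf case_prod_beta')
  also have "\<dots> = measure_pmf.expectation (semi_sample m n P) (\<lambda>(u, l). lp_loss p P (Qh u l))"
  proof (intro integral_cong_AE AE_pmfI)
    fix z assume "z \<in> set_pmf (semi_sample m n P)"
    then have "length (fst z) = n" by (auto simp: semi_sample_def set_replicate_pmf)
    then have "?f (take n (fst z @ map fst (snd z))) (drop n (fst z @ map fst (snd z)))
        = (\<Sum>x\<in>UNIV. \<bar>pmf P (x, y0) - pmf (Qh (fst z) (snd z)) (x, y0)\<bar> powr p)"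
      by (simp only: take_append drop_append) (simp add: lists P del: map_map)
    also have "\<dots> = lp_loss p P (Qh (fst z) (snd z))"
      unfolding lp_loss_singleton[OF y0] by (simp add: lp_loss_def pmf_singleton[OF y0])
    finally show "?f (take n (fst z @ map fst (snd z))) (drop n (fst z @ map fst (snd z)))
        = (case z of (u, l) \<Rightarrow> lp_loss p P (Qh u l))" by (simp only: case_prod_beta')
  qed auto
  also have "\<dots> \<le> semi_max_risk p m n Qh" by (rule risk_le_semi_max_risk[OF p])
  finally show ?thesis .
qed

lemma semi_minimax_risk_ge_singleton:
  assumes p: "1 \<le> p" and \<epsilon>: "0 < \<epsilon>" and nm: "filterlim (\<lambda>k. n k + m k) at_top sequentially"
    and y0: "UNIV = {y0 :: 'y::finite}"
  shows "eventually (\<lambda>k. (sharp_risk_const TYPE('x::finite) p - \<epsilon>) * real (n k + m k) powr (- p / 2)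
           \<le> semi_minimax_risk TYPE('x) TYPE('y) p (m k) (n k)) sequentially"
  using eventually_compose_filterlim[OF estimation_risk_ge[where 'a = 'x, OF p \<epsilon>] nm]
proof eventually_elim
  case (elim k)
  show ?case
    unfolding semi_minimax_risk_def
  proof (rule cINF_greatest)
    fix Qh :: "'x list \<Rightarrow> ('x \<times> 'y) list \<Rightarrow> ('x \<times> 'y) pmf"
    show "(sharp_risk_const TYPE('x) p - \<epsilon>) * real (n k + m k) powr (- p / 2) \<le> semi_max_risk p (m k) (n k) Qh"
      using p by (intro elim[rule_format, OF coordinate_risk_le_semi_max_risk_singleton[OF _ y0]]) simp
  qed simp
qed

lemma joint_comp_max_risk_le_singleton:
  assumes p: "0 < p" and \<epsilon>: "0 < \<epsilon>" and nm: "filterlim (\<lambda>k. n k + m k) at_top sequentially"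
    and y0: "UNIV = {y0 :: 'y::finite}"
  shows "eventually (\<lambda>k. semi_max_risk p (m k) (n k)
             (joint_comp qs :: 'x::finite list \<Rightarrow> ('x \<times> 'y) list \<Rightarrow> ('x \<times> 'y) pmf)
           \<le> (sharp_risk_const TYPE('x) p + \<epsilon>) * real (n k + m k) powr (- p / 2)) sequentially"
  using eventually_compose_filterlim[OF empirical_risk_le[where 'a = 'x, OF p \<epsilon>] nm]
proof eventually_elim
  case (elim k)
  show ?case
    unfolding semi_max_risk_def
  proof (rule cSUP_least)
    fix P :: "('x \<times> 'y) pmf"
    have "measure_pmf.expectation (semi_sample (m k) (n k) P) (\<lambda>(u, l). lp_loss p P (joint_comp qs u l))
        = measure_pmf.expectation (replicate_pmf (n k + m k) (map_pmf fst P)) (\<lambda>v. lp_loss p (map_pmf fst P) (empirical v))"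
      using integral_map_pmf[of "\<lambda>(u, l). u @ map fst l" "semi_sample (m k) (n k) P" "\<lambda>v. lp_loss p (map_pmf fst P) (empirical v)"]
      by (simp only: semi_sample_marginal_list lp_loss_singleton[OF y0] map_fst_joint_comp) (simp only: case_prod_beta')
    with elim show "measure_pmf.expectation (semi_sample (m k) (n k) P) (\<lambda>(u, l). lp_loss p P (joint_comp qs u l))
        \<le> (sharp_risk_const TYPE('x) p + \<epsilon>) * real (n k + m k) powr (- p / 2)" by simp
  qed simp
qed

text \<open>
  Being first order minimax optimal, the sequence is asymptotically at least as good as the
  empirical distribution.
\<close>

lemma minimax_optimal_rate:
  fixes qs :: "nat \<Rightarrow> 'y::finite list \<Rightarrow> 'y pmf"
  assumes p: "0 < p" and \<epsilon>: "0 < \<epsilon>"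
    and opt: "(\<lambda>N. max_risk p N (qs N) - minimax_risk TYPE('y) p N) \<in> o(\<lambda>N. minimax_risk TYPE('y) p N)"
  shows "eventually (\<lambda>N. max_risk p N (qs N)
           \<le> (sharp_risk_const TYPE('y) p + \<epsilon>) * real N powr (- p / 2)) sequentially"
proof -
  define C where "C = sharp_risk_const TYPE('y) p"
  have C: "0 \<le> C"
  proof -
    have "0 \<le> (\<Sum>a\<in>(UNIV :: 'y set). (pmf undefined a * (1 - pmf undefined a)) powr (p / 2))"
      by (intro sum_nonneg) auto
    also have "\<dots> \<le> (SUP q :: 'y pmf. \<Sum>a\<in>UNIV. (pmf q a * (1 - pmf q a)) powr (p / 2))"
      using p by (intro cSUP_upper multinomial_variance_powr_bdd) auto
    finally show ?thesis unfolding C_def sharp_risk_const_def using gauss_abs_moment_nonneg by simp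
  qed
  define c where "c = min 1 (\<epsilon> / (C + 2))"
  have c: "0 < c" "c \<le> 1" "c \<le> \<epsilon> / (C + 2)" using \<epsilon> C by (auto simp: c_def)
  then have c2: "c * (C + 2) \<le> \<epsilon>" using C by (simp add: pos_le_divide_eq)
  show ?thesis
    using landau_o.smallD[OF opt c(1)] empirical_risk_le[where 'a = 'y, OF p c(1)]
  proof eventually_elim
    case (elim N)
    have r0: "0 \<le> minimax_risk TYPE('y) p N"
      unfolding minimax_risk_def using p by (intro cINF_greatest max_risk_bdd(2)) auto
    have "minimax_risk TYPE('y) p N \<le> max_risk p N (empirical :: 'y list \<Rightarrow> 'y pmf)"
      unfolding minimax_risk_def
      by (rule cINF_lower) (use p in \<open>auto intro!: bdd_belowI[where m = 0] max_risk_bdd(2)\<close>)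
    also have "\<dots> \<le> (C + c) * real N powr (- p / 2)"
      unfolding max_risk_def using elim(2) by (intro cSUP_least) (auto simp: C_def)
    finally have r: "minimax_risk TYPE('y) p N \<le> (C + c) * real N powr (- p / 2)" .
    have "max_risk p N (qs N) \<le> (1 + c) * minimax_risk TYPE('y) p N"
      using elim(1) r0 by (simp add: algebra_simps abs_le_iff)
    also have "\<dots> \<le> (1 + c) * ((C + c) * real N powr (- p / 2))"
      using c r by (intro mult_left_mono) auto
    also have "\<dots> = ((1 + c) * (C + c)) * real N powr (- p / 2)" by simp
    also have "\<dots> \<le> (C + \<epsilon>) * real N powr (- p / 2)"
    proof (intro mult_right_mono)
      have "c * c \<le> c * 1" using c by (intro mult_left_mono) auto
      then have "(1 + c) * (C + c) \<le> C + c * (C + 2)" by (simp add: algebra_simps)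
      then show "(1 + c) * (C + c) \<le> C + \<epsilon>" using c2 by linarith
    qed simp
    finally show ?case by (simp add: C_def)
  qed
qed

theorem theorem4:
  fixes p :: real
    and qs :: "nat \<Rightarrow> 'y::finite list \<Rightarrow> 'y pmf"
    and m n :: "nat \<Rightarrow> nat"
  assumes "p \<ge> 2"
    and "(\<lambda>N. max_risk p N (qs N) - minimax_risk TYPE('y) p N)
           \<in> o(\<lambda>N. minimax_risk TYPE('y) p N)"
    and "filterlim m at_top sequentially"
    and "(\<lambda>k. real (m k)) \<in> o(\<lambda>k. real (n k))"
  shows "(\<lambda>k. semi_max_risk p (m k) (n k)
               (joint_comp qs :: 'x::finite list \<Rightarrow> ('x \<times> 'y) list \<Rightarrow> ('x \<times> 'y) pmf)
             - semi_minimax_risk TYPE('x) TYPE('y) p (m k) (n k))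
           \<in> o(\<lambda>k. semi_minimax_risk TYPE('x) TYPE('y) p (m k) (n k))"
proof -
  have p: "2 \<le> p" "1 \<le> p" "0 < p" "0 \<le> p" using assms(1) by auto
  have gf: "semi_minimax_risk TYPE('x) TYPE('y) p (m k) (n k)
      \<le> semi_max_risk p (m k) (n k) (joint_comp qs :: 'x list \<Rightarrow> ('x \<times> 'y) list \<Rightarrow> ('x \<times> 'y) pmf)" for k
    by (rule semi_minimax_risk_le[OF p(4)])
  show ?thesis
  proof (cases "2 \<le> CARD('y)")
    case True
    define C where "C = sharp_risk_const TYPE('y) p"
    have C: "0 < C" unfolding C_def by (rule sharp_risk_const_pos[OF p(4) True])
    show ?thesis
    proof (rule smallo_of_sharp_bounds[OF C _ _ gf])
      fix \<epsilon> :: real assume \<epsilon>: "0 < \<epsilon>"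
      then have e2: "0 < \<epsilon> / 2" by simp
      have "eventually (\<lambda>k. semi_max_risk p (m k) (n k)
             (joint_comp qs :: 'x list \<Rightarrow> ('x \<times> 'y) list \<Rightarrow> ('x \<times> 'y) pmf)
           \<le> ((C + \<epsilon> / 2) + \<epsilon> / 2) * real (m k) powr (- p / 2)) sequentially"
        using C e2 minimax_optimal_rate[OF p(3) e2 assms(2)] unfolding C_def[symmetric]
        by (intro joint_comp_max_risk_le p(1) assms(3,4)) auto
      moreover have "(C + \<epsilon> / 2) + \<epsilon> / 2 = C + \<epsilon>" by simp
      ultimately show "eventually (\<lambda>k. semi_max_risk p (m k) (n k)
             (joint_comp qs :: 'x list \<Rightarrow> ('x \<times> 'y) list \<Rightarrow> ('x \<times> 'y) pmf)
           \<le> (C + \<epsilon>) * real (m k) powr (- p / 2)) sequentially" by (simp only:)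
      show "eventually (\<lambda>k. (C - \<epsilon>) * real (m k) powr (- p / 2)
          \<le> semi_minimax_risk TYPE('x) TYPE('y) p (m k) (n k)) sequentially"
        unfolding C_def by (rule semi_minimax_risk_ge_labelled[OF p(2) \<epsilon> assms(3)])
    qed simp
  next
    case False
    have "0 < CARD('y)" by simp
    with False have "CARD('y) = 1" by linarith
    then obtain y0 where y0: "UNIV = {y0 :: 'y}" by (metis card_1_singletonE)
    have nm: "filterlim (\<lambda>k. n k + m k) at_top sequentially"
      by (rule filterlim_at_top_mono[OF assms(3)]) auto
    show ?thesis
    proof (cases "2 \<le> CARD('x)")
      case True
      define C where "C = sharp_risk_const TYPE('x) p"
      have C: "0 < C" unfolding C_def by (rule sharp_risk_const_pos[OF p(4) True])
      show ?thesis
        unfolding C_def[symmetric]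
        by (rule smallo_of_sharp_bounds[OF C _ _ gf, where a = "\<lambda>k. real (n k + m k) powr (- p / 2)"])
          (use joint_comp_max_risk_le_singleton[OF p(3) _ nm y0, where 'x = 'x]
             semi_minimax_risk_ge_singleton[OF p(2) _ nm y0, where 'x = 'x] in \<open>simp_all add: C_def\<close>)
    next
      case False
      have "0 < CARD('x)" by simp
      with False have "CARD('x) = 1" by linarith
      then obtain x0 where x0: "UNIV = {x0 :: 'x}" by (metis card_1_singletonE)
      have "lp_loss p P Q = 0" for P Q :: "('x \<times> 'y) pmf"
      proof -
        have one: "pmf q x0 = 1" for q
        proof -
          have "set_pmf q \<subseteq> {x0}" unfolding x0[symmetric] by (rule subset_UNIV)
          then show ?thesis using sum_pmf_eq_1[of "{x0}" q] by simp
        qed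
        show ?thesis unfolding lp_loss_singleton[OF y0] by (simp add: lp_loss_def x0 one)
      qed
      then have zero: "semi_max_risk p (m k) (n k) Qh = 0"
        for k and Qh :: "'x list \<Rightarrow> ('x \<times> 'y) list \<Rightarrow> ('x \<times> 'y) pmf"
        by (simp add: semi_max_risk_def case_prod_beta')
      then show ?thesis by (simp add: semi_minimax_risk_def)
    qed
  qed
qed

end
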